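(* There is a $^*$-homomorphism $\theta$ from the underlying $^*$-algebra $\mathcal P$ of Woronowicz's quantum group $SU_\nu(2)$, with $\nu=\lambda^{-1}$, to the dual $B$ of $(A,\Delta_A)$, given by $\theta(\alpha)=u_{11}$ and $\theta(\gamma)=u_{21}$. It is also a coalgebra homomorphism.
   Context: Let $t>0$ be real and $\lambda=\exp(t)$. $\mathfrak A_t$ is the unital complex $^*$-algebra generated by $e,f,q$ with $q$ invertible, subject to $qe=\lambda eq$, $qf=\lambda^{-1}fq$, $ef-fe=(\lambda-\lambda^{-1})^{-1}(q^2-q^{-2})$, with $e^*=f$, $q^*=q$; it is a Hopf $^*$-algebra with $\Delta(q)=q\otimes q$, $\Delta(e)=q\otimes e+e\otimes q^{-1}$, $\Delta(f)=q\otimes f+f\otimes q^{-1}$, $S(q)=q^{-1}$, $S(e)=-\lambda^{-1}e$, $S(f)=-\lambda f$. Let $I=\{0,\frac12,1,\dots\}$. For $n\in I$ let $\mathcal H_n$ be the Hilbert space with orthonormal basis $\xi(n,j)$, $j=-n,\dots,n$, and $\pi_n$ the irreducible $^*$-representation given by $\pi_n(q)\xi(n,j)=\lambda^j\xi(n,j)$, $\pi_n(e)\xi(n,j)=r_j\xi(n,j+1)$ ($j\neq n$), $\pi_n(e)\xi(n,n)=0$, $\pi_n(f)\xi(n,j)=r_{j-1}\xi(n,j-1)$ ($j\neq-n$), $\pi_n(f)\xi(n,-n)=0$, with $r_j>0$ for $-n\le j\le n-1$ determined by $r_n=0$ and $r_{j-1}^2-r_j^2=(\lambda-\lambda^{-1})^{-1}(\lambda^{2j}-\lambda^{-2j})$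 for $-n<j\le n$. $A_n$ is the $^*$-algebra of all linear operators on $\mathcal H_n$, $A=\bigoplus_{n\in I}A_n$ (algebraic direct sum), $M(A\otimes A)=\prod_{n,m}A_n\otimes A_m$. With $I_{nm}=\{|n-m|,\dots,n+m\}$, the coproduct $\Delta_A:A\to M(A\otimes A)$ is determined by: $\Delta_A(a)_{nm}=(\pi_n\otimes\pi_m)\Delta(x)$ if $a=(\pi_k(x))_{k\in I_{nm}}\in\bigoplus_{k\in I_{nm}}A_k$ with $x\in\mathfrak A_t$ (every element of this finite direct sum has this form, and the result does not depend on $x$), and $\Delta_A(a)_{nm}=0$ if $a\in A_k$, $k\notin I_{nm}$. $(A,\Delta_A)$ is a discrete quantum group; its antipode $S$ satisfies $S(\pi_n(x))=\pi_n(S(x))$, and its counit is $0$ on $A_k$ for $k\neq0$ and the identification $A_0\cong\mathbb C$ on $A_0$. $B=\widehat A$ is the dual of $(A,\Delta_A)$: the space of linear functionals on $A$ of the form $\varphi_A(\,\cdot\,a)$, $a\in A$, with $\varphi_A$ the left integral on $A$; as a vector space it is the direct sum $\bigoplus_k A_k'$, i.e. the functionals on $A$ vanishing on all but finitely many $A_k$. Write $\langle a,b\rangle=b(a)$. $B$ is a unital Hopf $^*$-algebra with $\langle a,bb'\rangle=\langle\Delta_A(a),b'\otimes b\rangle$, $\langle a\otimes a',\Delta(b)\rangle=\langle aa',b\rangle$, $\langle a,S(b)\rangle=\langle S^{-1}(a),b\rangle$, $\langle a,b^*\rangle=\overline{\langle S(a^* ),b\rangle}$; its unit is the counit of $A$,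 and its counit is $\varepsilon(b)=\langle 1,b\rangle$ with $1$ the identity of $M(A)$. The elements $u_{ij}\in B$ ($i,j\in\{1,2\}$) are defined by $\langle a,u_{ij}\rangle=a_{ij}$ for $a\in A_{\frac12}$, where $(a_{ij})$ is the matrix of $a$ with respect to the basis $(\xi(\frac12,\frac12),\xi(\frac12,-\frac12))$, and $\langle a,u_{ij}\rangle=0$ for $a$ in any other component $A_k$. $\mathcal P$ is the unital $^*$-algebra generated by $\alpha,\gamma$ subject to the relations expressing that $\begin{pmatrix}\alpha&-\nu\gamma^*\\ \gamma&\alpha^*\end{pmatrix}$ is unitary: $\alpha^*\alpha+\gamma^*\gamma=1$, $\alpha\alpha^*+\nu^2\gamma\gamma^*=1$, $\gamma\gamma^*=\gamma^*\gamma$, $\alpha\gamma=\nu\gamma\alpha$, $\alpha\gamma^*=\nu\gamma^*\alpha$, with coproduct $\Delta(\alpha)=\alpha\otimes\alpha-\nu\gamma^*\otimes\gamma$, $\Delta(\gamma)=\gamma\otimes\alpha+\alpha^*\otimes\gamma$ and counit $\varepsilon(\alpha)=1$, $\varepsilon(\gamma)=0$. *)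

theory Defs
  imports "Jordan_Normal_Form.Schur_Decomposition" "HOL-Algebra.Module"
begin

section \<open>Complex unital *-algebras\<close>

record 'a star_alg = "(complex, 'a) module" +
  star :: "'a \<Rightarrow> 'a"

definition linear_maps ::
  "(complex, 'a, 'c) module_scheme \<Rightarrow> (complex, 'b, 'd) module_scheme \<Rightarrow> ('a \<Rightarrow> 'b) set" where
  "linear_maps V W = {h \<in> carrier V \<rightarrow> carrier W.
     (\<forall>x\<in>carrier V. \<forall>y\<in>carrier V. h (x \<oplus>\<^bsub>V\<^esub> y) = h x \<oplus>\<^bsub>W\<^esub> h y) \<and>
     (\<forall>c. \<forall>x\<in>carrier V. h (c \<odot>\<^bsub>V\<^esub> x) = c \<odot>\<^bsub>W\<^esub> h x)}"

definition star_homs :: "'a star_alg \<Rightarrow> 'b star_alg \<Rightarrow> ('a \<Rightarrow> 'b) set" where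
  "star_homs V W = {h \<in> linear_maps V W \<inter> Ring.ring_hom V W.
     \<forall>x\<in>carrier V. h (star V x) = star W (h x)}"

definition antihoms :: "'a star_alg \<Rightarrow> 'b star_alg \<Rightarrow> ('a \<Rightarrow> 'b) set" where
  "antihoms V W = {h \<in> linear_maps V W.
     h \<one>\<^bsub>V\<^esub> = \<one>\<^bsub>W\<^esub> \<and>
     (\<forall>x\<in>carrier V. \<forall>y\<in>carrier V. h (x \<otimes>\<^bsub>V\<^esub> y) = h y \<otimes>\<^bsub>W\<^esub> h x)}"

definition complex_alg :: "complex star_alg" where
  "complex_alg = \<lparr>carrier = UNIV, monoid.mult = (*), one = 1, zero = 0, add = (+), module.smult = (*), star = cnj\<rparr>"


section \<open>Unital *-algebras given by generators and relations\<close>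

text \<open>The *-algebra generated by \<open>'x\<close> subject to a set \<open>R\<close> of equations is the algebra of
  formal expressions modulo the least congruence that contains \<open>R\<close> and the axioms of complex
  unital *-algebras.\<close>

datatype 'x expr =
    Gen 'x
  | EZero
  | EOne
  | EAdd "'x expr" "'x expr"  (infixl "\<boxplus>" 65)
  | EMul "'x expr" "'x expr"  (infixl "\<boxtimes>" 70)
  | EScale complex "'x expr"  (infixr "\<boxdot>" 75)
  | EStar "'x expr"

inductive expr_eq :: "('x expr \<times> 'x expr) set \<Rightarrow> 'x expr \<Rightarrow> 'x expr \<Rightarrow> bool"
  for R :: "('x expr \<times> 'x expr) set" where
  rel: "(x, y) \<in> R \<Longrightarrow> expr_eq R x y"
| refl: "expr_eq R x x"
| sym: "expr_eq R x y \<Longrightarrow> expr_eq R y x"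
| trans: "expr_eq R x y \<Longrightarrow> expr_eq R y z \<Longrightarrow> expr_eq R x z"
| cong_add: "expr_eq R x x' \<Longrightarrow> expr_eq R y y' \<Longrightarrow> expr_eq R (x \<boxplus> y) (x' \<boxplus> y')"
| cong_mul: "expr_eq R x x' \<Longrightarrow> expr_eq R y y' \<Longrightarrow> expr_eq R (x \<boxtimes> y) (x' \<boxtimes> y')"
| cong_scale: "expr_eq R x x' \<Longrightarrow> expr_eq R (c \<boxdot> x) (c \<boxdot> x')"
| cong_star: "expr_eq R x x' \<Longrightarrow> expr_eq R (EStar x) (EStar x')"
| add_assoc: "expr_eq R ((x \<boxplus> y) \<boxplus> z) (x \<boxplus> (y \<boxplus> z))"
| add_comm: "expr_eq R (x \<boxplus> y) (y \<boxplus> x)"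
| add_zero: "expr_eq R (x \<boxplus> EZero) x"
| add_inv: "expr_eq R (x \<boxplus> (-1) \<boxdot> x) EZero"
| scale_one: "expr_eq R (1 \<boxdot> x) x"
| scale_scale: "expr_eq R (c \<boxdot> d \<boxdot> x) ((c * d) \<boxdot> x)"
| scale_add: "expr_eq R (c \<boxdot> (x \<boxplus> y)) (c \<boxdot> x \<boxplus> c \<boxdot> y)"
| add_scale: "expr_eq R ((c + d) \<boxdot> x) (c \<boxdot> x \<boxplus> d \<boxdot> x)"
| mul_assoc: "expr_eq R ((x \<boxtimes> y) \<boxtimes> z) (x \<boxtimes> (y \<boxtimes> z))"
| one_mul: "expr_eq R (EOne \<boxtimes> x) x"
| mul_one: "expr_eq R (x \<boxtimes> EOne) x"
| mul_add: "expr_eq R (x \<boxtimes> (y \<boxplus> z)) (x \<boxtimes> y \<boxplus> x \<boxtimes> z)"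
| add_mul: "expr_eq R ((x \<boxplus> y) \<boxtimes> z) (x \<boxtimes> z \<boxplus> y \<boxtimes> z)"
| scale_mul: "expr_eq R ((c \<boxdot> x) \<boxtimes> y) (c \<boxdot> (x \<boxtimes> y))"
| mul_scale: "expr_eq R (x \<boxtimes> (c \<boxdot> y)) (c \<boxdot> (x \<boxtimes> y))"
| star_star: "expr_eq R (EStar (EStar x)) x"
| star_add: "expr_eq R (EStar (x \<boxplus> y)) (EStar x \<boxplus> EStar y)"
| star_mul: "expr_eq R (EStar (x \<boxtimes> y)) (EStar y \<boxtimes> EStar x)"
| star_scale: "expr_eq R (EStar (c \<boxdot> x)) (cnj c \<boxdot> EStar x)"

definition expr_rel :: "('x expr \<times> 'x expr) set \<Rightarrow> ('x expr \<times> 'x expr) set" where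
  "expr_rel R = {(x, y). expr_eq R x y}"

definition presented :: "('x expr \<times> 'x expr) set \<Rightarrow> 'x expr set star_alg" where
  "presented R = \<lparr>
     carrier = UNIV // expr_rel R,
     monoid.mult = (\<lambda>X Y. \<Union>x\<in>X. \<Union>y\<in>Y. expr_rel R `` {x \<boxtimes> y}),
     one = expr_rel R `` {EOne},
     zero = expr_rel R `` {EZero},
     add = (\<lambda>X Y. \<Union>x\<in>X. \<Union>y\<in>Y. expr_rel R `` {x \<boxplus> y}),
     module.smult = (\<lambda>c X. \<Union>x\<in>X. expr_rel R `` {c \<boxdot> x}),
     star = (\<lambda>X. \<Union>x\<in>X. expr_rel R `` {EStar x})\<rparr>"

definition gen :: "('x expr \<times> 'x expr) set \<Rightarrow> 'x \<Rightarrow> 'x expr set" where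
  "gen R g = expr_rel R `` {Gen g}"


section \<open>Algebraic tensor products\<close>

text \<open>A list \<open>[(v\<^sub>1, w\<^sub>1), \<dots>, (v\<^sub>k, w\<^sub>k)]\<close> stands for the formal sum
  \<open>v\<^sub>1 \<otimes> w\<^sub>1 + \<dots> + v\<^sub>k \<otimes> w\<^sub>k\<close>; scalars can be absorbed into the first factors.\<close>

inductive tensor_eq :: "'a star_alg \<Rightarrow> 'b star_alg \<Rightarrow> ('a \<times> 'b) list \<Rightarrow> ('a \<times> 'b) list \<Rightarrow> bool"
  for V :: "'a star_alg" and W :: "'b star_alg" where
  refl: "set xs \<subseteq> carrier V \<times> carrier W \<Longrightarrow> tensor_eq V W xs xs"
| sym: "tensor_eq V W xs ys \<Longrightarrow> tensor_eq V W ys xs"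
| trans: "tensor_eq V W xs ys \<Longrightarrow> tensor_eq V W ys zs \<Longrightarrow> tensor_eq V W xs zs"
| cong: "tensor_eq V W xs xs' \<Longrightarrow> tensor_eq V W ys ys' \<Longrightarrow> tensor_eq V W (xs @ ys) (xs' @ ys')"
| comm: "set xs \<subseteq> carrier V \<times> carrier W \<Longrightarrow> set ys \<subseteq> carrier V \<times> carrier W \<Longrightarrow>
    tensor_eq V W (xs @ ys) (ys @ xs)"
| add_left: "v \<in> carrier V \<Longrightarrow> v' \<in> carrier V \<Longrightarrow> w \<in> carrier W \<Longrightarrow>
    tensor_eq V W [(v \<oplus>\<^bsub>V\<^esub> v', w)] [(v, w), (v', w)]"
| add_right: "v \<in> carrier V \<Longrightarrow> w \<in> carrier W \<Longrightarrow> w' \<in> carrier W \<Longrightarrow>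
    tensor_eq V W [(v, w \<oplus>\<^bsub>W\<^esub> w')] [(v, w), (v, w')]"
| scale: "v \<in> carrier V \<Longrightarrow> w \<in> carrier W \<Longrightarrow>
    tensor_eq V W [(c \<odot>\<^bsub>V\<^esub> v, w)] [(v, c \<odot>\<^bsub>W\<^esub> w)]"
| zero: "w \<in> carrier W \<Longrightarrow> tensor_eq V W [(\<zero>\<^bsub>V\<^esub>, w)] []"

definition tensor_rel ::
  "'a star_alg \<Rightarrow> 'b star_alg \<Rightarrow> (('a \<times> 'b) list \<times> ('a \<times> 'b) list) set" where
  "tensor_rel V W = {(xs, ys). tensor_eq V W xs ys}"

definition tensor_alg :: "'a star_alg \<Rightarrow> 'b star_alg \<Rightarrow> ('a \<times> 'b) list set star_alg" where
  "tensor_alg V W = \<lparr>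
     carrier = {xs. set xs \<subseteq> carrier V \<times> carrier W} // tensor_rel V W,
     monoid.mult = (\<lambda>X Y. \<Union>xs\<in>X. \<Union>ys\<in>Y.
       tensor_rel V W `` {[(v \<otimes>\<^bsub>V\<^esub> v', w \<otimes>\<^bsub>W\<^esub> w'). (v, w) \<leftarrow> xs, (v', w') \<leftarrow> ys]}),
     one = tensor_rel V W `` {[(\<one>\<^bsub>V\<^esub>, \<one>\<^bsub>W\<^esub>)]},
     zero = tensor_rel V W `` {[]},
     add = (\<lambda>X Y. \<Union>xs\<in>X. \<Union>ys\<in>Y. tensor_rel V W `` {xs @ ys}),
     module.smult = (\<lambda>c X. \<Union>xs\<in>X. tensor_rel V W `` {[(c \<odot>\<^bsub>V\<^esub> v, w). (v, w) \<leftarrow> xs]}),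
     star = (\<lambda>X. \<Union>xs\<in>X. tensor_rel V W `` {[(star V v, star W w). (v, w) \<leftarrow> xs]})\<rparr>"

definition tensor :: "'a star_alg \<Rightarrow> 'b star_alg \<Rightarrow> 'a \<Rightarrow> 'b \<Rightarrow> ('a \<times> 'b) list set" where
  "tensor V W v w = tensor_rel V W `` {[(v, w)]}"

text \<open>\<open>tensor_map V' W' f g\<close> is the map \<open>f \<otimes> g\<close> into the tensor product of \<open>V'\<close> and \<open>W'\<close>, for
  linear maps \<open>f\<close> and \<open>g\<close>; \<open>tensor_functional f g\<close> is the functional \<open>f \<otimes> g\<close>, for linear
  functionals \<open>f\<close> and \<open>g\<close>.\<close>

definition tensor_map :: "'c star_alg \<Rightarrow> 'd star_alg \<Rightarrow> ('a \<Rightarrow> 'c) \<Rightarrow> ('b \<Rightarrow> 'd) \<Rightarrow>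
    ('a \<times> 'b) list set \<Rightarrow> ('c \<times> 'd) list set" where
  "tensor_map V' W' f g X = (\<Union>xs\<in>X. tensor_rel V' W' `` {[(f v, g w). (v, w) \<leftarrow> xs]})"

definition tensor_functional :: "('a \<Rightarrow> complex) \<Rightarrow> ('b \<Rightarrow> complex) \<Rightarrow>
    ('a \<times> 'b) list set \<Rightarrow> complex" where
  "tensor_functional f g X = the_elem ((\<lambda>xs. \<Sum>(v, w)\<leftarrow>xs. f v * g w) ` X)"

definition coalgebra_homs ::
  "'a star_alg \<Rightarrow> ('a \<Rightarrow> ('a \<times> 'a) list set) \<Rightarrow> ('a \<Rightarrow> complex) \<Rightarrow>
   'b star_alg \<Rightarrow> ('b \<Rightarrow> ('b \<times> 'b) list set) \<Rightarrow> ('b \<Rightarrow> complex) \<Rightarrow> ('a \<Rightarrow> 'b) set" where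
  "coalgebra_homs C \<Delta>C \<epsilon>C D \<Delta>D \<epsilon>D = {h \<in> linear_maps C D.
     \<forall>x\<in>carrier C. \<Delta>D (h x) = tensor_map D D h h (\<Delta>C x) \<and> \<epsilon>D (h x) = \<epsilon>C x}"


section \<open>The Hopf *-algebra generated by e, f, q\<close>

datatype uq_gen = Ge | Gf | Gq | Gqinv

definition uq_relations :: "real \<Rightarrow> (uq_gen expr \<times> uq_gen expr) set" where
  "uq_relations t = (
     let l = complex_of_real (exp t); e = Gen Ge; f = Gen Gf; q = Gen Gq; qi = Gen Gqinv
     in {(q \<boxtimes> qi, EOne), (qi \<boxtimes> q, EOne),
         (q \<boxtimes> e, l \<boxdot> (e \<boxtimes> q)),
         (q \<boxtimes> f, inverse l \<boxdot> (f \<boxtimes> q)),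
         (e \<boxtimes> f \<boxplus> (-1) \<boxdot> (f \<boxtimes> e),
            inverse (l - inverse l) \<boxdot> (q \<boxtimes> q \<boxplus> (-1) \<boxdot> (qi \<boxtimes> qi))),
         (EStar e, f), (EStar q, q)})"

definition uq :: "real \<Rightarrow> uq_gen expr set star_alg" where
  "uq t = presented (uq_relations t)"

abbreviation uq_el :: "real \<Rightarrow> uq_gen \<Rightarrow> uq_gen expr set" where
  "uq_el t g \<equiv> gen (uq_relations t) g"

definition uq_comult :: "real \<Rightarrow> uq_gen expr set \<Rightarrow> (uq_gen expr set \<times> uq_gen expr set) list set" where
  "uq_comult t = (
     let U = uq t; T = tensor_alg U U; e = uq_el t Ge; f = uq_el t Gf; q = uq_el t Gq; qi = uq_el t Gqinv
     in THE \<Delta>. \<Delta> \<in> star_homs U T \<inter> extensional (carrier U) \<and>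
          \<Delta> q = tensor U U q q \<and>
          \<Delta> e = tensor U U q e \<oplus>\<^bsub>T\<^esub> tensor U U e qi \<and>
          \<Delta> f = tensor U U q f \<oplus>\<^bsub>T\<^esub> tensor U U f qi)"

definition uq_antipode :: "real \<Rightarrow> uq_gen expr set \<Rightarrow> uq_gen expr set" where
  "uq_antipode t = (
     let U = uq t; l = complex_of_real (exp t)
     in THE S. S \<in> antihoms U U \<inter> extensional (carrier U) \<and>
          S (uq_el t Gq) = uq_el t Gqinv \<and>
          S (uq_el t Ge) = (- inverse l) \<odot>\<^bsub>U\<^esub> uq_el t Ge \<and>
          S (uq_el t Gf) = (- l) \<odot>\<^bsub>U\<^esub> uq_el t Gf)"


section \<open>The irreducible representations\<close>

text \<open>Throughout, a spin in \<open>{0, 1/2, 1, \<dots>}\<close> is represented by its double, a natural number \<open>n\<close>.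
  Operators on the corresponding \<open>(n+1)\<close>-dimensional Hilbert space are represented by their
  matrices with respect to the given orthonormal basis, whose vectors are numbered
  \<open>0, \<dots>, n\<close> in order of decreasing weight: the basis vector of index \<open>i\<close> has weight
  \<open>weight n i = n/2 - i\<close>, and \<open>e\<close> lowers the index.\<close>

definition op_alg :: "nat \<Rightarrow> complex mat star_alg" where
  "op_alg n = \<lparr>carrier = carrier_mat (n + 1) (n + 1), monoid.mult = (*), one = 1\<^sub>m (n + 1),
     zero = 0\<^sub>m (n + 1) (n + 1), add = (+), module.smult = (\<cdot>\<^sub>m), star = mat_adjoint\<rparr>"

definition weight :: "nat \<Rightarrow> nat \<Rightarrow> real" where
  "weight n i = real n / 2 - real i"

text \<open>\<open>rep_coeff t n i\<close> is the coefficient \<open>r\<^sub>j\<close> for \<open>j = weight n i\<close>, so \<open>Suc i\<close> belongs to \<open>j - 1\<close>.\<close>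

primrec rep_coeff :: "real \<Rightarrow> nat \<Rightarrow> nat \<Rightarrow> real" where
  "rep_coeff t n 0 = 0"
| "rep_coeff t n (Suc i) = sqrt ((rep_coeff t n i)\<^sup>2 +
     (exp t powr (2 * weight n i) - exp t powr (- 2 * weight n i)) / (exp t - inverse (exp t)))"

definition rep_q :: "real \<Rightarrow> nat \<Rightarrow> complex mat" where
  "rep_q t n = mat (n + 1) (n + 1)
     (\<lambda>(i, j). if i = j then complex_of_real (exp t powr weight n j) else 0)"

definition rep_e :: "real \<Rightarrow> nat \<Rightarrow> complex mat" where
  "rep_e t n = mat (n + 1) (n + 1)
     (\<lambda>(i, j). if j = i + 1 then complex_of_real (rep_coeff t n j) else 0)"

definition rep_f :: "real \<Rightarrow> nat \<Rightarrow> complex mat" where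
  "rep_f t n = mat (n + 1) (n + 1)
     (\<lambda>(i, j). if i = j + 1 then complex_of_real (rep_coeff t n (j + 1)) else 0)"

definition rep :: "real \<Rightarrow> nat \<Rightarrow> uq_gen expr set \<Rightarrow> complex mat" where
  "rep t n = (THE \<pi>. \<pi> \<in> star_homs (uq t) (op_alg n) \<inter> extensional (carrier (uq t)) \<and>
     \<pi> (uq_el t Gq) = rep_q t n \<and> \<pi> (uq_el t Ge) = rep_e t n \<and> \<pi> (uq_el t Gf) = rep_f t n)"


section \<open>The discrete quantum group A\<close>

text \<open>\<open>MA\<close> is the multiplier algebra \<open>M(A)\<close>, the full product of the algebras \<open>A\<^sub>n\<close>; the
  algebra \<open>A\<close> itself is its subspace \<open>A_set\<close>.\<close>

definition MA :: "(nat \<Rightarrow> complex mat) star_alg" where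
  "MA = \<lparr>carrier = {a. \<forall>n. a n \<in> carrier (op_alg n)},
     monoid.mult = (\<lambda>a b n. a n \<otimes>\<^bsub>op_alg n\<^esub> b n),
     one = (\<lambda>n. \<one>\<^bsub>op_alg n\<^esub>),
     zero = (\<lambda>n. \<zero>\<^bsub>op_alg n\<^esub>),
     add = (\<lambda>a b n. a n \<oplus>\<^bsub>op_alg n\<^esub> b n),
     module.smult = (\<lambda>c a n. c \<odot>\<^bsub>op_alg n\<^esub> a n),
     star = (\<lambda>a n. star (op_alg n) (a n))\<rparr>"

definition A_set :: "(nat \<Rightarrow> complex mat) set" where
  "A_set = {a \<in> carrier MA. finite {n. a n \<noteq> \<zero>\<^bsub>op_alg n\<^esub>}}"

definition component :: "nat \<Rightarrow> complex mat \<Rightarrow> nat \<Rightarrow> complex mat" where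
  "component k x = (\<lambda>n. if n = k then x else \<zero>\<^bsub>op_alg n\<^esub>)"

text \<open>In terms of doubled spins, \<open>{\<bar>n-m\<bar>, \<bar>n-m\<bar>+1, \<dots>, n+m}\<close> becomes the following set.\<close>

definition spins :: "nat \<Rightarrow> nat \<Rightarrow> nat set" where
  "spins n m = {k. \<bar>int n - int m\<bar> \<le> int k \<and> k \<le> n + m \<and> even (n + m + k)}"

text \<open>The component of \<open>\<Delta>\<^sub>A(a)\<close> in \<open>A\<^sub>n \<otimes> A\<^sub>m\<close>. The components \<open>a k\<close> with \<open>k \<notin> spins n m\<close> do not
  enter, that is, they contribute \<open>0\<close>.\<close>

definition A_comult :: "real \<Rightarrow> (nat \<Rightarrow> complex mat) \<Rightarrow> nat \<Rightarrow> nat \<Rightarrow>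
    (complex mat \<times> complex mat) list set" where
  "A_comult t a n m = (THE T. \<exists>x\<in>carrier (uq t). (\<forall>k\<in>spins n m. rep t k x = a k) \<and>
     T = tensor_map (op_alg n) (op_alg m) (rep t n) (rep t m) (uq_comult t x))"

definition A_antipode :: "real \<Rightarrow> (nat \<Rightarrow> complex mat) \<Rightarrow> nat \<Rightarrow> complex mat" where
  "A_antipode t a = (\<lambda>n. THE y. \<exists>x\<in>carrier (uq t). rep t n x = a n \<and>
     y = rep t n (uq_antipode t x))"

definition A_counit :: "(nat \<Rightarrow> complex mat) \<Rightarrow> complex" where
  "A_counit a = a 0 $$ (0, 0)"


section \<open>The dual B of A\<close>

definition blocks :: "((nat \<Rightarrow> complex mat) \<Rightarrow> complex) \<Rightarrow> nat set" where
  "blocks b = {k. \<exists>x\<in>carrier (op_alg k). b (component k x) \<noteq> 0}"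

definition B_set :: "((nat \<Rightarrow> complex mat) \<Rightarrow> complex) set" where
  "B_set = {b \<in> extensional A_set.
     (\<forall>a\<in>A_set. \<forall>a'\<in>A_set. b (a \<oplus>\<^bsub>MA\<^esub> a') = b a + b a') \<and>
     (\<forall>c. \<forall>a\<in>A_set. b (c \<odot>\<^bsub>MA\<^esub> a) = c * b a) \<and>
     finite (blocks b)}"

text \<open>The pairing of \<open>B \<otimes> B\<close> with \<open>M(A \<otimes> A)\<close> and of \<open>B\<close> with \<open>M(A)\<close>: only finitely many
  components matter.\<close>

definition pairing2 :: "(nat \<Rightarrow> nat \<Rightarrow> (complex mat \<times> complex mat) list set) \<Rightarrow>
    ((nat \<Rightarrow> complex mat) \<Rightarrow> complex) \<Rightarrow> ((nat \<Rightarrow> complex mat) \<Rightarrow> complex) \<Rightarrow> complex" where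
  "pairing2 X b c = (\<Sum>n\<in>blocks b. \<Sum>m\<in>blocks c.
     tensor_functional (\<lambda>x. b (component n x)) (\<lambda>x. c (component m x)) (X n m))"

definition pairingM :: "(nat \<Rightarrow> complex mat) \<Rightarrow> ((nat \<Rightarrow> complex mat) \<Rightarrow> complex) \<Rightarrow> complex" where
  "pairingM a b = (\<Sum>n\<in>blocks b. b (component n (a n)))"

text \<open>Note the flip in the product: \<open>\<langle>a, bb'\<rangle> = \<langle>\<Delta>\<^sub>A(a), b' \<otimes> b\<rangle>\<close>.\<close>

definition B_alg :: "real \<Rightarrow> ((nat \<Rightarrow> complex mat) \<Rightarrow> complex) star_alg" where
  "B_alg t = \<lparr>carrier = B_set,
     monoid.mult = (\<lambda>b b'. \<lambda>a\<in>A_set. pairing2 (A_comult t a) b' b),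
     one = restrict A_counit A_set,
     zero = (\<lambda>a\<in>A_set. 0),
     add = (\<lambda>b b'. \<lambda>a\<in>A_set. b a + b' a),
     module.smult = (\<lambda>c b. \<lambda>a\<in>A_set. c * b a),
     star = (\<lambda>b. \<lambda>a\<in>A_set. cnj (b (A_antipode t (star MA a))))\<rparr>"

definition B_comult :: "real \<Rightarrow> ((nat \<Rightarrow> complex mat) \<Rightarrow> complex) \<Rightarrow>
    (((nat \<Rightarrow> complex mat) \<Rightarrow> complex) \<times> ((nat \<Rightarrow> complex mat) \<Rightarrow> complex)) list set" where
  "B_comult t b = (THE T. T \<in> carrier (tensor_alg (B_alg t) (B_alg t)) \<and>
     (\<forall>a\<in>A_set. \<forall>a'\<in>A_set.
        tensor_functional (\<lambda>c. c a) (\<lambda>c. c a') T = b (a \<otimes>\<^bsub>MA\<^esub> a')))"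

definition B_counit :: "((nat \<Rightarrow> complex mat) \<Rightarrow> complex) \<Rightarrow> complex" where
  "B_counit b = pairingM \<one>\<^bsub>MA\<^esub> b"

text \<open>The matrix coefficients \<open>u\<^sub>i\<^sub>j\<close> of the spin 1/2 component, for \<open>i, j \<in> {1, 2}\<close>.\<close>

definition u :: "nat \<Rightarrow> nat \<Rightarrow> (nat \<Rightarrow> complex mat) \<Rightarrow> complex" where
  "u i j = (\<lambda>a\<in>A_set. a 1 $$ (i - 1, j - 1))"


section \<open>Woronowicz's quantum SU(2)\<close>

datatype su_gen = Galpha | Ggamma

definition su_relations :: "real \<Rightarrow> (su_gen expr \<times> su_gen expr) set" where
  "su_relations \<nu> = (
     let v = complex_of_real \<nu>; \<alpha> = Gen Galpha; \<gamma> = Gen Ggamma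
     in {(EStar \<alpha> \<boxtimes> \<alpha> \<boxplus> EStar \<gamma> \<boxtimes> \<gamma>, EOne),
         (\<alpha> \<boxtimes> EStar \<alpha> \<boxplus> v\<^sup>2 \<boxdot> (\<gamma> \<boxtimes> EStar \<gamma>), EOne),
         (\<gamma> \<boxtimes> EStar \<gamma>, EStar \<gamma> \<boxtimes> \<gamma>),
         (\<alpha> \<boxtimes> \<gamma>, v \<boxdot> (\<gamma> \<boxtimes> \<alpha>)),
         (\<alpha> \<boxtimes> EStar \<gamma>, v \<boxdot> (EStar \<gamma> \<boxtimes> \<alpha>))})"

definition su :: "real \<Rightarrow> su_gen expr set star_alg" where
  "su \<nu> = presented (su_relations \<nu>)"

definition su_alpha :: "real \<Rightarrow> su_gen expr set" where
  "su_alpha \<nu> = gen (su_relations \<nu>) Galpha"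

definition su_gamma :: "real \<Rightarrow> su_gen expr set" where
  "su_gamma \<nu> = gen (su_relations \<nu>) Ggamma"

definition su_comult :: "real \<Rightarrow> su_gen expr set \<Rightarrow> (su_gen expr set \<times> su_gen expr set) list set" where
  "su_comult \<nu> = (
     let P = su \<nu>; T = tensor_alg P P; \<alpha> = su_alpha \<nu>; \<gamma> = su_gamma \<nu>
     in THE \<Delta>. \<Delta> \<in> star_homs P T \<inter> extensional (carrier P) \<and>
          \<Delta> \<alpha> = tensor P P \<alpha> \<alpha> \<oplus>\<^bsub>T\<^esub> (- complex_of_real \<nu>) \<odot>\<^bsub>T\<^esub> tensor P P (star P \<gamma>) \<gamma> \<and>
          \<Delta> \<gamma> = tensor P P \<gamma> \<alpha> \<oplus>\<^bsub>T\<^esub> tensor P P (star P \<alpha>) \<gamma>)"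

definition su_counit :: "real \<Rightarrow> su_gen expr set \<Rightarrow> complex" where
  "su_counit \<nu> = (THE \<epsilon>. \<epsilon> \<in> star_homs (su \<nu>) complex_alg \<inter> extensional (carrier (su \<nu>)) \<and>
     \<epsilon> (su_alpha \<nu>) = 1 \<and> \<epsilon> (su_gamma \<nu>) = 0)"

end

theory Submission
  imports Defs
begin

text \<open>Write \<open>U\<close> for the algebra generated by \<open>e, f, q\<close>. A functional \<open>b\<close> in \<open>B\<close> induces a
  functional \<open>hat b\<close> on \<open>U\<close> by composition with the representations \<open>\<pi>\<^sub>n\<close>. This is injective since
  finitely many of the \<open>\<pi>\<^sub>n\<close> are jointly surjective, and it turns the product of \<open>B\<close> into the flipped
  convolution, because \<open>(\<pi>\<^sub>n \<otimes> \<pi>\<^sub>m)\<Delta>(x)\<close> depends only on the \<open>\<pi>\<^sub>k(x)\<close> with \<open>k\<close> in \<open>spins n m\<close>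
  (Clebsch-Gordan). All identities in \<open>B\<close> thereby become identities in \<open>U\<close> that can be checked on
  formal expressions. The relations of \<open>SU\<^sub>\<nu>(2)\<close> hold for the \<open>u\<^sub>i\<^sub>j\<close> because the vector
  \<open>\<xi>\<^sub>1 \<otimes> \<xi>\<^sub>2 - \<lambda> \<xi>\<^sub>2 \<otimes> \<xi>\<^sub>1\<close> in the tensor square of the spin 1/2 representation is invariant.\<close>


section \<open>Complex unital *-algebras\<close>

text \<open>Most maps in the statement are definite descriptions, so existence and uniqueness come
  before any property of them. For maps out of a presented algebra both follow from the universal
  property: \<Delta>, S and the \<pi>_n arise by exhibiting elements with the relations of U in U
  \<otimes> U, in a twisted copy of U and in matrix algebras. For \<Delta>_A the obstacle is that
  finitely many \<pi>_k(x) determine x only up to their common kernel. Clebsch-Gordan enters as the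
  statement that (\<pi>_n \<otimes> \<pi>_m)\<Delta> annihilates this kernel. It is obtained from a
  submodule argument instead of explicit coefficients: the vectors annihilated by the kernel form a
  submodule that contains the highest weight vectors, and a positivity argument shows that it is the
  whole space. Coproducts are taken of expressions instead of classes, where they are explicit
  finite lists of pairs; identities such as coassociativity then become equalities of finite sums,
  accessible to structural induction.\<close>

locale staralg =
  fixes V :: "'a star_alg" (structure)
  assumes add_closed [simp, intro]: "x \<in> carrier V \<Longrightarrow> y \<in> carrier V \<Longrightarrow> x \<oplus> y \<in> carrier V"
    and mult_closed [simp, intro]: "x \<in> carrier V \<Longrightarrow> y \<in> carrier V \<Longrightarrow> x \<otimes> y \<in> carrier V"
    and smult_closed [simp, intro]: "x \<in> carrier V \<Longrightarrow> c \<odot> x \<in> carrier V"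
    and star_closed [simp, intro]: "x \<in> carrier V \<Longrightarrow> star V x \<in> carrier V"
    and zero_closed [simp, intro]: "\<zero> \<in> carrier V"
    and one_closed [simp, intro]: "\<one> \<in> carrier V"
    and a_assoc: "x \<in> carrier V \<Longrightarrow> y \<in> carrier V \<Longrightarrow> z \<in> carrier V \<Longrightarrow> (x \<oplus> y) \<oplus> z = x \<oplus> (y \<oplus> z)"
    and a_comm: "x \<in> carrier V \<Longrightarrow> y \<in> carrier V \<Longrightarrow> x \<oplus> y = y \<oplus> x"
    and r_zero [simp]: "x \<in> carrier V \<Longrightarrow> x \<oplus> \<zero> = x"
    and r_neg [simp]: "x \<in> carrier V \<Longrightarrow> x \<oplus> (-1) \<odot> x = \<zero>"
    and smult_one [simp]: "x \<in> carrier V \<Longrightarrow> 1 \<odot> x = x"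
    and smult_smult [simp]: "x \<in> carrier V \<Longrightarrow> c \<odot> (d \<odot> x) = (c * d) \<odot> x"
    and smult_add: "x \<in> carrier V \<Longrightarrow> y \<in> carrier V \<Longrightarrow> c \<odot> (x \<oplus> y) = c \<odot> x \<oplus> c \<odot> y"
    and add_smult: "x \<in> carrier V \<Longrightarrow> (c + d) \<odot> x = c \<odot> x \<oplus> d \<odot> x"
    and m_assoc: "x \<in> carrier V \<Longrightarrow> y \<in> carrier V \<Longrightarrow> z \<in> carrier V \<Longrightarrow> (x \<otimes> y) \<otimes> z = x \<otimes> (y \<otimes> z)"
    and l_one [simp]: "x \<in> carrier V \<Longrightarrow> \<one> \<otimes> x = x"
    and r_one [simp]: "x \<in> carrier V \<Longrightarrow> x \<otimes> \<one> = x"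
    and r_distr: "x \<in> carrier V \<Longrightarrow> y \<in> carrier V \<Longrightarrow> z \<in> carrier V \<Longrightarrow> x \<otimes> (y \<oplus> z) = x \<otimes> y \<oplus> x \<otimes> z"
    and l_distr: "x \<in> carrier V \<Longrightarrow> y \<in> carrier V \<Longrightarrow> z \<in> carrier V \<Longrightarrow> (x \<oplus> y) \<otimes> z = x \<otimes> z \<oplus> y \<otimes> z"
    and smult_l: "x \<in> carrier V \<Longrightarrow> y \<in> carrier V \<Longrightarrow> (c \<odot> x) \<otimes> y = c \<odot> (x \<otimes> y)"
    and smult_r: "x \<in> carrier V \<Longrightarrow> y \<in> carrier V \<Longrightarrow> x \<otimes> (c \<odot> y) = c \<odot> (x \<otimes> y)"
    and star_star [simp]: "x \<in> carrier V \<Longrightarrow> star V (star V x) = x"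
    and star_add: "x \<in> carrier V \<Longrightarrow> y \<in> carrier V \<Longrightarrow> star V (x \<oplus> y) = star V x \<oplus> star V y"
    and star_mult: "x \<in> carrier V \<Longrightarrow> y \<in> carrier V \<Longrightarrow> star V (x \<otimes> y) = star V y \<otimes> star V x"
    and star_smult: "x \<in> carrier V \<Longrightarrow> star V (c \<odot> x) = cnj c \<odot> star V x"
begin

lemma l_zero [simp]: "x \<in> carrier V \<Longrightarrow> \<zero> \<oplus> x = x"
  by (metis a_comm r_zero zero_closed)

lemma a_lcomm: "x \<in> carrier V \<Longrightarrow> y \<in> carrier V \<Longrightarrow> z \<in> carrier V \<Longrightarrow> x \<oplus> (y \<oplus> z) = y \<oplus> (x \<oplus> z)"
  by (metis a_assoc a_comm)

lemmas a_ac = a_assoc a_comm a_lcomm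

lemma add_left_cancel:
  assumes "x \<in> carrier V" "y \<in> carrier V" "z \<in> carrier V" "x \<oplus> y = x \<oplus> z"
  shows "y = z"
proof -
  have "((-1) \<odot> x \<oplus> x) \<oplus> y = ((-1) \<odot> x \<oplus> x) \<oplus> z"
    using assms by (simp add: a_assoc)
  then show ?thesis using assms by (simp add: a_comm[of "(-1) \<odot> x" x])
qed

lemma smult_zero_left [simp]: "x \<in> carrier V \<Longrightarrow> 0 \<odot> x = \<zero>"
  using add_smult[of x 1 "-1"] by simp

lemma smult_zero_right [simp]: "c \<odot> \<zero> = \<zero>"
  using smult_smult[of \<zero> c 0] by simp

lemma star_one [simp]: "star V \<one> = \<one>"
  by (metis l_one one_closed star_closed star_mult star_star)

lemma star_zero [simp]: "star V \<zero> = \<zero>"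
  using star_smult[of \<zero> 0] by simp

lemma inverse_unique:
  assumes "x \<in> carrier V" "y \<in> carrier V" "z \<in> carrier V" "y \<otimes> x = \<one>" "x \<otimes> z = \<one>"
  shows "y = z"
  by (metis assms l_one m_assoc r_one)

end

lemma (in staralg) linear_map_zero:
  assumes "staralg W" "h \<in> linear_maps W V"
  shows "h \<zero>\<^bsub>W\<^esub> = \<zero>"
proof -
  have "h (0 \<odot>\<^bsub>W\<^esub> \<zero>\<^bsub>W\<^esub>) = 0 \<odot> h \<zero>\<^bsub>W\<^esub>" "h \<zero>\<^bsub>W\<^esub> \<in> carrier V"
    using assms staralg.zero_closed[OF assms(1)] by (auto simp: linear_maps_def)
  then show ?thesis using staralg.smult_zero_right[OF assms(1), of 0] by simp
qed

section \<open>Evaluation of expressions and the universal property of presented algebras\<close>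

primrec interp :: "'w star_alg \<Rightarrow> ('x \<Rightarrow> 'w) \<Rightarrow> 'x expr \<Rightarrow> 'w" where
  "interp W g (Gen a) = g a"
| "interp W g EZero = \<zero>\<^bsub>W\<^esub>"
| "interp W g EOne = \<one>\<^bsub>W\<^esub>"
| "interp W g (x \<boxplus> y) = interp W g x \<oplus>\<^bsub>W\<^esub> interp W g y"
| "interp W g (x \<boxtimes> y) = interp W g x \<otimes>\<^bsub>W\<^esub> interp W g y"
| "interp W g (c \<boxdot> x) = c \<odot>\<^bsub>W\<^esub> interp W g x"
| "interp W g (EStar x) = star W (interp W g x)"

lemma (in staralg) interp_closed [simp]:
  assumes "\<And>a. g a \<in> carrier V"
  shows "interp V g x \<in> carrier V"
  by (induction x) (auto simp: assms)

text \<open>The rules of \<open>expr_eq\<close> match the axioms of \<open>staralg\<close>, so rule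
  induction reduces everything to the relations in \<open>R\<close>.\<close>

lemma (in staralg) interp_cong:
  assumes g: "\<And>a. g a \<in> carrier V"
    and R: "\<And>x y. (x, y) \<in> R \<Longrightarrow> interp V g x = interp V g y"
    and "expr_eq R x y"
  shows "interp V g x = interp V g y"
  using assms(3)
proof induction
  case (add_comm x y)
  then show ?case using a_comm g by simp
qed (simp_all add: g R a_assoc smult_add add_smult m_assoc r_distr l_distr
  smult_l smult_r star_add star_mult star_smult)

definition cls :: "('x expr \<times> 'x expr) set \<Rightarrow> 'x expr \<Rightarrow> 'x expr set" where
  "cls R x = expr_rel R `` {x}"

lemma equiv_expr_rel: "equiv UNIV (expr_rel R)"
  unfolding expr_rel_def
  by (intro equivI) (auto simp: refl_on_def intro: symI transI expr_eq.refl expr_eq.sym expr_eq.trans)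

lemma cls_eq_iff: "cls R x = cls R y \<longleftrightarrow> expr_eq R x y"
  using eq_equiv_class_iff[OF equiv_expr_rel, of x y R] by (simp add: cls_def expr_rel_def)

lemma mem_cls_iff: "y \<in> cls R x \<longleftrightarrow> expr_eq R x y"
  by (simp add: cls_def expr_rel_def)

lemma gen_eq_cls: "gen R g = cls R (Gen g)"
  by (simp add: gen_def cls_def)

text \<open>The operations of \<open>presented\<close> are unions over representatives. Such a union
  collapses to one value when the function is constant on the class.\<close>

lemma Union_cls:
  assumes "\<And>y. expr_eq R x y \<Longrightarrow> F y = F x"
  shows "(\<Union>y\<in>cls R x. F y) = F x"
proof -
  have "F ` cls R x = (\<lambda>_. F x) ` cls R x"
    using assms by (intro image_cong) (auto simp only: mem_cls_iff)
  moreover have "cls R x \<noteq> {}" using expr_eq.refl mem_cls_iff by blast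
  ultimately show ?thesis by simp
qed

lemma carrier_presented: "carrier (presented R) = range (cls R)"
  by (auto simp: presented_def quotient_def cls_def)

lemma cls_closed [simp]: "cls R x \<in> carrier (presented R)"
  by (simp add: carrier_presented)

lemma presented_cases:
  assumes "X \<in> carrier (presented R)" obtains x where "X = cls R x"
  using assms by (auto simp: carrier_presented)

lemma presented_simps [simp]:
  "cls R x \<oplus>\<^bsub>presented R\<^esub> cls R y = cls R (x \<boxplus> y)"
  "cls R x \<otimes>\<^bsub>presented R\<^esub> cls R y = cls R (x \<boxtimes> y)"
  "c \<odot>\<^bsub>presented R\<^esub> cls R x = cls R (c \<boxdot> x)"
  "star (presented R) (cls R x) = cls R (EStar x)"
  "\<one>\<^bsub>presented R\<^esub> = cls R EOne"
  "\<zero>\<^bsub>presented R\<^esub> = cls R EZero"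
proof -
  have *: "(\<Union>x'\<in>cls R x. \<Union>y'\<in>cls R y. cls R (f x' y')) = cls R (f x y)"
    if "\<And>x' y'. expr_eq R x x' \<Longrightarrow> expr_eq R y y' \<Longrightarrow> expr_eq R (f x y) (f x' y')" for f
  proof -
    have "(\<Union>y'\<in>cls R y. cls R (f x' y')) = cls R (f x' y)" if "expr_eq R x x'" for x'
      using \<open>\<And>x' y'. expr_eq R x x' \<Longrightarrow> expr_eq R y y' \<Longrightarrow> expr_eq R (f x y) (f x' y')\<close> that
      by (intro Union_cls) (metis cls_eq_iff expr_eq.refl)
    then have "(\<Union>x'\<in>cls R x. \<Union>y'\<in>cls R y. cls R (f x' y')) = (\<Union>x'\<in>cls R x. cls R (f x' y))"
      by (simp add: mem_cls_iff)
    also have "\<dots> = cls R (f x y)"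
      using that by (intro Union_cls) (metis cls_eq_iff expr_eq.refl)
    finally show ?thesis .
  qed
  show "cls R x \<oplus>\<^bsub>presented R\<^esub> cls R y = cls R (x \<boxplus> y)"
    using *[of "(\<boxplus>)"] by (simp add: presented_def expr_eq.cong_add cls_def)
  show "cls R x \<otimes>\<^bsub>presented R\<^esub> cls R y = cls R (x \<boxtimes> y)"
    using *[of "(\<boxtimes>)"] by (simp add: presented_def expr_eq.cong_mul cls_def)
  have "(\<Union>y\<in>cls R x. cls R (c \<boxdot> y)) = cls R (c \<boxdot> x)"
    by (rule Union_cls) (simp add: cls_eq_iff expr_eq.cong_scale expr_eq.sym)
  then show "c \<odot>\<^bsub>presented R\<^esub> cls R x = cls R (c \<boxdot> x)"
    by (simp add: presented_def cls_def)
  have "(\<Union>y\<in>cls R x. cls R (EStar y)) = cls R (EStar x)"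
    by (rule Union_cls) (simp add: cls_eq_iff expr_eq.cong_star expr_eq.sym)
  then show "star (presented R) (cls R x) = cls R (EStar x)"
    by (simp add: presented_def cls_def)
qed (simp_all add: presented_def cls_def)

lemma staralg_presented: "staralg (presented R)"
proof
  fix x y assume "x \<in> carrier (presented R)" "y \<in> carrier (presented R)"
  then show "x \<oplus>\<^bsub>presented R\<^esub> y = y \<oplus>\<^bsub>presented R\<^esub> x"
    by (elim presented_cases) (simp add: cls_eq_iff expr_eq.add_comm)
qed ((elim presented_cases)?, simp add: cls_eq_iff expr_eq.add_assoc expr_eq.add_zero
  expr_eq.add_inv expr_eq.scale_one expr_eq.scale_scale expr_eq.scale_add expr_eq.add_scale
  expr_eq.mul_assoc expr_eq.one_mul expr_eq.mul_one expr_eq.mul_add expr_eq.add_mul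
  expr_eq.scale_mul expr_eq.mul_scale expr_eq.star_star expr_eq.star_add expr_eq.star_mul
  expr_eq.star_scale)+

text \<open>The map of the universal property. It is cut down to the carrier because the definite
  descriptions that it has to match ask for extensional maps.\<close>

definition lift :: "('x expr \<times> 'x expr) set \<Rightarrow> 'w star_alg \<Rightarrow> ('x \<Rightarrow> 'w) \<Rightarrow> 'x expr set \<Rightarrow> 'w" where
  "lift R W g = (\<lambda>X\<in>carrier (presented R). the_elem (interp W g ` X))"

lemma lift_extensional: "lift R W g \<in> extensional (carrier (presented R))"
  by (simp add: lift_def)

context staralg
begin

context
  fixes R :: "('x expr \<times> 'x expr) set" and g
  assumes g: "\<And>a. g a \<in> carrier V"
    and R: "\<And>x y. (x, y) \<in> R \<Longrightarrow> interp V g x = interp V g y"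
begin

lemma lift_cls: "lift R V g (cls R x) = interp V g x"
proof -
  have "cls R x \<noteq> {}" using expr_eq.refl mem_cls_iff by blast
  moreover have "interp V g y = interp V g x" if "y \<in> cls R x" for y
    using interp_cong[OF g R] that mem_cls_iff by metis
  ultimately have "the_elem (interp V g ` cls R x) = interp V g x"
    by (rule the_elem_image_unique)
  then show ?thesis by (simp add: lift_def)
qed

lemma lift_star_homs: "lift R V g \<in> star_homs (presented R) V"
  unfolding star_homs_def linear_maps_def Ring.ring_hom_def
  by (auto elim!: presented_cases simp: lift_cls g)

end

text \<open>This is the uniqueness half of the universal property: the values at the generators
  determine the map.\<close>

lemma star_hom_cls:
  assumes "h \<in> star_homs (presented R) V"
  shows "h (cls R x) = interp V (\<lambda>a. h (cls R (Gen a))) x"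
proof (induction x)
  case EZero
  then show ?case
    using linear_map_zero[OF staralg_presented, of h R] assms by (simp add: star_homs_def)
next
  case EOne
  then show ?case using assms by (simp add: star_homs_def Ring.ring_hom_def)
next
  case (EAdd x y)
  have "h (cls R (x \<boxplus> y)) = h (cls R x) \<oplus> h (cls R y)"
    using assms cls_closed[of R x] cls_closed[of R y]
    by (simp add: star_homs_def linear_maps_def flip: presented_simps(1))
  then show ?case using EAdd by simp
next
  case (EMul x y)
  have "h (cls R (x \<boxtimes> y)) = h (cls R x) \<otimes> h (cls R y)"
    using assms cls_closed[of R x] cls_closed[of R y]
    by (simp add: star_homs_def Ring.ring_hom_def flip: presented_simps(2))
  then show ?case using EMul by simp
next
  case (EScale c x)
  have "h (cls R (c \<boxdot> x)) = c \<odot> h (cls R x)"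
    using assms cls_closed[of R x]
    by (simp add: star_homs_def linear_maps_def flip: presented_simps(3))
  then show ?case using EScale by simp
next
  case (EStar x)
  have "h (cls R (EStar x)) = star V (h (cls R x))"
    using assms cls_closed[of R x]
    by (simp add: star_homs_def flip: presented_simps(4))
  then show ?case using EStar by simp
qed simp

lemma star_hom_eqI:
  assumes "h \<in> star_homs (presented R) V" "h' \<in> star_homs (presented R) V"
    and "h \<in> extensional (carrier (presented R))" "h' \<in> extensional (carrier (presented R))"
    and "\<And>a. h (cls R (Gen a)) = h' (cls R (Gen a))"
  shows "h = h'"
proof (rule extensionalityI[OF assms(3,4)])
  fix X assume "X \<in> carrier (presented R)"
  then obtain x where "X = cls R x" by (rule presented_cases)
  moreover have "h (cls R x) = h' (cls R x)"
  proof -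
    have "h (cls R x) = interp V (\<lambda>a. h' (cls R (Gen a))) x"
      using star_hom_cls[OF assms(1), of x] unfolding assms(5) .
    also have "\<dots> = h' (cls R x)"
      by (rule star_hom_cls[OF assms(2), symmetric])
    finally show ?thesis .
  qed
  ultimately show "h X = h' X" by simp
qed

end


section \<open>Tensor products of *-algebras\<close>

lemma tensor_eq_valid:
  assumes "tensor_eq V W xs ys" "staralg V" "staralg W"
  shows "set xs \<subseteq> carrier V \<times> carrier W \<and> set ys \<subseteq> carrier V \<times> carrier W"
  using assms(1)
proof induction
  case (add_left v v' w)
  then show ?case using staralg.add_closed[OF assms(2)] by auto
next
  case (add_right v w w')
  then show ?case using staralg.add_closed[OF assms(3)] by auto
next
  case (scale v w c)
  then show ?case using staralg.smult_closed[OF assms(3)] staralg.smult_closed[OF assms(2)] by auto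
next
  case (zero w)
  then show ?case using staralg.zero_closed[OF assms(2)] by auto
qed auto

text \<open>The twist \<sigma> of the scalars lets one induction serve both pairs of linear maps,
  with \<sigma> the identity, and the pair of involutions, with \<sigma> =
  \<open>cnj\<close>.\<close>

lemma tensor_eq_map:
  assumes V: "staralg V" "staralg W" "staralg V'" "staralg W'"
    and f: "\<And>v. v \<in> carrier V \<Longrightarrow> f v \<in> carrier V'" "\<And>w. w \<in> carrier W \<Longrightarrow> g w \<in> carrier W'"
    and fadd: "\<And>v v'. v \<in> carrier V \<Longrightarrow> v' \<in> carrier V \<Longrightarrow> f (v \<oplus>\<^bsub>V\<^esub> v') = f v \<oplus>\<^bsub>V'\<^esub> f v'"
    and gadd: "\<And>w w'. w \<in> carrier W \<Longrightarrow> w' \<in> carrier W \<Longrightarrow> g (w \<oplus>\<^bsub>W\<^esub> w') = g w \<oplus>\<^bsub>W'\<^esub> g w'"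
    and fsmult: "\<And>c v. v \<in> carrier V \<Longrightarrow> f (c \<odot>\<^bsub>V\<^esub> v) = \<sigma> c \<odot>\<^bsub>V'\<^esub> f v"
    and gsmult: "\<And>c w. w \<in> carrier W \<Longrightarrow> g (c \<odot>\<^bsub>W\<^esub> w) = \<sigma> c \<odot>\<^bsub>W'\<^esub> g w"
    and "tensor_eq V W xs ys"
  shows "tensor_eq V' W' (map (\<lambda>(v, w). (f v, g w)) xs) (map (\<lambda>(v, w). (f v, g w)) ys)"
  using assms(11)
proof induction
  case (refl xs)
  then show ?case using f by (intro tensor_eq.refl) auto
next
  case (sym xs ys)
  show ?case using sym.IH by (rule tensor_eq.sym)
next
  case (trans xs ys zs)
  show ?case using trans.IH by (rule tensor_eq.trans)
next
  case (cong xs xs' ys ys')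
  then show ?case by (simp add: tensor_eq.cong)
next
  case (comm xs ys)
  then show ?case using f by (simp, intro tensor_eq.comm) auto
next
  case (add_left v v' w)
  then show ?case using f fadd tensor_eq.add_left[of "f v" V' "f v'" "g w" W'] by simp
next
  case (add_right v w w')
  then show ?case using f gadd tensor_eq.add_right[of "f v" V' "g w" W' "g w'"] by simp
next
  case (scale v w c)
  then show ?case using f fsmult gsmult tensor_eq.scale[of "f v" V' "g w" W' "\<sigma> c"] by simp
next
  case (zero w)
  \<comment> \<open>Nothing is known about \<sigma> 0, so that f preserves zero is derived from
    additivity and cancellation.\<close>
  have "f \<zero>\<^bsub>V\<^esub> \<oplus>\<^bsub>V'\<^esub> f \<zero>\<^bsub>V\<^esub> = f \<zero>\<^bsub>V\<^esub> \<oplus>\<^bsub>V'\<^esub> \<zero>\<^bsub>V'\<^esub>"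
    using fadd[of "\<zero>\<^bsub>V\<^esub>" "\<zero>\<^bsub>V\<^esub>"] V f(1)[of "\<zero>\<^bsub>V\<^esub>"] by (simp add: staralg.zero_closed staralg.r_zero)
  then have "f \<zero>\<^bsub>V\<^esub> = \<zero>\<^bsub>V'\<^esub>"
    using staralg.add_left_cancel[OF V(3)] f(1) V by (metis staralg.zero_closed)
  then show ?case using zero f tensor_eq.zero[of "g w" W' V'] by simp
qed

definition tcls :: "'a star_alg \<Rightarrow> 'b star_alg \<Rightarrow> ('a \<times> 'b) list \<Rightarrow> ('a \<times> 'b) list set" where
  "tcls V W xs = tensor_rel V W `` {xs}"

lemma tensor_eq_tcls: "tensor V W v w = tcls V W [(v, w)]"
  by (simp add: tensor_def tcls_def)

lemma mem_tcls_iff: "ys \<in> tcls V W xs \<longleftrightarrow> tensor_eq V W xs ys"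
  by (simp add: tcls_def tensor_rel_def)

section \<open>Multiplication of formal sums of simple tensors\<close>

definition tprod :: "'a star_alg \<Rightarrow> 'b star_alg \<Rightarrow> ('a \<times> 'b) list \<Rightarrow> ('a \<times> 'b) list \<Rightarrow> ('a \<times> 'b) list" where
  "tprod V W xs ys = [(v \<otimes>\<^bsub>V\<^esub> v', w \<otimes>\<^bsub>W\<^esub> w'). (v, w) \<leftarrow> xs, (v', w') \<leftarrow> ys]"

lemma tprod_Nil [simp]: "tprod V W [] ys = []"
  by (simp add: tprod_def)

lemma tprod_Cons: "tprod V W ((v, w) # xs) ys =
  map (\<lambda>(v', w'). (v \<otimes>\<^bsub>V\<^esub> v', w \<otimes>\<^bsub>W\<^esub> w')) ys @ tprod V W xs ys"
  by (simp add: tprod_def)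

lemma tprod_append: "tprod V W (xs @ xs') ys = tprod V W xs ys @ tprod V W xs' ys"
  by (simp add: tprod_def)

locale tensor_pair = V: staralg V + W: staralg W
  for V :: "'a star_alg" and W :: "'b star_alg"
begin

abbreviation valid :: "('a \<times> 'b) list \<Rightarrow> bool" where
  "valid xs \<equiv> set xs \<subseteq> carrier V \<times> carrier W"

abbreviation teq (infix "\<approx>" 50) where "xs \<approx> ys \<equiv> tensor_eq V W xs ys"

lemma valid: assumes "xs \<approx> ys" shows "valid xs" "valid ys"
  using tensor_eq_valid[OF assms V.staralg_axioms W.staralg_axioms] by auto

lemma tcls_eqI: "xs \<approx> ys \<Longrightarrow> tcls V W xs = tcls V W ys"
  by (auto simp: tcls_def tensor_rel_def intro: tensor_eq.sym tensor_eq.trans)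

text \<open>Distributivity and the reversal of products under star hold for lists only up to order;
  this lemma turns them into equalities of tensors.\<close>

lemma tensor_eq_mset:
  assumes "mset xs = mset ys" "valid xs"
  shows "xs \<approx> ys"
  using assms
proof (induction xs arbitrary: ys)
  case Nil
  then show ?case by (simp add: tensor_eq.refl)
next
  case (Cons x xs)
  then have "x \<in> set ys" by (metis list.set_intros(1) set_mset_mset)
  then obtain as bs where ys: "ys = as @ x # bs" by (meson split_list)
  then have m: "mset xs = mset (as @ bs)" using Cons.prems(1) by simp
  then have vab: "valid (as @ bs)" using Cons.prems(2)
    by (metis list.set_intros(2) set_mset_mset subset_iff)
  have "[x] @ xs \<approx> [x] @ (as @ bs)"
    using Cons m by (intro tensor_eq.cong tensor_eq.refl) auto
  moreover have "([x] @ as) @ bs \<approx> (as @ [x]) @ bs"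
    using vab Cons.prems(2) by (intro tensor_eq.cong tensor_eq.comm tensor_eq.refl) auto
  ultimately show ?case using ys tensor_eq.trans by force
qed

lemma tensor_eq_concat_map:
  assumes "\<And>x. x \<in> set xs \<Longrightarrow> f x \<approx> g x"
  shows "concat (map f xs) \<approx> concat (map g xs)"
  using assms by (induction xs) (auto intro: tensor_eq.cong tensor_eq.refl)

lemma tensor_scale_left:
  assumes "v \<in> carrier V" "w \<in> carrier W"
  shows "tcls V W [(c \<odot>\<^bsub>V\<^esub> v, w)] = tcls V W [(v, c \<odot>\<^bsub>W\<^esub> w)]"
  using assms by (intro tcls_eqI tensor_eq.scale)

lemma tprod_valid: "valid xs \<Longrightarrow> valid ys \<Longrightarrow> valid (tprod V W xs ys)"
  by (auto simp: tprod_def)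

lemma tprod_Nil2 [simp]: "tprod V W xs [] = []"
  by (induction xs) (auto simp: tprod_Cons)

lemma mset_tprod_append2: "mset (tprod V W xs (ys @ ys')) = mset (tprod V W xs ys @ tprod V W xs ys')"
  by (induction xs) (auto simp: tprod_Cons)

lemma mset_tprod_Cons2: "mset (tprod V W xs ((v, w) # ys)) =
    mset (map (\<lambda>(v', w'). (v' \<otimes>\<^bsub>V\<^esub> v, w' \<otimes>\<^bsub>W\<^esub> w)) xs @ tprod V W xs ys)"
  by (induction xs) (auto simp: tprod_Cons)

text \<open>Left multiplication by one simple tensor is a pair of linear maps, so
  \<open>tensor_eq_map\<close> settles each row of the product list.\<close>

lemma tprod_cong_right:
  assumes "valid xs" "ys \<approx> ys'"
  shows "tprod V W xs ys \<approx> tprod V W xs ys'"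
  using assms(1)
proof (induction xs)
  case (Cons x xs)
  obtain v w where x: "x = (v, w)" by force
  have "map (\<lambda>(v', w'). (v \<otimes>\<^bsub>V\<^esub> v', w \<otimes>\<^bsub>W\<^esub> w')) ys \<approx> map (\<lambda>(v', w'). (v \<otimes>\<^bsub>V\<^esub> v', w \<otimes>\<^bsub>W\<^esub> w')) ys'"
    using Cons.prems x assms(2) V.staralg_axioms W.staralg_axioms
    by (intro tensor_eq_map[where \<sigma> = "\<lambda>c. c"]) (auto simp: V.r_distr W.r_distr V.smult_r W.smult_r)
  then show ?case using Cons x by (simp add: tprod_Cons tensor_eq.cong)
qed (simp add: tensor_eq.refl)

text \<open>The product list is ordered by its left factor. The entries belonging to one element of
  \<open>ys\<close> are gathered by a rearrangement, after which \<open>tensor_eq_map\<close>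
  applies as on the other side.\<close>

lemma tprod_cong_left:
  assumes "valid ys" "xs \<approx> xs'"
  shows "tprod V W xs ys \<approx> tprod V W xs' ys"
  using assms(1)
proof (induction ys)
  case (Cons y ys)
  obtain v w where y: "y = (v, w)" by force
  let ?m = "map (\<lambda>(v', w'). (v' \<otimes>\<^bsub>V\<^esub> v, w' \<otimes>\<^bsub>W\<^esub> w))"
  have "?m xs \<approx> ?m xs'"
    using Cons.prems y assms(2) V.staralg_axioms W.staralg_axioms
    by (intro tensor_eq_map[where \<sigma> = "\<lambda>c. c"]) (auto simp: V.l_distr W.l_distr V.smult_l W.smult_l)
  then have "?m xs @ tprod V W xs ys \<approx> ?m xs' @ tprod V W xs' ys"
    using Cons by (intro tensor_eq.cong) auto
  moreover have "tprod V W xs (y # ys) \<approx> ?m xs @ tprod V W xs ys"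
    using y mset_tprod_Cons2 tprod_valid valid(1)[OF assms(2)] Cons.prems by (intro tensor_eq_mset) auto
  moreover have "tprod V W xs' (y # ys) \<approx> ?m xs' @ tprod V W xs' ys"
    using y mset_tprod_Cons2 tprod_valid valid(2)[OF assms(2)] Cons.prems by (intro tensor_eq_mset) auto
  ultimately show ?case by (meson tensor_eq.sym tensor_eq.trans)
qed (simp add: tensor_eq.refl)

text \<open>Both sides enumerate the triple products lexicographically, so the lists themselves
  agree.\<close>

lemma tprod_assoc:
  assumes "valid xs" "valid ys" "valid zs"
  shows "tprod V W (tprod V W xs ys) zs = tprod V W xs (tprod V W ys zs)"
  using assms(1)
proof (induction xs)
  case (Cons x xs)
  obtain v w where x: "x = (v, w)" by force
  have "tprod V W (map (\<lambda>(v', w'). (v \<otimes>\<^bsub>V\<^esub> v', w \<otimes>\<^bsub>W\<^esub> w')) ys) zs =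
      map (\<lambda>(v', w'). (v \<otimes>\<^bsub>V\<^esub> v', w \<otimes>\<^bsub>W\<^esub> w')) (tprod V W ys zs)"
    using assms(2,3) Cons.prems x
    by (induction ys) (auto simp: tprod_Cons V.m_assoc W.m_assoc subset_iff)
  then show ?case using Cons x by (simp add: tprod_Cons tprod_append)
qed simp

lemma Union_tcls:
  assumes "valid xs" "\<And>ys. xs \<approx> ys \<Longrightarrow> F ys = F xs"
  shows "(\<Union>ys\<in>tcls V W xs. F ys) = F xs"
proof -
  have "F ` tcls V W xs = (\<lambda>_. F xs) ` tcls V W xs"
    using assms by (intro image_cong) (auto simp only: mem_tcls_iff)
  moreover have "tcls V W xs \<noteq> {}" using assms(1) tensor_eq.refl mem_tcls_iff by blast
  ultimately show ?thesis by simp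
qed

lemma Union_tcls_map:
  assumes "staralg V'" "staralg W'"
    and "\<And>v. v \<in> carrier V \<Longrightarrow> f v \<in> carrier V'" "\<And>w. w \<in> carrier W \<Longrightarrow> g w \<in> carrier W'"
    and "\<And>v v'. v \<in> carrier V \<Longrightarrow> v' \<in> carrier V \<Longrightarrow> f (v \<oplus>\<^bsub>V\<^esub> v') = f v \<oplus>\<^bsub>V'\<^esub> f v'"
    and "\<And>w w'. w \<in> carrier W \<Longrightarrow> w' \<in> carrier W \<Longrightarrow> g (w \<oplus>\<^bsub>W\<^esub> w') = g w \<oplus>\<^bsub>W'\<^esub> g w'"
    and "\<And>c v. v \<in> carrier V \<Longrightarrow> f (c \<odot>\<^bsub>V\<^esub> v) = \<sigma> c \<odot>\<^bsub>V'\<^esub> f v"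
    and "\<And>c w. w \<in> carrier W \<Longrightarrow> g (c \<odot>\<^bsub>W\<^esub> w) = \<sigma> c \<odot>\<^bsub>W'\<^esub> g w"
    and "valid xs"
  shows "(\<Union>xs\<in>tcls V W xs. tcls V' W' (map (\<lambda>(v, w). (f v, g w)) xs)) =
    tcls V' W' (map (\<lambda>(v, w). (f v, g w)) xs)"
proof (rule Union_tcls[OF assms(9)])
  fix ys assume "xs \<approx> ys"
  then have "tensor_eq V' W' (map (\<lambda>(v, w). (f v, g w)) xs) (map (\<lambda>(v, w). (f v, g w)) ys)"
    using assms by (intro tensor_eq_map[OF V.staralg_axioms W.staralg_axioms]) auto
  then show "tcls V' W' (map (\<lambda>(v, w). (f v, g w)) ys) = tcls V' W' (map (\<lambda>(v, w). (f v, g w)) xs)"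
    using tensor_pair.tcls_eqI[of V' W'] assms(1,2) by (simp add: tensor_pair_def)
qed

lemma tensor_map_tcls:
  assumes "staralg V'" "staralg W'" "f \<in> linear_maps V V'" "g \<in> linear_maps W W'" "valid xs"
  shows "tensor_map V' W' f g (tcls V W xs) = tcls V' W' (map (\<lambda>(v, w). (f v, g w)) xs)"
  unfolding tensor_map_def
  using assms by (subst Union_tcls_map[where \<sigma> = "\<lambda>c. c", symmetric])
    (auto simp: linear_maps_def tcls_def)

lemma carrier_tensor: "carrier (tensor_alg V W) = tcls V W ` {xs. valid xs}"
  by (auto simp: tensor_alg_def quotient_def tcls_def)

lemma tcls_closed: "valid xs \<Longrightarrow> tcls V W xs \<in> carrier (tensor_alg V W)"
  by (simp add: carrier_tensor)

lemma tensor_cases: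
  assumes "X \<in> carrier (tensor_alg V W)" obtains xs where "X = tcls V W xs" "valid xs"
  using assms by (auto simp: carrier_tensor)

lemma tensor_add:
  assumes "valid xs" "valid ys"
  shows "tcls V W xs \<oplus>\<^bsub>tensor_alg V W\<^esub> tcls V W ys = tcls V W (xs @ ys)"
proof -
  have "(\<Union>ys'\<in>tcls V W ys. tcls V W (xs' @ ys')) = tcls V W (xs' @ ys)" if "xs \<approx> xs'" for xs'
    using assms valid(2)[OF that]
    by (intro Union_tcls[of ys "\<lambda>ys'. tcls V W (xs' @ ys')"])
      (auto intro!: tcls_eqI tensor_eq.cong tensor_eq.refl intro: tensor_eq.sym)
  then have "(\<Union>xs'\<in>tcls V W xs. \<Union>ys'\<in>tcls V W ys. tcls V W (xs' @ ys')) =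
      (\<Union>xs'\<in>tcls V W xs. tcls V W (xs' @ ys))"
    by (simp add: mem_tcls_iff)
  also have "\<dots> = tcls V W (xs @ ys)"
    using assms
    by (intro Union_tcls[of xs "\<lambda>xs'. tcls V W (xs' @ ys)"])
      (auto intro!: tcls_eqI tensor_eq.cong tensor_eq.refl intro: tensor_eq.sym)
  finally show ?thesis by (simp add: tensor_alg_def tcls_def)
qed

lemma tensor_mult:
  assumes "valid xs" "valid ys"
  shows "tcls V W xs \<otimes>\<^bsub>tensor_alg V W\<^esub> tcls V W ys = tcls V W (tprod V W xs ys)"
proof -
  have "(\<Union>ys'\<in>tcls V W ys. tcls V W (tprod V W xs' ys')) = tcls V W (tprod V W xs' ys)" if "xs \<approx> xs'" for xs'
    using assms valid(2)[OF that]
    by (intro Union_tcls[of ys "\<lambda>ys'. tcls V W (tprod V W xs' ys')"])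
      (auto intro!: tcls_eqI tprod_cong_right intro: tensor_eq.sym)
  then have "(\<Union>xs'\<in>tcls V W xs. \<Union>ys'\<in>tcls V W ys. tcls V W (tprod V W xs' ys')) =
      (\<Union>xs'\<in>tcls V W xs. tcls V W (tprod V W xs' ys))"
    by (simp add: mem_tcls_iff)
  also have "\<dots> = tcls V W (tprod V W xs ys)"
    using assms
    by (intro Union_tcls[of xs "\<lambda>xs'. tcls V W (tprod V W xs' ys)"])
      (auto intro!: tcls_eqI tprod_cong_left intro: tensor_eq.sym)
  finally show ?thesis by (simp add: tensor_alg_def tcls_def tprod_def)
qed

lemma tensor_smult:
  assumes "valid xs"
  shows "c \<odot>\<^bsub>tensor_alg V W\<^esub> tcls V W xs = tcls V W (map (\<lambda>(v, w). (c \<odot>\<^bsub>V\<^esub> v, w)) xs)"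
  using Union_tcls_map[OF V.staralg_axioms W.staralg_axioms, of "\<lambda>v. c \<odot>\<^bsub>V\<^esub> v" "\<lambda>w. w" "\<lambda>c. c" xs] assms
  by (simp add: tensor_alg_def tcls_def V.smult_add mult.commute)

lemma tensor_star:
  assumes "valid xs"
  shows "star (tensor_alg V W) (tcls V W xs) = tcls V W (map (\<lambda>(v, w). (star V v, star W w)) xs)"
  using Union_tcls_map[OF V.staralg_axioms W.staralg_axioms, of "star V" "star W" cnj xs] assms
  by (simp add: tensor_alg_def tcls_def V.star_add W.star_add V.star_smult W.star_smult)

lemma tensor_one: "\<one>\<^bsub>tensor_alg V W\<^esub> = tcls V W [(\<one>\<^bsub>V\<^esub>, \<one>\<^bsub>W\<^esub>)]"
  and tensor_zero: "\<zero>\<^bsub>tensor_alg V W\<^esub> = tcls V W []"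
  by (simp_all add: tensor_alg_def tcls_def)

lemma smult_valid: "valid xs \<Longrightarrow> (\<lambda>(v, w). (c \<odot>\<^bsub>V\<^esub> v, w)) ` set xs \<subseteq> carrier V \<times> carrier W"
  by auto

lemma star_valid: "valid xs \<Longrightarrow> (\<lambda>(v, w). (star V v, star W w)) ` set xs \<subseteq> carrier V \<times> carrier W"
  by auto

lemma tensor_eq_neg:
  assumes "valid xs"
  shows "xs @ map (\<lambda>(v, w). ((-1) \<odot>\<^bsub>V\<^esub> v, w)) xs \<approx> []"
  using assms
proof (induction xs)
  case (Cons x xs)
  obtain v w where x: "x = (v, w)" by force
  have vw: "v \<in> carrier V" "w \<in> carrier W" using Cons.prems x by auto
  have "[(v, w), ((-1) \<odot>\<^bsub>V\<^esub> v, w)] \<approx> []"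
    using tensor_eq.trans[OF tensor_eq.sym[OF tensor_eq.add_left[of v V "(-1) \<odot>\<^bsub>V\<^esub> v" w W]], of "[]"]
      tensor_eq.zero[of w W V] vw
    by simp
  then have "[(v, w), ((-1) \<odot>\<^bsub>V\<^esub> v, w)] @ (xs @ map (\<lambda>(v, w). ((-1) \<odot>\<^bsub>V\<^esub> v, w)) xs) \<approx> [] @ []"
    using Cons by (intro tensor_eq.cong) auto
  moreover have "(x # xs) @ map (\<lambda>(v, w). ((-1) \<odot>\<^bsub>V\<^esub> v, w)) (x # xs) \<approx>
      [(v, w), ((-1) \<odot>\<^bsub>V\<^esub> v, w)] @ (xs @ map (\<lambda>(v, w). ((-1) \<odot>\<^bsub>V\<^esub> v, w)) xs)"
    using Cons.prems x by (intro tensor_eq_mset) auto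
  ultimately show ?case using tensor_eq.trans by (simp only: append_Nil)
qed (simp add: tensor_eq.refl)

lemma tensor_eq_add_smult:
  assumes "valid xs"
  shows "map (\<lambda>(v, w). ((c + d) \<odot>\<^bsub>V\<^esub> v, w)) xs \<approx>
    map (\<lambda>(v, w). (c \<odot>\<^bsub>V\<^esub> v, w)) xs @ map (\<lambda>(v, w). (d \<odot>\<^bsub>V\<^esub> v, w)) xs"
  using assms
proof (induction xs)
  case (Cons x xs)
  obtain v w where x: "x = (v, w)" by force
  have vw: "v \<in> carrier V" "w \<in> carrier W" using Cons.prems x by auto
  have "[((c + d) \<odot>\<^bsub>V\<^esub> v, w)] \<approx> [(c \<odot>\<^bsub>V\<^esub> v, w), (d \<odot>\<^bsub>V\<^esub> v, w)]"
    using tensor_eq.add_left[of "c \<odot>\<^bsub>V\<^esub> v" V "d \<odot>\<^bsub>V\<^esub> v" w W] vw by (simp add: V.add_smult)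
  then have "[((c + d) \<odot>\<^bsub>V\<^esub> v, w)] @ map (\<lambda>(v, w). ((c + d) \<odot>\<^bsub>V\<^esub> v, w)) xs \<approx>
    [(c \<odot>\<^bsub>V\<^esub> v, w), (d \<odot>\<^bsub>V\<^esub> v, w)] @
    (map (\<lambda>(v, w). (c \<odot>\<^bsub>V\<^esub> v, w)) xs @ map (\<lambda>(v, w). (d \<odot>\<^bsub>V\<^esub> v, w)) xs)"
    using Cons by (intro tensor_eq.cong) auto
  moreover have "map (\<lambda>(v, w). (c \<odot>\<^bsub>V\<^esub> v, w)) (x # xs) @ map (\<lambda>(v, w). (d \<odot>\<^bsub>V\<^esub> v, w)) (x # xs) \<approx>
    [(c \<odot>\<^bsub>V\<^esub> v, w), (d \<odot>\<^bsub>V\<^esub> v, w)] @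
    (map (\<lambda>(v, w). (c \<odot>\<^bsub>V\<^esub> v, w)) xs @ map (\<lambda>(v, w). (d \<odot>\<^bsub>V\<^esub> v, w)) xs)"
    using Cons.prems x by (intro tensor_eq_mset) auto
  ultimately show ?case using x by (auto intro: tensor_eq.trans tensor_eq.sym)
qed (simp add: tensor_eq.refl)

text \<open>Adjoints reverse the factors, which transposes the double list; only the multisets of
  entries agree.\<close>

lemma mset_star_tprod:
  assumes "valid xs" "valid ys"
  shows "mset (map (\<lambda>(v, w). (star V v, star W w)) (tprod V W xs ys)) =
    mset (tprod V W (map (\<lambda>(v, w). (star V v, star W w)) ys) (map (\<lambda>(v, w). (star V v, star W w)) xs))"
  using assms(1)
proof (induction xs)
  case (Cons x xs)
  obtain v w where x: "x = (v, w)" by force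
  have "map (\<lambda>(v, w). (star V v, star W w)) (map (\<lambda>(v', w'). (v \<otimes>\<^bsub>V\<^esub> v', w \<otimes>\<^bsub>W\<^esub> w')) ys) =
    map (\<lambda>(v', w'). (v' \<otimes>\<^bsub>V\<^esub> star V v, w' \<otimes>\<^bsub>W\<^esub> star W w)) (map (\<lambda>(v, w). (star V v, star W w)) ys)"
    using Cons.prems x assms(2) by (auto simp: V.star_mult W.star_mult)
  then show ?case using Cons x by (simp add: tprod_Cons mset_tprod_Cons2 del: map_map)
qed simp

lemma staralg_tensor: "staralg (tensor_alg V W)"
proof
  fix X Y Z c d
  assume "X \<in> carrier (tensor_alg V W)" "Y \<in> carrier (tensor_alg V W)" "Z \<in> carrier (tensor_alg V W)"
  then obtain xs ys zs where X: "X = tcls V W xs" "valid xs" and Y: "Y = tcls V W ys" "valid ys"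
    and Z: "Z = tcls V W zs" "valid zs"
    by (elim tensor_cases)
  note [simp] = tensor_add tensor_mult tensor_smult tensor_star tensor_one tensor_zero
    tcls_closed tprod_valid smult_valid star_valid
  let ?T = "tensor_alg V W"
  show "(X \<oplus>\<^bsub>?T\<^esub> Y) \<oplus>\<^bsub>?T\<^esub> Z = X \<oplus>\<^bsub>?T\<^esub> (Y \<oplus>\<^bsub>?T\<^esub> Z)" using X Y Z by simp
  show "(X \<otimes>\<^bsub>?T\<^esub> Y) \<otimes>\<^bsub>?T\<^esub> Z = X \<otimes>\<^bsub>?T\<^esub> (Y \<otimes>\<^bsub>?T\<^esub> Z)" using X Y Z by (simp add: tprod_assoc)
  show "X \<otimes>\<^bsub>?T\<^esub> (Y \<oplus>\<^bsub>?T\<^esub> Z) = X \<otimes>\<^bsub>?T\<^esub> Y \<oplus>\<^bsub>?T\<^esub> X \<otimes>\<^bsub>?T\<^esub> Z"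
    using X Y Z by simp (intro tcls_eqI tensor_eq_mset; simp add: mset_tprod_append2)
  show "(X \<oplus>\<^bsub>?T\<^esub> Y) \<otimes>\<^bsub>?T\<^esub> Z = X \<otimes>\<^bsub>?T\<^esub> Z \<oplus>\<^bsub>?T\<^esub> Y \<otimes>\<^bsub>?T\<^esub> Z"
    using X Y Z by (simp add: tprod_append)
next
  fix X Y c
  assume "X \<in> carrier (tensor_alg V W)" "Y \<in> carrier (tensor_alg V W)"
  then obtain xs ys where X: "X = tcls V W xs" "valid xs" and Y: "Y = tcls V W ys" "valid ys"
    by (elim tensor_cases)
  note [simp] = tensor_add tensor_mult tensor_smult tensor_star tensor_one tensor_zero
    tcls_closed tprod_valid smult_valid star_valid
  let ?T = "tensor_alg V W"
  show "X \<oplus>\<^bsub>?T\<^esub> Y \<in> carrier ?T" "X \<otimes>\<^bsub>?T\<^esub> Y \<in> carrier ?T"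
    using X Y by (simp_all del: set_append add: Un_subset_iff set_append)
  show "X \<oplus>\<^bsub>?T\<^esub> Y = Y \<oplus>\<^bsub>?T\<^esub> X"
    using X Y by simp (intro tcls_eqI tensor_eq.comm)
  show "star ?T (X \<oplus>\<^bsub>?T\<^esub> Y) = star ?T X \<oplus>\<^bsub>?T\<^esub> star ?T Y" using X Y by simp
  show "star ?T (X \<otimes>\<^bsub>?T\<^esub> Y) = star ?T Y \<otimes>\<^bsub>?T\<^esub> star ?T X"
    using X Y by simp (intro tcls_eqI tensor_eq_mset mset_star_tprod; simp)
  show "c \<odot>\<^bsub>?T\<^esub> (X \<oplus>\<^bsub>?T\<^esub> Y) = c \<odot>\<^bsub>?T\<^esub> X \<oplus>\<^bsub>?T\<^esub> c \<odot>\<^bsub>?T\<^esub> Y" using X Y by simp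
  show "(c \<odot>\<^bsub>?T\<^esub> X) \<otimes>\<^bsub>?T\<^esub> Y = c \<odot>\<^bsub>?T\<^esub> (X \<otimes>\<^bsub>?T\<^esub> Y)"
  proof -
    have "tprod V W (map (\<lambda>(v, w). (c \<odot>\<^bsub>V\<^esub> v, w)) xs) ys = map (\<lambda>(v, w). (c \<odot>\<^bsub>V\<^esub> v, w)) (tprod V W xs ys)"
      using X(2) Y(2) by (induction xs) (auto simp: tprod_Cons V.smult_l subset_iff)
    then show ?thesis using X Y by simp
  qed
  show "X \<otimes>\<^bsub>?T\<^esub> (c \<odot>\<^bsub>?T\<^esub> Y) = c \<odot>\<^bsub>?T\<^esub> (X \<otimes>\<^bsub>?T\<^esub> Y)"
  proof -
    have "tprod V W xs (map (\<lambda>(v, w). (c \<odot>\<^bsub>V\<^esub> v, w)) ys) = map (\<lambda>(v, w). (c \<odot>\<^bsub>V\<^esub> v, w)) (tprod V W xs ys)"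
      using X(2) Y(2) by (induction xs) (auto simp: tprod_Cons V.smult_r subset_iff)
    then show ?thesis using X Y by simp
  qed
next
  fix X c d
  assume "X \<in> carrier (tensor_alg V W)"
  then obtain xs where X: "X = tcls V W xs" "valid xs"
    by (elim tensor_cases)
  note [simp] = tensor_add tensor_mult tensor_smult tensor_star tensor_one tensor_zero
    tcls_closed tprod_valid smult_valid star_valid
  let ?T = "tensor_alg V W"
  show "c \<odot>\<^bsub>?T\<^esub> X \<in> carrier ?T" "star ?T X \<in> carrier ?T" using X by simp_all
  show "X \<oplus>\<^bsub>?T\<^esub> \<zero>\<^bsub>?T\<^esub> = X" using X by simp
  show "X \<oplus>\<^bsub>?T\<^esub> (-1) \<odot>\<^bsub>?T\<^esub> X = \<zero>\<^bsub>?T\<^esub>"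
    using X tcls_eqI[OF tensor_eq_neg[of xs]] by simp
  have id: "map (\<lambda>(v, w). (f v, g w)) xs = xs"
    if "\<And>v. v \<in> carrier V \<Longrightarrow> f v = v" "\<And>w. w \<in> carrier W \<Longrightarrow> g w = w" for f g
    using X(2) that by (intro map_idI) auto
  show "1 \<odot>\<^bsub>?T\<^esub> X = X" using X id[of "\<lambda>v. 1 \<odot>\<^bsub>V\<^esub> v" "\<lambda>w. w"] by simp
  show "\<one>\<^bsub>?T\<^esub> \<otimes>\<^bsub>?T\<^esub> X = X"
    using X id[of "\<lambda>v. \<one>\<^bsub>V\<^esub> \<otimes>\<^bsub>V\<^esub> v" "\<lambda>w. \<one>\<^bsub>W\<^esub> \<otimes>\<^bsub>W\<^esub> w"] by (simp add: tprod_Cons)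
  have "tprod V W xs [(\<one>\<^bsub>V\<^esub>, \<one>\<^bsub>W\<^esub>)] = xs"
    using X(2) by (induction xs) (auto simp: tprod_Cons)
  then show "X \<otimes>\<^bsub>?T\<^esub> \<one>\<^bsub>?T\<^esub> = X" using X by simp
  have "map (\<lambda>(v, w). (c \<odot>\<^bsub>V\<^esub> v, w)) (map (\<lambda>(v, w). (d \<odot>\<^bsub>V\<^esub> v, w)) xs) =
      map (\<lambda>(v, w). ((c * d) \<odot>\<^bsub>V\<^esub> v, w)) xs"
    using X(2) by (induction xs) auto
  then show "c \<odot>\<^bsub>?T\<^esub> (d \<odot>\<^bsub>?T\<^esub> X) = (c * d) \<odot>\<^bsub>?T\<^esub> X"
    using X by (simp del: map_map)
  show "(c + d) \<odot>\<^bsub>?T\<^esub> X = c \<odot>\<^bsub>?T\<^esub> X \<oplus>\<^bsub>?T\<^esub> d \<odot>\<^bsub>?T\<^esub> X"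
    using X tcls_eqI[OF tensor_eq_add_smult[of xs]] by simp
  have "map (\<lambda>(v, w). (star V v, star W w)) (map (\<lambda>(v, w). (star V v, star W w)) xs) = xs"
    using X(2) by (induction xs) auto
  then show "star ?T (star ?T X) = X"
    using X by (simp del: map_map)
  have "map (\<lambda>(v, w). (star V v, star W w)) (map (\<lambda>(v, w). (c \<odot>\<^bsub>V\<^esub> v, w)) xs) =
      map (\<lambda>(v, w). (cnj c \<odot>\<^bsub>V\<^esub> v, w)) (map (\<lambda>(v, w). (star V v, star W w)) xs)"
    using X(2) by (induction xs) (auto simp: V.star_smult)
  then show "star ?T (c \<odot>\<^bsub>?T\<^esub> X) = cnj c \<odot>\<^bsub>?T\<^esub> star ?T X"
    using X by (simp del: map_map)
qed (auto simp: tensor_one tensor_zero tcls_closed)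

end

context tensor_pair
begin

lemma tensor_closed: "v \<in> carrier V \<Longrightarrow> w \<in> carrier W \<Longrightarrow> tensor V W v w \<in> carrier (tensor_alg V W)"
  by (simp add: tensor_eq_tcls tcls_closed)

lemma tensor_mult1:
  assumes "v \<in> carrier V" "w \<in> carrier W" "v' \<in> carrier V" "w' \<in> carrier W"
  shows "tensor V W v w \<otimes>\<^bsub>tensor_alg V W\<^esub> tensor V W v' w' = tensor V W (v \<otimes>\<^bsub>V\<^esub> v') (w \<otimes>\<^bsub>W\<^esub> w')"
  using assms by (simp add: tensor_eq_tcls tensor_mult tprod_Cons)

lemma tensor_star1:
  assumes "v \<in> carrier V" "w \<in> carrier W"
  shows "star (tensor_alg V W) (tensor V W v w) = tensor V W (star V v) (star W w)"
  using assms by (simp add: tensor_eq_tcls tensor_star)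

lemma tensor_one1: "\<one>\<^bsub>tensor_alg V W\<^esub> = tensor V W \<one>\<^bsub>V\<^esub> \<one>\<^bsub>W\<^esub>"
  by (simp add: tensor_eq_tcls tensor_one)

lemma tensor_add_left:
  assumes "v \<in> carrier V" "v' \<in> carrier V" "w \<in> carrier W"
  shows "tensor V W (v \<oplus>\<^bsub>V\<^esub> v') w = tensor V W v w \<oplus>\<^bsub>tensor_alg V W\<^esub> tensor V W v' w"
  using assms tcls_eqI[OF tensor_eq.add_left] by (simp add: tensor_eq_tcls tensor_add)

lemma tensor_add_right:
  assumes "v \<in> carrier V" "w \<in> carrier W" "w' \<in> carrier W"
  shows "tensor V W v (w \<oplus>\<^bsub>W\<^esub> w') = tensor V W v w \<oplus>\<^bsub>tensor_alg V W\<^esub> tensor V W v w'"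
  using assms tcls_eqI[OF tensor_eq.add_right] by (simp add: tensor_eq_tcls tensor_add)

lemma tensor_smult_left:
  assumes "v \<in> carrier V" "w \<in> carrier W"
  shows "tensor V W (c \<odot>\<^bsub>V\<^esub> v) w = c \<odot>\<^bsub>tensor_alg V W\<^esub> tensor V W v w"
  using assms by (simp add: tensor_eq_tcls tensor_smult)

lemma tensor_smult_right:
  assumes "v \<in> carrier V" "w \<in> carrier W"
  shows "tensor V W v (c \<odot>\<^bsub>W\<^esub> w) = c \<odot>\<^bsub>tensor_alg V W\<^esub> tensor V W v w"
  using assms by (simp add: tensor_eq_tcls tensor_smult tensor_scale_left)

lemmas tensor_bilinear = tensor_add_left tensor_add_right tensor_smult_left tensor_smult_right

end

section \<open>Tensor squares and coproducts of expressions\<close>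

context staralg
begin

abbreviation add_tensor (infixl "\<oplus>\<^sub>2" 65) where
  "X \<oplus>\<^sub>2 Y \<equiv> X \<oplus>\<^bsub>tensor_alg V V\<^esub> Y"

abbreviation mult_tensor (infixl "\<otimes>\<^sub>2" 70) where
  "X \<otimes>\<^sub>2 Y \<equiv> X \<otimes>\<^bsub>tensor_alg V V\<^esub> Y"

abbreviation smult_tensor (infixl "\<odot>\<^sub>2" 70) where
  "c \<odot>\<^sub>2 X \<equiv> c \<odot>\<^bsub>tensor_alg V V\<^esub> X"

end

text \<open>The coproduct of an expression as an explicit list, when \<open>d\<close> prescribes it
  on the generators. It serves both U and SU_\<nu>(2) and keeps coproducts computable without a
  choice of representatives.\<close>

primrec expr_comult ::
  "('x \<Rightarrow> ('x expr \<times> 'x expr) list) \<Rightarrow> 'x expr \<Rightarrow> ('x expr \<times> 'x expr) list" where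
  "expr_comult d (Gen a) = d a"
| "expr_comult d EZero = []"
| "expr_comult d EOne = [(EOne, EOne)]"
| "expr_comult d (x \<boxplus> y) = expr_comult d x @ expr_comult d y"
| "expr_comult d (x \<boxtimes> y) =
    [(p \<boxtimes> p', r \<boxtimes> r'). (p, r) \<leftarrow> expr_comult d x, (p', r') \<leftarrow> expr_comult d y]"
| "expr_comult d (c \<boxdot> x) = map (\<lambda>(p, r). (c \<boxdot> p, r)) (expr_comult d x)"
| "expr_comult d (EStar x) = map (\<lambda>(p, r). (EStar p, EStar r)) (expr_comult d x)"

lemma interp_tensor_presented:
  fixes R :: "('x expr \<times> 'x expr) set"
  defines "P \<equiv> presented R" and "cc \<equiv> map_prod (cls R) (cls R)"
  shows "interp (tensor_alg P P) (\<lambda>a. tcls P P (map cc (d a))) x = tcls P P (map cc (expr_comult d x))"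
proof -
  interpret tensor_pair P P by (simp add: tensor_pair_def P_def staralg_presented)
  have valid: "valid (map cc xs)" for xs by (auto simp: P_def cc_def)
  have im: "cc ` A \<subseteq> carrier P \<times> carrier P" for A by (auto simp: P_def cc_def)
  show ?thesis
  proof (induction x)
    case (EMul x y)
    have "tprod P P (map cc xs) (map cc ys) = map cc [(p \<boxtimes> p', r \<boxtimes> r'). (p, r) \<leftarrow> xs, (p', r') \<leftarrow> ys]"
      for xs ys :: "('x expr \<times> 'x expr) list"
      by (induction xs) (auto simp: tprod_Cons cc_def P_def)
    then show ?case using EMul valid by (simp only: interp.simps tensor_mult expr_comult.simps)
  next
    case (EScale c x)
    have "map (\<lambda>(v, w). (c \<odot>\<^bsub>P\<^esub> v, w)) (map cc (expr_comult d x)) =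
        map cc (map (\<lambda>(p, r). (c \<boxdot> p, r)) (expr_comult d x))"
      by (simp add: cc_def P_def case_prod_unfold)
    then show ?case using EScale valid by (simp only: interp.simps tensor_smult expr_comult.simps)
  next
    case (EStar x)
    have "map (\<lambda>(v, w). (star P v, star P w)) (map cc (expr_comult d x)) =
        map cc (map (\<lambda>(p, r). (EStar p, EStar r)) (expr_comult d x))"
      by (simp add: cc_def P_def case_prod_unfold)
    then show ?case using EStar valid by (simp only: interp.simps tensor_star expr_comult.simps)
  next
    case (EAdd x y)
    then show ?case using valid by (simp only: interp.simps tensor_add expr_comult.simps map_append)
  next
    case EOne
    then show ?case by (simp add: tensor_one cc_def) (simp add: P_def)
  qed (simp_all add: tensor_zero)
qed

section \<open>Linear functionals and coordinates on tensor products\<close>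

definition linear_functional :: "'a star_alg \<Rightarrow> ('a \<Rightarrow> complex) \<Rightarrow> bool" where
  "linear_functional V f \<longleftrightarrow>
     (\<forall>x\<in>carrier V. \<forall>y\<in>carrier V. f (x \<oplus>\<^bsub>V\<^esub> y) = f x + f y) \<and>
     (\<forall>c. \<forall>x\<in>carrier V. f (c \<odot>\<^bsub>V\<^esub> x) = c * f x)"

context tensor_pair
begin

lemma sum_tensor_eq:
  assumes "linear_functional V f" "linear_functional W g" "xs \<approx> ys"
  shows "(\<Sum>(v, w)\<leftarrow>xs. f v * g w) = (\<Sum>(v, w)\<leftarrow>ys. f v * g w)"
  using assms(3)
proof induction
  case (zero w)
  have "f (0 \<odot>\<^bsub>V\<^esub> \<zero>\<^bsub>V\<^esub>) = 0 * f \<zero>\<^bsub>V\<^esub>"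
    using assms(1) unfolding linear_functional_def by blast
  then show ?case by simp
qed (use assms(1,2) in \<open>auto simp: linear_functional_def algebra_simps\<close>)

lemma tensor_functional_tcls:
  assumes "linear_functional V f" "linear_functional W g" "valid xs"
  shows "tensor_functional f g (tcls V W xs) = (\<Sum>(v, w)\<leftarrow>xs. f v * g w)"
proof -
  have "tcls V W xs \<noteq> {}" using tensor_eq.refl[OF assms(3)] mem_tcls_iff by blast
  moreover have "(\<Sum>(v, w)\<leftarrow>ys. f v * g w) = (\<Sum>(v, w)\<leftarrow>xs. f v * g w)" if "ys \<in> tcls V W xs" for ys
    using sum_tensor_eq[OF assms(1,2)] that mem_tcls_iff by metis
  ultimately show ?thesis
    unfolding tensor_functional_def by (rule the_elem_image_unique)
qed

end

primrec lcomb :: "'a star_alg \<Rightarrow> (complex \<times> 'a) list \<Rightarrow> 'a" where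
  "lcomb V [] = \<zero>\<^bsub>V\<^esub>"
| "lcomb V (p # ps) = fst p \<odot>\<^bsub>V\<^esub> snd p \<oplus>\<^bsub>V\<^esub> lcomb V ps"

lemma (in staralg) lcomb_closed [simp]:
  "snd ` set ps \<subseteq> carrier V \<Longrightarrow> lcomb V ps \<in> carrier V"
  by (induction ps) (auto simp: case_prod_beta)

lemma linear_functional_lcomb:
  assumes "staralg V" "linear_functional V f" "snd ` set ps \<subseteq> carrier V"
  shows "f (lcomb V ps) = (\<Sum>(c, v)\<leftarrow>ps. c * f v)"
  using assms(3)
proof (induction ps)
  case Nil
  have "f (0 \<odot>\<^bsub>V\<^esub> \<zero>\<^bsub>V\<^esub>) = 0 * f \<zero>\<^bsub>V\<^esub>"
    using assms(1,2) staralg.zero_closed unfolding linear_functional_def by blast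
  then show ?case using staralg.smult_zero_right[OF assms(1)] by simp
next
  case (Cons p ps)
  have p: "snd p \<in> carrier V" using Cons.prems by simp
  have "lcomb V ps \<in> carrier V"
    using Cons.prems by (intro staralg.lcomb_closed[OF assms(1)]) auto
  moreover have "fst p \<odot>\<^bsub>V\<^esub> snd p \<in> carrier V" using p assms(1) by (simp add: staralg.smult_closed)
  ultimately have "f (lcomb V (p # ps)) = f (fst p \<odot>\<^bsub>V\<^esub> snd p) + f (lcomb V ps)"
    using assms(2) by (simp add: linear_functional_def)
  also have "f (fst p \<odot>\<^bsub>V\<^esub> snd p) = fst p * f (snd p)"
    using assms(2) p by (simp add: linear_functional_def)
  also have "f (lcomb V ps) = (\<Sum>(c, v)\<leftarrow>ps. c * f v)"
    using Cons.prems by (intro Cons.IH) auto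
  finally show ?case by (cases p) simp
qed

context tensor_pair
begin

lemma tensor_eq_lcomb_left:
  assumes "w \<in> carrier W" "snd ` set ps \<subseteq> carrier V"
  shows "[(lcomb V ps, w)] \<approx> map (\<lambda>(c, v). (v, c \<odot>\<^bsub>W\<^esub> w)) ps"
  using assms(2)
proof (induction ps)
  case Nil
  then show ?case using assms(1) by (simp add: tensor_eq.zero)
next
  case (Cons p ps)
  obtain c v where p: "p = (c, v)" by force
  then have v: "v \<in> carrier V" "lcomb V ps \<in> carrier V" using Cons.prems by auto
  have "[(lcomb V (p # ps), w)] \<approx> [(c \<odot>\<^bsub>V\<^esub> v, w)] @ [(lcomb V ps, w)]"
    using tensor_eq.add_left[of "c \<odot>\<^bsub>V\<^esub> v" V "lcomb V ps" w W] p v assms(1) by simp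
  moreover have "[(c \<odot>\<^bsub>V\<^esub> v, w)] @ [(lcomb V ps, w)] \<approx>
      [(v, c \<odot>\<^bsub>W\<^esub> w)] @ map (\<lambda>(c, v). (v, c \<odot>\<^bsub>W\<^esub> w)) ps"
    using Cons v assms(1) by (intro tensor_eq.cong tensor_eq.scale) auto
  ultimately show ?case using p by (auto intro: tensor_eq.trans)
qed

lemma tensor_eq_lcomb_right:
  assumes "v \<in> carrier V" "snd ` set ps \<subseteq> carrier W"
  shows "[(v, lcomb W ps)] \<approx> map (\<lambda>(c, w). (v, c \<odot>\<^bsub>W\<^esub> w)) ps"
  using assms(2)
proof (induction ps)
  case Nil
  have "[(v, 0 \<odot>\<^bsub>W\<^esub> \<zero>\<^bsub>W\<^esub>)] \<approx> [(0 \<odot>\<^bsub>V\<^esub> v, \<zero>\<^bsub>W\<^esub>)]"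
    using assms(1) by (intro tensor_eq.sym[OF tensor_eq.scale]) auto
  then show ?case using assms(1) tensor_eq.zero[of "\<zero>\<^bsub>W\<^esub>" W V] by (simp, metis W.zero_closed tensor_eq.trans)
next
  case (Cons p ps)
  obtain c w where p: "p = (c, w)" by force
  then have w: "w \<in> carrier W" "lcomb W ps \<in> carrier W" using Cons.prems by auto
  have "[(v, lcomb W (p # ps))] \<approx> [(v, c \<odot>\<^bsub>W\<^esub> w)] @ [(v, lcomb W ps)]"
    using tensor_eq.add_right[of v V "c \<odot>\<^bsub>W\<^esub> w" W "lcomb W ps"] p w assms(1) by simp
  moreover have "[(v, c \<odot>\<^bsub>W\<^esub> w)] @ [(v, lcomb W ps)] \<approx>
      [(v, c \<odot>\<^bsub>W\<^esub> w)] @ map (\<lambda>(c, w). (v, c \<odot>\<^bsub>W\<^esub> w)) ps"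
    using Cons w assms(1) by (intro tensor_eq.cong tensor_eq.refl) auto
  ultimately show ?case using p by (auto intro: tensor_eq.trans)
qed

lemma mset_concat_swap:
  "mset (concat (map (\<lambda>x. map (\<lambda>y. f x y) ys) xs)) = mset (concat (map (\<lambda>y. map (\<lambda>x. f x y) xs) ys))"
proof (induction xs)
  case Nil
  then show ?case by (induction ys) auto
next
  case (Cons x xs)
  have "mset (concat (map (\<lambda>y. f x y # map (\<lambda>x. f x y) xs) ys)) =
      mset (map (f x) ys) + mset (concat (map (\<lambda>y. map (\<lambda>x. f x y) xs) ys))"
    by (induction ys) auto
  then show ?case using Cons by simp
qed

text \<open>A tensor is determined by the second components obtained when the first ones are expanded
  in a spanning family \<open>b\<close> with coordinate functions \<open>\<phi>\<close>.\<close>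

lemma tensor_eq_coordinates:
  assumes b: "\<And>p. p \<in> set ps \<Longrightarrow> b p \<in> carrier V" and "valid xs"
    and exp: "\<And>v w. (v, w) \<in> set xs \<Longrightarrow> v = lcomb V (map (\<lambda>p. (\<phi> p v, b p)) ps)"
  shows "xs \<approx> map (\<lambda>p. (b p, lcomb W (map (\<lambda>(v, w). (\<phi> p v, w)) xs))) ps"
proof -
  have "concat (map (\<lambda>x. [x]) xs) \<approx>
      concat (map (\<lambda>x. map (\<lambda>p. (b p, \<phi> p (fst x) \<odot>\<^bsub>W\<^esub> snd x)) ps) xs)"
  proof (rule tensor_eq_concat_map)
    fix x assume x: "x \<in> set xs"
    have "[(lcomb V (map (\<lambda>p. (\<phi> p (fst x), b p)) ps), snd x)] \<approx>
        map (\<lambda>(c, v). (v, c \<odot>\<^bsub>W\<^esub> snd x)) (map (\<lambda>p. (\<phi> p (fst x), b p)) ps)"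
      using x assms(2) b by (intro tensor_eq_lcomb_left) auto
    then show "[x] \<approx> map (\<lambda>p. (b p, \<phi> p (fst x) \<odot>\<^bsub>W\<^esub> snd x)) ps"
      using exp[of "fst x" "snd x"] x by (simp add: comp_def)
  qed
  also have "concat (map (\<lambda>x. [x]) xs) = xs" by (induction xs) auto
  finally have 1: "xs \<approx> concat (map (\<lambda>x. map (\<lambda>p. (b p, \<phi> p (fst x) \<odot>\<^bsub>W\<^esub> snd x)) ps) xs)" .
  have 2: "concat (map (\<lambda>x. map (\<lambda>p. (b p, \<phi> p (fst x) \<odot>\<^bsub>W\<^esub> snd x)) ps) xs) \<approx>
      concat (map (\<lambda>p. map (\<lambda>x. (b p, \<phi> p (fst x) \<odot>\<^bsub>W\<^esub> snd x)) xs) ps)"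
    using valid(2)[OF 1] by (intro tensor_eq_mset mset_concat_swap)
  have 3: "concat (map (\<lambda>p. [(b p, lcomb W (map (\<lambda>(v, w). (\<phi> p v, w)) xs))]) ps) \<approx>
      concat (map (\<lambda>p. map (\<lambda>x. (b p, \<phi> p (fst x) \<odot>\<^bsub>W\<^esub> snd x)) xs) ps)"
  proof (rule tensor_eq_concat_map)
    fix p assume p: "p \<in> set ps"
    have "[(b p, lcomb W (map (\<lambda>(v, w). (\<phi> p v, w)) xs))] \<approx>
      map (\<lambda>(c, w). (b p, c \<odot>\<^bsub>W\<^esub> w)) (map (\<lambda>(v, w). (\<phi> p v, w)) xs)"
      using b[OF p] assms(2) by (intro tensor_eq_lcomb_right) auto
    then show "[(b p, lcomb W (map (\<lambda>(v, w). (\<phi> p v, w)) xs))] \<approx>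
        map (\<lambda>x. (b p, \<phi> p (fst x) \<odot>\<^bsub>W\<^esub> snd x)) xs"
      by (simp add: comp_def case_prod_beta)
  qed
  have "concat (map (\<lambda>p. [(b p, lcomb W (map (\<lambda>(v, w). (\<phi> p v, w)) xs))]) ps) =
      map (\<lambda>p. (b p, lcomb W (map (\<lambda>(v, w). (\<phi> p v, w)) xs))) ps" by (induction ps) auto
  then show ?thesis using tensor_eq.trans[OF tensor_eq.trans[OF 1 2] tensor_eq.sym[OF 3]] by simp
qed

text \<open>Both lists are brought into the coordinate form of \<open>tensor_eq_coordinates\<close>.
  There only the second components can differ, and the family \<open>F\<close> separates them. It is
  the source of well-definedness for \<Delta>_A and of uniqueness for the coproduct of B.\<close>

lemma tensor_eqI:
  assumes b: "\<And>p. p \<in> set ps \<Longrightarrow> b p \<in> carrier V" and "valid xs" "valid ys"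
    and exp: "\<And>v w. (v, w) \<in> set (xs @ ys) \<Longrightarrow> v = lcomb V (map (\<lambda>p. (\<phi> p v, b p)) ps)"
    and sep: "\<And>w w'. w \<in> carrier W \<Longrightarrow> w' \<in> carrier W \<Longrightarrow> (\<And>\<psi>. \<psi> \<in> F \<Longrightarrow> \<psi> w = \<psi> w') \<Longrightarrow> w = w'"
    and F: "\<And>\<psi>. \<psi> \<in> F \<Longrightarrow> linear_functional W \<psi>"
    and eq: "\<And>p \<psi>. p \<in> set ps \<Longrightarrow> \<psi> \<in> F \<Longrightarrow>
      (\<Sum>(v, w)\<leftarrow>xs. \<phi> p v * \<psi> w) = (\<Sum>(v, w)\<leftarrow>ys. \<phi> p v * \<psi> w)"
  shows "xs \<approx> ys"
proof -
  let ?l = "\<lambda>xs p. lcomb W (map (\<lambda>(v, w). (\<phi> p v, w)) xs)"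
  have "?l xs p = ?l ys p" if p: "p \<in> set ps" for p
  proof (rule sep)
    show "?l xs p \<in> carrier W" "?l ys p \<in> carrier W"
      using assms(2,3) by (auto intro!: W.lcomb_closed)
    fix \<psi> assume \<psi>: "\<psi> \<in> F"
    have "\<psi> (?l zs p) = (\<Sum>(v, w)\<leftarrow>zs. \<phi> p v * \<psi> w)" if "valid zs" for zs
    proof -
      have "snd ` set (map (\<lambda>(v, w). (\<phi> p v, w)) zs) \<subseteq> carrier W" using that by auto
      from linear_functional_lcomb[OF W.staralg_axioms F[OF \<psi>] this] show ?thesis
        by (simp add: comp_def split_def)
    qed
    then show "\<psi> (?l xs p) = \<psi> (?l ys p)" using eq[OF p \<psi>] assms(2,3) by simp
  qed
  then have eq_map: "map (\<lambda>p. (b p, ?l xs p)) ps = map (\<lambda>p. (b p, ?l ys p)) ps" by simp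
  have "xs \<approx> map (\<lambda>p. (b p, ?l xs p)) ps"
    by (rule tensor_eq_coordinates[OF b assms(2) exp]) auto
  moreover have "ys \<approx> map (\<lambda>p. (b p, ?l ys p)) ps"
    by (rule tensor_eq_coordinates[OF b assms(3) exp]) auto
  ultimately show ?thesis unfolding eq_map by (rule tensor_eq.trans[OF _ tensor_eq.sym])
qed

end


section \<open>The algebra generated by e, f, q\<close>

text \<open>Interpreted four times: in U itself, in U \<otimes> U for \<Delta>, in the twisted
  algebra for S, and in the matrices for \<pi>_n. Each interpretation yields a homomorphism out of U
  through \<open>lift\<close>.\<close>

locale uq_alg = staralg V for V :: "'a star_alg" (structure) +
  fixes t :: real and e f q qi :: 'a
  assumes gens_closed [simp, intro]: "e \<in> carrier V" "f \<in> carrier V" "q \<in> carrier V" "qi \<in> carrier V"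
    and q_qi: "q \<otimes> qi = \<one>" and qi_q: "qi \<otimes> q = \<one>"
    and q_e: "q \<otimes> e = complex_of_real (exp t) \<odot> (e \<otimes> q)"
    and q_f: "q \<otimes> f = inverse (complex_of_real (exp t)) \<odot> (f \<otimes> q)"
    and e_f: "e \<otimes> f \<oplus> (-1) \<odot> (f \<otimes> e) =
      inverse (complex_of_real (exp t) - inverse (complex_of_real (exp t))) \<odot> (q \<otimes> q \<oplus> (-1) \<odot> (qi \<otimes> qi))"
    and star_e: "star V e = f" and star_q: "star V q = q"
begin

lemma star_f: "star V f = e"
  using star_e star_star by (metis gens_closed(1))

lemma star_qi: "star V qi = qi"
proof (rule inverse_unique[of q])
  show "star V qi \<otimes> q = \<one>" using star_mult[of q qi] star_q q_qi by simp
qed (simp_all add: q_qi)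

lemma cancel_q:
  assumes "x \<in> carrier V"
  shows "q \<otimes> (qi \<otimes> x) = x" "qi \<otimes> (q \<otimes> x) = x"
  using assms by (simp_all flip: m_assoc add: q_qi qi_q)

lemma qi_e: "qi \<otimes> e = inverse (complex_of_real (exp t)) \<odot> (e \<otimes> qi)"
proof -
  have "qi \<otimes> (q \<otimes> e) \<otimes> qi = e \<otimes> qi" by (simp add: cancel_q)
  then have "complex_of_real (exp t) \<odot> (qi \<otimes> e) = e \<otimes> qi"
    by (simp add: q_e smult_l smult_r m_assoc q_qi)
  then have "inverse (complex_of_real (exp t)) \<odot> (complex_of_real (exp t) \<odot> (qi \<otimes> e)) =
      inverse (complex_of_real (exp t)) \<odot> (e \<otimes> qi)" by (simp only:)
  then show ?thesis by simp
qed

lemma qi_f: "qi \<otimes> f = complex_of_real (exp t) \<odot> (f \<otimes> qi)"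
proof -
  have "qi \<otimes> (q \<otimes> f) \<otimes> qi = f \<otimes> qi" by (simp add: cancel_q)
  then have "inverse (complex_of_real (exp t)) \<odot> (qi \<otimes> f) = f \<otimes> qi"
    by (simp add: q_f smult_l smult_r m_assoc q_qi)
  then have "complex_of_real (exp t) \<odot> (inverse (complex_of_real (exp t)) \<odot> (qi \<otimes> f)) =
      complex_of_real (exp t) \<odot> (f \<otimes> qi)" by (simp only:)
  then show ?thesis by simp
qed

lemma interp_relations:
  assumes "(x, y) \<in> uq_relations t"
  shows "interp V (case_uq_gen e f q qi) x = interp V (case_uq_gen e f q qi) y"
  using assms by (auto simp: uq_relations_def Let_def q_qi qi_q q_e q_f e_f star_e star_q)

lemma case_gens_closed [simp]: "case_uq_gen e f q qi a \<in> carrier V"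
  by (cases a) auto

end

section \<open>Realizations of the relations of U: coproduct and antipode\<close>

lemma uq_alg_uq:
  "uq_alg (uq t) t (uq_el t Ge) (uq_el t Gf) (uq_el t Gq) (uq_el t Gqinv)"
proof -
  have "uq_alg_axioms (presented (uq_relations t)) t (uq_el t Ge) (uq_el t Gf) (uq_el t Gq) (uq_el t Gqinv)"
    unfolding gen_eq_cls
    by unfold_locales (auto simp: cls_eq_iff uq_relations_def Let_def intro: expr_eq.rel)
  then show ?thesis using staralg_presented by (simp add: uq_alg_def uq_def)
qed

text \<open>Intended for A = q \<otimes> e, B = e \<otimes> \<open>qi\<close>, C = q \<otimes> f, D
  = f \<otimes> \<open>qi\<close>, the summands of \<Delta>(e) and \<Delta>(f). The mixed
  commutators vanish and the two pure ones survive.\<close>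

lemma (in staralg) commutator_sum:
  assumes [simp, intro]: "A \<in> carrier V" "B \<in> carrier V" "C \<in> carrier V" "D \<in> carrier V"
    and "A \<otimes> D = D \<otimes> A" "B \<otimes> C = C \<otimes> B"
  shows "(A \<oplus> B) \<otimes> (C \<oplus> D) \<oplus> (-1) \<odot> ((C \<oplus> D) \<otimes> (A \<oplus> B)) =
    (A \<otimes> C \<oplus> (-1) \<odot> (C \<otimes> A)) \<oplus> (B \<otimes> D \<oplus> (-1) \<odot> (D \<otimes> B))"
proof -
  have "(A \<oplus> B) \<otimes> (C \<oplus> D) = (A \<otimes> C \<oplus> B \<otimes> D) \<oplus> (A \<otimes> D \<oplus> B \<otimes> C)"
    by (simp add: l_distr r_distr a_ac)
  moreover have "(C \<oplus> D) \<otimes> (A \<oplus> B) = (C \<otimes> A \<oplus> D \<otimes> B) \<oplus> (A \<otimes> D \<oplus> B \<otimes> C)"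
    using assms by (simp add: l_distr r_distr a_ac)
  ultimately have "(A \<oplus> B) \<otimes> (C \<oplus> D) \<oplus> (-1) \<odot> ((C \<oplus> D) \<otimes> (A \<oplus> B)) =
     (A \<otimes> C \<oplus> B \<otimes> D) \<oplus> (-1) \<odot> (C \<otimes> A \<oplus> D \<otimes> B) \<oplus>
     ((A \<otimes> D \<oplus> B \<otimes> C) \<oplus> (-1) \<odot> (A \<otimes> D \<oplus> B \<otimes> C))"
    by (simp add: smult_add a_ac del: r_neg)
  also have "\<dots> = (A \<otimes> C \<oplus> B \<otimes> D) \<oplus> (-1) \<odot> (C \<otimes> A \<oplus> D \<otimes> B)"
    by simp
  finally show ?thesis by (simp add: smult_add a_ac)
qed

context uq_alg
begin

lemma uq_alg_tensor:
  "uq_alg (tensor_alg V V) t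
    (tensor V V q e \<oplus>\<^sub>2 tensor V V e qi)
    (tensor V V q f \<oplus>\<^sub>2 tensor V V f qi) (tensor V V q q) (tensor V V qi qi)"
proof -
  interpret P: tensor_pair V V by unfold_locales
  let ?T = "tensor_alg V V"
  interpret T: staralg ?T by (rule P.staralg_tensor)
  note [simp] = P.tensor_closed P.tensor_mult1 P.tensor_one1 P.tensor_star1
  let ?l = "complex_of_real (exp t)"
  let ?c = "inverse (?l - inverse ?l)"
  show ?thesis
  proof
    show "tensor V V q q \<otimes>\<^sub>2 (tensor V V q e \<oplus>\<^sub>2 tensor V V e qi) =
      ?l \<odot>\<^sub>2 ((tensor V V q e \<oplus>\<^sub>2 tensor V V e qi) \<otimes>\<^sub>2 tensor V V q q)"
      by (simp add: T.l_distr T.r_distr q_e q_qi qi_q P.tensor_smult_left P.tensor_smult_right T.smult_add)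
    show "tensor V V q q \<otimes>\<^sub>2 (tensor V V q f \<oplus>\<^sub>2 tensor V V f qi) =
      inverse ?l \<odot>\<^sub>2 ((tensor V V q f \<oplus>\<^sub>2 tensor V V f qi) \<otimes>\<^sub>2 tensor V V q q)"
      by (simp add: T.l_distr T.r_distr q_f q_qi qi_q P.tensor_smult_left P.tensor_smult_right T.smult_add)
    \<comment> \<open>Moving q past f in the first leg and \<open>qi\<close> past e in the second
      produces the same scalar \<open>inverse ?l\<close>, so the two products agree.\<close>
    have 1: "tensor V V q e \<otimes>\<^sub>2 tensor V V f qi = tensor V V f qi \<otimes>\<^sub>2 tensor V V q e"
      by (simp add: q_f qi_e P.tensor_smult_left P.tensor_smult_right)
    have 2: "tensor V V e qi \<otimes>\<^sub>2 tensor V V q f = tensor V V q f \<otimes>\<^sub>2 tensor V V e qi"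
      by (simp add: q_e qi_f P.tensor_smult_left P.tensor_smult_right)
    have "(tensor V V q e \<oplus>\<^sub>2 tensor V V e qi) \<otimes>\<^sub>2 (tensor V V q f \<oplus>\<^sub>2 tensor V V f qi) \<oplus>\<^sub>2
      (-1) \<odot>\<^sub>2 ((tensor V V q f \<oplus>\<^sub>2 tensor V V f qi) \<otimes>\<^sub>2 (tensor V V q e \<oplus>\<^sub>2 tensor V V e qi)) =
      (tensor V V (q \<otimes> q) (e \<otimes> f) \<oplus>\<^sub>2 (-1) \<odot>\<^sub>2 tensor V V (q \<otimes> q) (f \<otimes> e)) \<oplus>\<^sub>2
      (tensor V V (e \<otimes> f) (qi \<otimes> qi) \<oplus>\<^sub>2 (-1) \<odot>\<^sub>2 tensor V V (f \<otimes> e) (qi \<otimes> qi))"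
      using T.commutator_sum[OF _ _ _ _ 1 2] by simp
    also have "\<dots> = tensor V V (q \<otimes> q) (e \<otimes> f \<oplus> (-1) \<odot> (f \<otimes> e)) \<oplus>\<^sub>2
        tensor V V (e \<otimes> f \<oplus> (-1) \<odot> (f \<otimes> e)) (qi \<otimes> qi)"
      by (simp add: P.tensor_bilinear)
    \<comment> \<open>The two commutators contribute q^2 \<otimes> q^-2 with opposite signs; the
      bracketed pair cancels in the next step.\<close>
    also have "\<dots> = ?c \<odot>\<^sub>2 (tensor V V (q \<otimes> q) (q \<otimes> q) \<oplus>\<^sub>2
        ((-1) \<odot>\<^sub>2 tensor V V (q \<otimes> q) (qi \<otimes> qi) \<oplus>\<^sub>2 tensor V V (q \<otimes> q) (qi \<otimes> qi)) \<oplus>\<^sub>2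
        (-1) \<odot>\<^sub>2 tensor V V (qi \<otimes> qi) (qi \<otimes> qi))"
      by (simp only: e_f) (simp add: P.tensor_bilinear T.a_ac T.smult_add del: T.r_neg)
    also have "\<dots> = ?c \<odot>\<^sub>2 (tensor V V (q \<otimes> q) (q \<otimes> q) \<oplus>\<^sub>2
        (-1) \<odot>\<^sub>2 tensor V V (qi \<otimes> qi) (qi \<otimes> qi))"
      using T.a_comm[of "(-1) \<odot>\<^sub>2 tensor V V (q \<otimes> q) (qi \<otimes> qi)" "tensor V V (q \<otimes> q) (qi \<otimes> qi)"]
      by simp
    finally show "(tensor V V q e \<oplus>\<^sub>2 tensor V V e qi) \<otimes>\<^sub>2 (tensor V V q f \<oplus>\<^sub>2 tensor V V f qi) \<oplus>\<^sub>2
      (-1) \<odot>\<^sub>2 ((tensor V V q f \<oplus>\<^sub>2 tensor V V f qi) \<otimes>\<^sub>2 (tensor V V q e \<oplus>\<^sub>2 tensor V V e qi)) =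
      ?c \<odot>\<^sub>2 (tensor V V q q \<otimes>\<^sub>2 tensor V V q q \<oplus>\<^sub>2
        (-1) \<odot>\<^sub>2 (tensor V V qi qi \<otimes>\<^sub>2 tensor V V qi qi))" by simp
  qed (simp_all add: q_qi qi_q T.star_add star_e star_f star_q star_qi)
qed

end

text \<open>The map \<open>x \<mapsto> S(x\<^sup>*)\<close> is a conjugate linear multiplicative map, and it satisfies
  \<open>S(x\<^sup>*\<^sup>*) = q\<^sup>-\<^sup>2 S(x\<^sup>*)\<^sup>* q\<^sup>2\<close> because \<open>S\<^sup>2\<close> is conjugation by \<open>q\<^sup>-\<^sup>2\<close>. It is thus a
  *-homomorphism into the following *-algebra.\<close>

definition twisted_alg :: "'a star_alg \<Rightarrow> 'a \<Rightarrow> 'a \<Rightarrow> 'a star_alg" where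
  "twisted_alg V q qi = \<lparr>carrier = carrier V, monoid.mult = monoid.mult V, one = monoid.one V,
     zero = ring.zero V, add = ring.add V, module.smult = (\<lambda>c. module.smult V (cnj c)),
     star = (\<lambda>x. qi \<otimes>\<^bsub>V\<^esub> (qi \<otimes>\<^bsub>V\<^esub> star V x \<otimes>\<^bsub>V\<^esub> q) \<otimes>\<^bsub>V\<^esub> q)\<rparr>"

lemma twisted_alg_simps [simp]:
  "carrier (twisted_alg V q qi) = carrier V"
  "monoid.mult (twisted_alg V q qi) = monoid.mult V"
  "monoid.one (twisted_alg V q qi) = monoid.one V"
  "ring.zero (twisted_alg V q qi) = ring.zero V"
  "ring.add (twisted_alg V q qi) = ring.add V"
  "module.smult (twisted_alg V q qi) c = module.smult V (cnj c)"
  "star (twisted_alg V q qi) x = qi \<otimes>\<^bsub>V\<^esub> (qi \<otimes>\<^bsub>V\<^esub> star V x \<otimes>\<^bsub>V\<^esub> q) \<otimes>\<^bsub>V\<^esub> q"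
  by (simp_all add: twisted_alg_def)

text \<open>The four elements are the images of e, f, q and \<open>qi\<close> under star followed by
  S. For example, compatibility with the twisted involution at e reads -\<lambda> q^-2 e q^2 =
  -\<lambda>^-1 e.\<close>

lemma (in uq_alg) uq_alg_twisted:
  "uq_alg (twisted_alg V q qi) t ((- complex_of_real (exp t)) \<odot> f)
    ((- inverse (complex_of_real (exp t))) \<odot> e) qi q"
proof -
  have conj_mult: "qi \<otimes> (x \<otimes> y) \<otimes> q = (qi \<otimes> x \<otimes> q) \<otimes> (qi \<otimes> y \<otimes> q)"
    if "x \<in> carrier V" "y \<in> carrier V" for x y
    using that by (simp add: m_assoc cancel_q)
  interpret W: staralg "twisted_alg V q qi"
    by unfold_locales
      (simp_all add: a_ac smult_add add_smult m_assoc r_distr l_distr smult_l smult_r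
        star_add star_smult star_mult star_q star_qi cancel_q q_qi qi_q)
  let ?l = "complex_of_real (exp t)"
  let ?c = "inverse (?l - inverse ?l)"
  have 1: "f \<otimes> e \<oplus> (-1) \<odot> (e \<otimes> f) = ?c \<odot> (qi \<otimes> qi \<oplus> (-1) \<odot> (q \<otimes> q))"
  proof -
    have "f \<otimes> e \<oplus> (-1) \<odot> (e \<otimes> f) = (-1) \<odot> (e \<otimes> f \<oplus> (-1) \<odot> (f \<otimes> e))"
      by (simp add: smult_add a_comm)
    also have "\<dots> = (-1) \<odot> (?c \<odot> (q \<otimes> q \<oplus> (-1) \<odot> (qi \<otimes> qi)))" by (simp only: e_f)
    also have "\<dots> = ?c \<odot> (qi \<otimes> qi \<oplus> (-1) \<odot> (q \<otimes> q))" by (simp add: smult_add a_comm)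
    finally show ?thesis .
  qed
  show ?thesis
  proof
    show "((- ?l) \<odot> f) \<otimes>\<^bsub>twisted_alg V q qi\<^esub> ((- inverse ?l) \<odot> e) \<oplus>\<^bsub>twisted_alg V q qi\<^esub>
      (-1) \<odot>\<^bsub>twisted_alg V q qi\<^esub> (((- inverse ?l) \<odot> e) \<otimes>\<^bsub>twisted_alg V q qi\<^esub> ((- ?l) \<odot> f)) =
      ?c \<odot>\<^bsub>twisted_alg V q qi\<^esub> (qi \<otimes>\<^bsub>twisted_alg V q qi\<^esub> qi \<oplus>\<^bsub>twisted_alg V q qi\<^esub>
        (-1) \<odot>\<^bsub>twisted_alg V q qi\<^esub> (q \<otimes>\<^bsub>twisted_alg V q qi\<^esub> q))"
      using 1 by (simp add: smult_l smult_r)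
  qed (simp_all add: q_qi qi_q qi_e qi_f smult_l smult_r star_smult star_e star_f star_q star_qi
    m_assoc cancel_q)
qed


section \<open>The irreducible representations\<close>

lemma op_alg_simps [simp]:
  "carrier (op_alg n) = carrier_mat (Suc n) (Suc n)"
  "monoid.mult (op_alg n) = (*)"
  "monoid.one (op_alg n) = 1\<^sub>m (Suc n)"
  "ring.zero (op_alg n) = 0\<^sub>m (Suc n) (Suc n)"
  "ring.add (op_alg n) = (+)"
  "module.smult (op_alg n) = (\<cdot>\<^sub>m)"
  "star (op_alg n) = mat_adjoint"
  by (simp_all add: op_alg_def)

lemma mat_adjoint_carrier [simp]:
  "(A :: complex mat) \<in> carrier_mat n m \<Longrightarrow> mat_adjoint A \<in> carrier_mat m n"
  by (auto simp: mat_adjoint_def)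

lemma mat_adjoint_dim [simp]:
  "dim_row (mat_adjoint (A :: complex mat)) = dim_col A"
  "dim_col (mat_adjoint (A :: complex mat)) = dim_row A"
  by (auto simp: mat_adjoint_def)

lemma mat_adjoint_index [simp]:
  "i < dim_col A \<Longrightarrow> j < dim_row A \<Longrightarrow> mat_adjoint (A :: complex mat) $$ (i, j) = cnj (A $$ (j, i))"
  by (simp add: mat_adjoint_def mat_of_rows_def)

lemma mult_mat_index:
  assumes "A \<in> carrier_mat (Suc n) (Suc n)" "B \<in> carrier_mat (Suc n) (Suc n)" "i \<le> n" "j \<le> n"
  shows "(A * B) $$ (i, j) = (\<Sum>k\<le>n. A $$ (i, k) * B $$ (k, j :: nat) :: complex)"
  using assms by (simp add: scalar_prod_def atLeast0LessThan lessThan_Suc_atMost)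

lemma op_alg_eqI:
  assumes "A \<in> carrier_mat (Suc n) (Suc n)" "B \<in> carrier_mat (Suc n) (Suc n)"
    and "\<And>i j. i \<le> n \<Longrightarrow> j \<le> n \<Longrightarrow> A $$ (i, j) = B $$ (i, j)"
  shows "A = B"
  using assms by (intro eq_matI) auto

lemma staralg_op_alg: "staralg (op_alg n)"
proof
  fix A B :: "complex mat" assume *: "A \<in> carrier (op_alg n)" "B \<in> carrier (op_alg n)"
  have "mat_adjoint (A * B) = mat_adjoint B * mat_adjoint A"
    using * by (intro op_alg_eqI[of _ n]) (auto simp: mult_mat_index[of _ n] mult.commute simp del: index_mult_mat(1))
  then show "star (op_alg n) (A \<otimes>\<^bsub>op_alg n\<^esub> B) = star (op_alg n) B \<otimes>\<^bsub>op_alg n\<^esub> star (op_alg n) A"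
    by simp
qed (auto simp: comm_add_mat add_smult_distrib_left_mat add_smult_distrib_right_mat
  mult_add_distrib_mat add_mult_distrib_mat intro: assoc_add_mat intro!: eq_matI)

lemma staralg_complex_alg: "staralg complex_alg"
  by unfold_locales (auto simp: complex_alg_def algebra_simps)

section \<open>Quantum integers and the coefficients of the representations\<close>

declare rep_coeff.simps(2) [simp del]

lemma sinh_mult_sinh: "sinh x * sinh y = (cosh (x + y) - cosh (x - y)) / (2 :: real)"
  by (simp add: cosh_add cosh_diff)

locale quantum =
  fixes t :: real
  assumes t_pos: "t > 0"
begin

abbreviation lam :: complex where "lam \<equiv> complex_of_real (exp t)"

definition qv :: "nat \<Rightarrow> nat \<Rightarrow> complex" where
  "qv n i = complex_of_real (exp (t * weight n i))"

abbreviation rc :: "nat \<Rightarrow> nat \<Rightarrow> complex" where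
  "rc n i \<equiv> complex_of_real (rep_coeff t n i)"

text \<open>With the quantum integers [k] = sinh(k t) / sinh t the square is [i][n+1-i], and the
  recursion telescopes once products of sinh are written as differences of cosh. At i = n + 2 the
  radicand is negative, whence the restriction on i.\<close>

lemma rep_coeff_nonneg: "rep_coeff t n i \<ge> 0 \<or> i > Suc n"
  and rep_coeff_square: "i \<le> Suc n \<Longrightarrow>
    (rep_coeff t n i)\<^sup>2 = sinh (real i * t) * sinh ((real n + 1 - real i) * t) / (sinh t)\<^sup>2"
proof -
  have s: "sinh t > 0" using t_pos by simp
  have *: "i \<le> Suc n \<Longrightarrow> rep_coeff t n i \<ge> 0 \<and>
    (rep_coeff t n i)\<^sup>2 = sinh (real i * t) * sinh ((real n + 1 - real i) * t) / (sinh t)\<^sup>2" for i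
  proof (induction i)
    case (Suc i)
    have "exp t powr (2 * weight n i) - exp t powr (- 2 * weight n i) = 2 * sinh ((real n - 2 * real i) * t)"
      by (simp add: powr_def sinh_field_def weight_def algebra_simps)
    moreover have "exp t - inverse (exp t) = 2 * sinh t"
      by (simp add: sinh_field_def exp_minus)
    moreover have "sinh (real i * t) * sinh ((real n + 1 - real i) * t) / (sinh t)\<^sup>2 +
        sinh ((real n - 2 * real i) * t) / sinh t =
        sinh (real (Suc i) * t) * sinh ((real n + 1 - real (Suc i)) * t) / (sinh t)\<^sup>2"
    proof -
      have "sinh (real i * t) * sinh ((real n + 1 - real i) * t) + sinh ((real n - 2 * real i) * t) * sinh t =
          sinh (real (Suc i) * t) * sinh ((real n + 1 - real (Suc i)) * t)"
      proof -
        \<comment> \<open>Since cosh is even, the inner two of the four cosh terms agree, and the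
          sum has the telescoping form (a - b)/2 + (b - c)/2.\<close>
        have "cosh (real i * t - (real n + 1 - real i) * t) = cosh ((real n - 2 * real i) * t + t)"
          by (subst cosh_minus[symmetric]) (simp add: algebra_simps)
        moreover have "cosh ((real n - 2 * real i) * t - t) =
            cosh (real (Suc i) * t - (real n + 1 - real (Suc i)) * t)"
          by (subst cosh_minus[symmetric]) (simp add: algebra_simps)
        moreover have "cosh (real i * t + (real n + 1 - real i) * t) = cosh (real (Suc i) * t + (real n + 1 - real (Suc i)) * t)"
          by (simp add: algebra_simps)
        moreover have "(a - b) / 2 + (b - c) / 2 = (a - c) / 2" for a b c :: real
          by (simp add: field_simps)
        ultimately show ?thesis unfolding sinh_mult_sinh by (simp only:)
      qed
      then show ?thesis using s by (simp add: field_simps power2_eq_square)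
    qed
    ultimately have sum: "(rep_coeff t n i)\<^sup>2 +
      (exp t powr (2 * weight n i) - exp t powr (- 2 * weight n i)) / (exp t - inverse (exp t)) =
      sinh (real (Suc i) * t) * sinh ((real n + 1 - real (Suc i)) * t) / (sinh t)\<^sup>2" (is "?A = ?B")
      using Suc by simp
    have "0 \<le> ?B" using Suc.prems t_pos s by (intro divide_nonneg_nonneg mult_nonneg_nonneg) auto
    moreover have "rep_coeff t n (Suc i) = sqrt ?B" using sum by (simp only: rep_coeff.simps)
    ultimately show ?case by (simp only: real_sqrt_ge_zero real_sqrt_pow2 simp_thms)
  qed simp
  show "rep_coeff t n i \<ge> 0 \<or> i > Suc n" using * by force
  show "i \<le> Suc n \<Longrightarrow> (rep_coeff t n i)\<^sup>2 =
      sinh (real i * t) * sinh ((real n + 1 - real i) * t) / (sinh t)\<^sup>2"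
    using * by blast
qed

lemma rep_coeff_pos: "0 < i \<Longrightarrow> i \<le> n \<Longrightarrow> rep_coeff t n i > 0"
proof -
  assume i: "0 < i" "i \<le> n"
  then have "(rep_coeff t n i)\<^sup>2 > 0"
    using t_pos by (subst rep_coeff_square) (auto intro!: divide_pos_pos mult_pos_pos)
  then have "rep_coeff t n i \<noteq> 0" by auto
  then show ?thesis using rep_coeff_nonneg[of n i] i by linarith
qed

text \<open>The coefficient one step below the lowest weight vanishes, so formulas for e and f hold
  at the ends of the index range without case distinctions.\<close>

lemma rep_coeff_last [simp]: "rep_coeff t n (Suc n) = 0"
  using rep_coeff_square[of "Suc n" n] by simp

text \<open>The closed form is invariant under i -> n + 1 - i. Hence reversing the basis exchanges e
  and f up to scalars, which \<open>repE_tau\<close> relies on.\<close>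

lemma rep_coeff_symmetric:
  assumes "i \<le> Suc n"
  shows "rep_coeff t n (Suc n - i) = rep_coeff t n i"
proof -
  have "(rep_coeff t n (Suc n - i))\<^sup>2 = (rep_coeff t n i)\<^sup>2"
    using assms by (subst (1 2) rep_coeff_square) (auto simp: of_nat_diff algebra_simps)
  then show ?thesis using rep_coeff_nonneg[of n i] rep_coeff_nonneg[of n "Suc n - i"] assms
    by (metis diff_le_self not_less power2_eq_imp_eq)
qed

text \<open>The diagonal entry of the relation for ef - fe. The bound on \<open>i\<close> makes the
  radicand nonnegative, so that squaring undoes the root.\<close>

lemma rep_coeff_step:
  assumes "i \<le> n"
  shows "(rc n (Suc i))\<^sup>2 - (rc n i)\<^sup>2 = inverse (lam - inverse lam) * ((qv n i)\<^sup>2 - inverse ((qv n i)\<^sup>2))"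
proof -
  have 0: "0 \<le> (rep_coeff t n i)\<^sup>2 +
    (exp t powr (2 * weight n i) - exp t powr (- 2 * weight n i)) / (exp t - inverse (exp t))"
    using rep_coeff_nonneg[of n "Suc i"] assms by (auto simp: rep_coeff.simps(2))
  have "exp t powr (2 * weight n i) = (exp (t * weight n i))\<^sup>2"
    by (simp add: powr_def power2_eq_square flip: exp_add)
  moreover have "exp t powr (- 2 * weight n i) = inverse ((exp (t * weight n i))\<^sup>2)"
    by (simp add: powr_def power2_eq_square flip: exp_add exp_minus)
  ultimately have "(rep_coeff t n (Suc i))\<^sup>2 - (rep_coeff t n i)\<^sup>2 =
      inverse (exp t - inverse (exp t)) * ((exp (t * weight n i))\<^sup>2 - inverse ((exp (t * weight n i))\<^sup>2))"
    using 0 by (simp add: divide_inverse mult.commute rep_coeff.simps(2))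
  then have "complex_of_real ((rep_coeff t n (Suc i))\<^sup>2 - (rep_coeff t n i)\<^sup>2) = complex_of_real
     (inverse (exp t - inverse (exp t)) * ((exp (t * weight n i))\<^sup>2 - inverse ((exp (t * weight n i))\<^sup>2)))"
    by (simp only:)
  then show ?thesis by (simp add: qv_def)
qed

lemma qv_nonzero [simp]: "qv n i \<noteq> 0"
  by (simp add: qv_def)

lemma qv_Suc: "qv n (Suc i) = inverse lam * qv n i"
proof -
  have "t * weight n (Suc i) = t * weight n i - t" by (simp add: weight_def algebra_simps)
  then show ?thesis by (simp add: qv_def exp_diff divide_inverse mult.commute)
qed

lemma lam_nonzero [simp]: "lam \<noteq> 0"
  by simp

definition rep_qi :: "nat \<Rightarrow> complex mat" where
  "rep_qi n = mat (n + 1) (n + 1) (\<lambda>(i, j). if i = j then inverse (qv n j) else 0)"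

lemma rep_q_eq: "rep_q t n = mat (n + 1) (n + 1) (\<lambda>(i, j). if i = j then qv n j else 0)"
  by (auto simp: rep_q_def qv_def powr_def mult.commute intro!: eq_matI)

lemma rep_carrier [simp]:
  "rep_q t n \<in> carrier_mat (Suc n) (Suc n)" "rep_qi n \<in> carrier_mat (Suc n) (Suc n)"
  "rep_e t n \<in> carrier_mat (Suc n) (Suc n)" "rep_f t n \<in> carrier_mat (Suc n) (Suc n)"
  by (simp_all add: rep_q_def rep_qi_def rep_e_def rep_f_def)

lemma rep_dim [simp]:
  "dim_row (rep_q t n) = Suc n" "dim_col (rep_q t n) = Suc n"
  "dim_row (rep_qi n) = Suc n" "dim_col (rep_qi n) = Suc n"
  "dim_row (rep_e t n) = Suc n" "dim_col (rep_e t n) = Suc n"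
  "dim_row (rep_f t n) = Suc n" "dim_col (rep_f t n) = Suc n"
  by (simp_all add: rep_q_def rep_qi_def rep_e_def rep_f_def)

lemma rep_mult_index:
  assumes "A \<in> carrier_mat (Suc n) (Suc n)" "i \<le> n" "j \<le> n"
  shows "(rep_q t n * A) $$ (i, j) = qv n i * A $$ (i, j)"
    "(rep_qi n * A) $$ (i, j) = inverse (qv n i) * A $$ (i, j)"
    "(rep_e t n * A) $$ (i, j) = (if i < n then rc n (Suc i) * A $$ (Suc i, j) else 0)"
    "(rep_f t n * A) $$ (i, j) = (if i = 0 then 0 else rc n i * A $$ (i - 1, j))"
proof -
  show "(rep_q t n * A) $$ (i, j) = qv n i * A $$ (i, j)"
    using assms by (subst mult_mat_index[of _ n]) (auto simp: rep_q_eq if_distrib if_distribR cong: if_cong)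
  show "(rep_qi n * A) $$ (i, j) = inverse (qv n i) * A $$ (i, j)"
    using assms by (subst mult_mat_index[of _ n]) (auto simp: rep_qi_def if_distrib if_distribR cong: if_cong)
  show "(rep_e t n * A) $$ (i, j) = (if i < n then rc n (Suc i) * A $$ (Suc i, j) else 0)"
  proof -
    have "(rep_e t n * A) $$ (i, j) = (\<Sum>k\<le>n. if k = Suc i then rc n k * A $$ (k, j) else 0)"
      using assms by (subst mult_mat_index[of _ n], simp_all only: rep_carrier)
        (rule sum.cong, auto simp: rep_e_def)
    also have "\<dots> = (if Suc i \<in> {..n} then rc n (Suc i) * A $$ (Suc i, j) else 0)"
      by (rule sum.delta) simp
    finally show ?thesis by (simp add: Suc_le_eq)
  qed
  show "(rep_f t n * A) $$ (i, j) = (if i = 0 then 0 else rc n i * A $$ (i - 1, j))"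
  proof -
    have "(rep_f t n * A) $$ (i, j) = (\<Sum>k\<le>n. if i = Suc k then rc n i * A $$ (k, j) else 0)"
      using assms by (subst mult_mat_index[of _ n], simp_all only: rep_carrier)
        (rule sum.cong, auto simp: rep_f_def)
    then show ?thesis using assms(2) by (cases i) (simp_all add: sum.delta)
  qed
qed

lemma rep_index:
  assumes "i \<le> n" "j \<le> n"
  shows "rep_q t n $$ (i, j) = (if i = j then qv n j else 0)"
    "rep_qi n $$ (i, j) = (if i = j then inverse (qv n j) else 0)"
    "rep_e t n $$ (i, j) = (if j = Suc i then rc n j else 0)"
    "rep_f t n $$ (i, j) = (if i = Suc j then rc n i else 0)"
  using assms by (auto simp: rep_q_eq rep_qi_def rep_e_def rep_f_def)

lemma uq_alg_rep: "uq_alg (op_alg n) t (rep_e t n) (rep_f t n) (rep_q t n) (rep_qi n)"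
proof -
  interpret staralg "op_alg n" by (rule staralg_op_alg)
  note index = rep_mult_index rep_index
  have c: "A * B \<in> carrier_mat (Suc n) (Suc n)"
    if "A \<in> carrier_mat (Suc n) (Suc n)" "B \<in> carrier_mat (Suc n) (Suc n)" for A B :: "complex mat"
    using that by simp
  have "rep_q t n * rep_e t n = lam \<cdot>\<^sub>m (rep_e t n * rep_q t n)"
    by (rule op_alg_eqI[of _ n]) (auto intro!: carrier_matI simp: index qv_Suc simp del: index_mult_mat(1))
  moreover have "rep_q t n * rep_f t n = inverse lam \<cdot>\<^sub>m (rep_f t n * rep_q t n)"
    by (rule op_alg_eqI[of _ n]) (auto intro!: carrier_matI simp: index qv_Suc simp del: index_mult_mat(1))
  moreover have "rep_q t n * rep_qi n = 1\<^sub>m (Suc n)" "rep_qi n * rep_q t n = 1\<^sub>m (Suc n)"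
    by (rule op_alg_eqI[of _ n]; auto intro!: carrier_matI simp: index simp del: index_mult_mat(1))+
  moreover have "mat_adjoint (rep_e t n) = rep_f t n"
    by (rule op_alg_eqI[of _ n]) (auto simp: rep_e_def rep_f_def)
  moreover have "mat_adjoint (rep_q t n) = rep_q t n"
    by (rule op_alg_eqI[of _ n]) (auto simp: rep_q_eq qv_def)
  moreover have "rep_e t n * rep_f t n + (-1) \<cdot>\<^sub>m (rep_f t n * rep_e t n) =
    inverse (lam - inverse lam) \<cdot>\<^sub>m (rep_q t n * rep_q t n + (-1) \<cdot>\<^sub>m (rep_qi n * rep_qi n))" (is "?A = ?B")
  proof (rule op_alg_eqI[of _ n])
    fix i j assume ij: "i \<le> n" "j \<le> n"
    have "?A $$ (i, j) = (if i = j then (rc n (Suc i))\<^sup>2 - (rc n i)\<^sup>2 else 0)"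
      using ij by (cases "i = n"; cases i) (auto simp: index power2_eq_square simp del: index_mult_mat(1))
    moreover have "?B $$ (i, j) = (if i = j then inverse (lam - inverse lam) * ((qv n i)\<^sup>2 - inverse ((qv n i)\<^sup>2)) else 0)"
      using ij by (auto simp: index power2_eq_square simp del: index_mult_mat(1))
    ultimately show "?A $$ (i, j) = ?B $$ (i, j)"
      using rep_coeff_step[OF ij(1)] by (simp only:)
  qed (simp_all add: c)
  ultimately show ?thesis by unfold_locales auto
qed

end


text \<open>The description fixes h at q, e and f only; its value at \<open>Gqinv\<close> is then
  forced, because inverses are unique.\<close>

lemma (in uq_alg) the_star_hom:
  "(THE h. h \<in> star_homs (uq t) V \<inter> extensional (carrier (uq t)) \<and>
      h (uq_el t Gq) = q \<and> h (uq_el t Ge) = e \<and> h (uq_el t Gf) = f) =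
    lift (uq_relations t) V (case_uq_gen e f q qi)"
proof (rule the_equality)
  note lift = lift_cls[OF case_gens_closed interp_relations]
  note lift_hom = lift_star_homs[OF case_gens_closed interp_relations]
  show "lift (uq_relations t) V (case_uq_gen e f q qi) \<in> star_homs (uq t) V \<inter> extensional (carrier (uq t)) \<and>
      lift (uq_relations t) V (case_uq_gen e f q qi) (uq_el t Gq) = q \<and>
      lift (uq_relations t) V (case_uq_gen e f q qi) (uq_el t Ge) = e \<and>
      lift (uq_relations t) V (case_uq_gen e f q qi) (uq_el t Gf) = f"
    using lift_hom lift_extensional by (auto simp: uq_def gen_eq_cls lift)
  fix h assume h: "h \<in> star_homs (uq t) V \<inter> extensional (carrier (uq t)) \<and>
      h (uq_el t Gq) = q \<and> h (uq_el t Ge) = e \<and> h (uq_el t Gf) = f"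
  interpret U: uq_alg "uq t" t "uq_el t Ge" "uq_el t Gf" "uq_el t Gq" "uq_el t Gqinv"
    by (rule uq_alg_uq)
  have hom: "h \<in> Ring.ring_hom (uq t) V" and hq: "h (uq_el t Gq) = q"
    using h by (simp_all add: star_homs_def)
  have "h (uq_el t Gqinv) \<otimes> h (uq_el t Gq) = h (uq_el t Gqinv \<otimes>\<^bsub>uq t\<^esub> uq_el t Gq)"
    using ring_hom_mult[OF hom U.gens_closed(4,3)] by simp
  also have "\<dots> = \<one>" using ring_hom_one[OF hom] by (simp add: U.qi_q)
  finally have "h (uq_el t Gqinv) = qi"
    using ring_hom_closed[OF hom U.gens_closed(4)] by (rule_tac inverse_unique[of q]) (simp_all add: q_qi hq)
  then have "h (uq_el t a) = lift (uq_relations t) V (case_uq_gen e f q qi) (uq_el t a)" for a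
    using h by (cases a) (simp_all add: gen_eq_cls lift)
  then show "h = lift (uq_relations t) V (case_uq_gen e f q qi)"
    using h lift_hom lift_extensional
    by (intro star_hom_eqI) (auto simp: uq_def gen_eq_cls)
qed

lemma (in uq_alg) lift_uq:
  "lift (uq_relations t) V (case_uq_gen e f q qi) (cls (uq_relations t) x) = interp V (case_uq_gen e f q qi) x"
  by (rule lift_cls[OF case_gens_closed interp_relations])

section \<open>Sums over the coproduct of an expression\<close>

text \<open>Sweedler notation made concrete: the sum of F(x_(1), x_(2)). Complex values are enough
  because tensors are always tested by functionals.\<close>

definition comult_sum ::
  "('x \<Rightarrow> ('x expr \<times> 'x expr) list) \<Rightarrow> 'x expr \<Rightarrow> ('x expr \<Rightarrow> 'x expr \<Rightarrow> complex) \<Rightarrow> complex" where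
  "comult_sum d x F = (\<Sum>(p, r)\<leftarrow>expr_comult d x. F p r)"

lemma sum_list_concat: "sum_list (concat xss) = sum_list (map sum_list xss)"
  for xss :: "complex list list"
  by (induction xss) auto

lemma comult_sum_simps [simp]:
  "comult_sum d (Gen a) F = (\<Sum>(p, r)\<leftarrow>d a. F p r)"
  "comult_sum d EZero F = 0"
  "comult_sum d EOne F = F EOne EOne"
  "comult_sum d (x \<boxplus> y) F = comult_sum d x F + comult_sum d y F"
  "comult_sum d (x \<boxtimes> y) F = comult_sum d x (\<lambda>p r. comult_sum d y (\<lambda>p' r'. F (p \<boxtimes> p') (r \<boxtimes> r')))"
  "comult_sum d (c \<boxdot> x) F = comult_sum d x (\<lambda>p r. F (c \<boxdot> p) r)"
  "comult_sum d (EStar x) F = comult_sum d x (\<lambda>p r. F (EStar p) (EStar r))"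
proof -
  show "comult_sum d (x \<boxtimes> y) F = comult_sum d x (\<lambda>p r. comult_sum d y (\<lambda>p' r'. F (p \<boxtimes> p') (r \<boxtimes> r')))"
    unfolding comult_sum_def expr_comult.simps map_concat sum_list_concat map_map
    by (intro arg_cong[where f = sum_list] map_cong) (auto simp: comp_def split_def)
qed (simp_all add: comult_sum_def comp_def split_def)

lemma comult_sum_add: "comult_sum d x (\<lambda>p r. F p r + G p r) = comult_sum d x F + comult_sum d x G"
  by (simp add: comult_sum_def split_def sum_list_addf)

lemma comult_sum_mult_left: "comult_sum d x (\<lambda>p r. c * F p r) = c * comult_sum d x F"
  by (simp add: comult_sum_def split_def sum_list_const_mult)

lemma comult_sum_mult_right: "comult_sum d x (\<lambda>p r. F p r * c) = comult_sum d x F * c"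
  using comult_sum_mult_left[of d x c F] by (simp add: mult.commute)

lemma comult_sum_cnj: "comult_sum d x (\<lambda>p r. cnj (F p r)) = cnj (comult_sum d x F)"
proof -
  have "(\<Sum>x\<leftarrow>xs. cnj (g x)) = cnj (\<Sum>x\<leftarrow>xs. g x)" for xs :: "('a expr \<times> 'a expr) list" and g
    by (induction xs) auto
  then show ?thesis by (simp add: comult_sum_def split_def)
qed

lemma comult_sum_0 [simp]: "comult_sum d x (\<lambda>p r. 0) = 0"
  by (simp add: comult_sum_def split_def)

lemma comult_sum_sum:
  "comult_sum d x (\<lambda>p r. \<Sum>k\<in>K. F k p r) = (\<Sum>k\<in>K. comult_sum d x (F k))"
  by (induction K rule: infinite_finite_induct) (simp_all add: comult_sum_add)

lemma comult_sum_swap: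
  "comult_sum d x (\<lambda>p r. comult_sum d' y (\<lambda>p' r'. F p r p' r')) =
    comult_sum d' y (\<lambda>p' r'. comult_sum d x (\<lambda>p r. F p r p' r'))"
proof -
  have "(\<Sum>x\<leftarrow>xs. \<Sum>y\<leftarrow>ys. g x y) = (\<Sum>y\<leftarrow>ys. \<Sum>x\<leftarrow>xs. g x y)"
    for xs :: "('a expr \<times> 'a expr) list" and ys :: "('b expr \<times> 'b expr) list" and g :: "_ \<Rightarrow> _ \<Rightarrow> complex"
    by (induction xs) (simp_all add: sum_list_addf)
  then show ?thesis by (simp add: comult_sum_def split_def)
qed

definition uq_delta :: "uq_gen \<Rightarrow> (uq_gen expr \<times> uq_gen expr) list" where
  "uq_delta a = (case a of
      Ge \<Rightarrow> [(Gen Gq, Gen Ge), (Gen Ge, Gen Gqinv)]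
    | Gf \<Rightarrow> [(Gen Gq, Gen Gf), (Gen Gf, Gen Gqinv)]
    | Gq \<Rightarrow> [(Gen Gq, Gen Gq)]
    | Gqinv \<Rightarrow> [(Gen Gqinv, Gen Gqinv)])"

lemma uq_delta_simps [simp]:
  "uq_delta Ge = [(Gen Gq, Gen Ge), (Gen Ge, Gen Gqinv)]"
  "uq_delta Gf = [(Gen Gq, Gen Gf), (Gen Gf, Gen Gqinv)]"
  "uq_delta Gq = [(Gen Gq, Gen Gq)]"
  "uq_delta Gqinv = [(Gen Gqinv, Gen Gqinv)]"
  by (simp_all add: uq_delta_def)

text \<open>Star followed by S, on expressions. This composite is multiplicative and conjugate
  linear, unlike S, so it has a clause for each constructor; the clause for \<open>EStar\<close> is
  the involution of \<open>twisted_alg\<close>.\<close>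

primrec conj_antipode :: "real \<Rightarrow> uq_gen expr \<Rightarrow> uq_gen expr" where
  "conj_antipode t (Gen a) = (case a of
      Ge \<Rightarrow> (- complex_of_real (exp t)) \<boxdot> Gen Gf
    | Gf \<Rightarrow> (- inverse (complex_of_real (exp t))) \<boxdot> Gen Ge
    | Gq \<Rightarrow> Gen Gqinv
    | Gqinv \<Rightarrow> Gen Gq)"
| "conj_antipode t EZero = EZero"
| "conj_antipode t EOne = EOne"
| "conj_antipode t (x \<boxplus> y) = conj_antipode t x \<boxplus> conj_antipode t y"
| "conj_antipode t (x \<boxtimes> y) = conj_antipode t x \<boxtimes> conj_antipode t y"
| "conj_antipode t (c \<boxdot> x) = cnj c \<boxdot> conj_antipode t x"
| "conj_antipode t (EStar x) =
    Gen Gqinv \<boxtimes> (Gen Gqinv \<boxtimes> EStar (conj_antipode t x) \<boxtimes> Gen Gq) \<boxtimes> Gen Gq"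

section \<open>Representations, coproduct and antipode evaluated on expressions\<close>

context quantum
begin

abbreviation R :: "(uq_gen expr \<times> uq_gen expr) set" where "R \<equiv> uq_relations t"

abbreviation csum :: "uq_gen expr \<Rightarrow> (uq_gen expr \<Rightarrow> uq_gen expr \<Rightarrow> complex) \<Rightarrow> complex" where
  "csum \<equiv> comult_sum uq_delta"

abbreviation tau :: "uq_gen expr \<Rightarrow> uq_gen expr" where "tau \<equiv> conj_antipode t"

definition repE :: "nat \<Rightarrow> uq_gen expr \<Rightarrow> complex mat" where
  "repE n = interp (op_alg n) (case_uq_gen (rep_e t n) (rep_f t n) (rep_q t n) (rep_qi n))"

lemma repE_carrier [simp]: "repE n x \<in> carrier_mat (Suc n) (Suc n)"
  unfolding repE_def
  using staralg.interp_closed[OF staralg_op_alg uq_alg.case_gens_closed[OF uq_alg_rep], of n _ x] by simp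

lemma repE_dim [simp]: "dim_row (repE n x) = Suc n" "dim_col (repE n x) = Suc n"
  by (simp_all add: carrier_matD[OF repE_carrier])

lemma repE_simps [simp]:
  "repE n (Gen Ge) = rep_e t n" "repE n (Gen Gf) = rep_f t n"
  "repE n (Gen Gq) = rep_q t n" "repE n (Gen Gqinv) = rep_qi n"
  "repE n EZero = 0\<^sub>m (Suc n) (Suc n)" "repE n EOne = 1\<^sub>m (Suc n)"
  "repE n (x \<boxplus> y) = repE n x + repE n y" "repE n (x \<boxtimes> y) = repE n x * repE n y"
  "repE n (c \<boxdot> x) = c \<cdot>\<^sub>m repE n x" "repE n (EStar x) = mat_adjoint (repE n x)"
  by (simp_all add: repE_def)

lemma rep_cls: "rep t n (cls R x) = repE n x"
  unfolding rep_def uq_alg.the_star_hom[OF uq_alg_rep] repE_def by (rule uq_alg.lift_uq[OF uq_alg_rep])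

lemma repE_cong: "expr_eq R x y \<Longrightarrow> repE n x = repE n y"
  by (simp flip: rep_cls cls_eq_iff)

lemma rep_linear: "rep t n \<in> linear_maps (uq t) (op_alg n)"
  by (auto simp: linear_maps_def uq_def rep_cls elim!: presented_cases)

lemma carrier_uq: "X \<in> carrier (uq t) \<longleftrightarrow> (\<exists>x. X = cls R x)"
  by (auto simp: uq_def carrier_presented)

lemma uq_comult_cls:
  "uq_comult t (cls R x) = tcls (uq t) (uq t) (map (map_prod (cls R) (cls R)) (expr_comult uq_delta x))"
proof -
  interpret U: uq_alg "uq t" t "uq_el t Ge" "uq_el t Gf" "uq_el t Gq" "uq_el t Gqinv"
    by (rule uq_alg_uq)
  interpret P: tensor_pair "uq t" "uq t" by unfold_locales
  note T = U.uq_alg_tensor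
  let ?g = "case_uq_gen (tensor (uq t) (uq t) (uq_el t Gq) (uq_el t Ge) \<oplus>\<^bsub>tensor_alg (uq t) (uq t)\<^esub> tensor (uq t) (uq t) (uq_el t Ge) (uq_el t Gqinv))
    (tensor (uq t) (uq t) (uq_el t Gq) (uq_el t Gf) \<oplus>\<^bsub>tensor_alg (uq t) (uq t)\<^esub> tensor (uq t) (uq t) (uq_el t Gf) (uq_el t Gqinv))
    (tensor (uq t) (uq t) (uq_el t Gq) (uq_el t Gq)) (tensor (uq t) (uq t) (uq_el t Gqinv) (uq_el t Gqinv))"
  have "uq_comult t (cls R x) = interp (tensor_alg (uq t) (uq t)) ?g x"
    unfolding uq_comult_def Let_def uq_alg.the_star_hom[OF T] by (rule uq_alg.lift_uq[OF T])
  also have "?g = (\<lambda>a. tcls (uq t) (uq t) (map (map_prod (cls R) (cls R)) (uq_delta a)))"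
    using U.gens_closed
    by (intro ext) (simp add: tensor_eq_tcls P.tensor_add gen_eq_cls split: uq_gen.split)
  also have "interp (tensor_alg (uq t) (uq t)) \<dots> x =
      tcls (uq t) (uq t) (map (map_prod (cls R) (cls R)) (expr_comult uq_delta x))"
    using interp_tensor_presented[of R uq_delta x] by (simp add: uq_def)
  finally show ?thesis .
qed

text \<open>Induction on U as a plain algebra. Star maps generators to generators, so proving
  \<open>P\<close> for x and for its adjoint simultaneously disposes of the star step.\<close>

lemma uq_induct:
  assumes cong: "\<And>x y. expr_eq R x y \<Longrightarrow> P x \<Longrightarrow> P y"
    and gen: "\<And>a. P (Gen a)" and "P EZero" "P EOne"
    and add: "\<And>x y. P x \<Longrightarrow> P y \<Longrightarrow> P (x \<boxplus> y)"
    and mult: "\<And>x y. P x \<Longrightarrow> P y \<Longrightarrow> P (x \<boxtimes> y)"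
    and smult: "\<And>c x. P x \<Longrightarrow> P (c \<boxdot> x)"
  shows "P x"
proof -
  interpret U: uq_alg "uq t" t "uq_el t Ge" "uq_el t Gf" "uq_el t Gq" "uq_el t Gqinv"
    by (rule uq_alg_uq)
  have eqI: "cls R x = cls R y \<Longrightarrow> P y \<Longrightarrow> P x" for x y
    using cong cls_eq_iff by metis
  have "P x \<and> P (EStar x)"
  proof (induction x)
    case (Gen a)
    have "P (EStar (Gen Ge))" by (rule eqI[OF _ gen[of Gf]]) (use U.star_e in \<open>simp add: gen_eq_cls uq_def\<close>)
    moreover have "P (EStar (Gen Gf))" by (rule eqI[OF _ gen[of Ge]]) (use U.star_f in \<open>simp add: gen_eq_cls uq_def\<close>)
    moreover have "P (EStar (Gen Gq))" by (rule eqI[OF _ gen[of Gq]]) (use U.star_q in \<open>simp add: gen_eq_cls uq_def\<close>)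
    moreover have "P (EStar (Gen Gqinv))" by (rule eqI[OF _ gen[of Gqinv]]) (use U.star_qi in \<open>simp add: gen_eq_cls uq_def\<close>)
    ultimately show ?case using gen by (cases a) auto
  next
    case EZero
    have "P (EStar EZero)" by (rule eqI[OF _ assms(3)]) (use U.star_zero in \<open>simp add: uq_def\<close>)
    then show ?case using assms(3) by simp
  next
    case EOne
    have "P (EStar EOne)" by (rule eqI[OF _ assms(4)]) (use U.star_one in \<open>simp add: uq_def\<close>)
    then show ?case using assms(4) by simp
  next
    case (EAdd x y)
    then show ?case by (metis add cong expr_eq.star_add expr_eq.sym)
  next
    case (EMul x y)
    then show ?case by (metis mult cong expr_eq.star_mul expr_eq.sym)
  next
    case (EScale c x)
    then show ?case by (metis smult cong expr_eq.star_scale expr_eq.sym)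
  next
    case (EStar x)
    then show ?case by (metis cong expr_eq.star_star expr_eq.sym)
  qed
  then show ?thesis by simp
qed

lemma antihom_cls:
  assumes S: "S \<in> antihoms (uq t) (uq t)"
  shows "S (cls R EZero) = cls R EZero" "S (cls R EOne) = cls R EOne"
    "S (cls R (x \<boxplus> y)) = S (cls R x) \<oplus>\<^bsub>uq t\<^esub> S (cls R y)"
    "S (cls R (x \<boxtimes> y)) = S (cls R y) \<otimes>\<^bsub>uq t\<^esub> S (cls R x)"
    "S (cls R (c \<boxdot> x)) = c \<odot>\<^bsub>uq t\<^esub> S (cls R x)"
    "S (cls R x) \<in> carrier (uq t)"
proof -
  interpret U: staralg "uq t" unfolding uq_def by (rule staralg_presented)
  have lin: "S \<in> linear_maps (uq t) (uq t)" using S by (simp add: antihoms_def)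
  have cl: "cls R z \<in> carrier (uq t)" for z by (auto simp: carrier_uq)
  have ops: "cls R (x \<boxplus> y) = cls R x \<oplus>\<^bsub>uq t\<^esub> cls R y" "cls R (x \<boxtimes> y) = cls R x \<otimes>\<^bsub>uq t\<^esub> cls R y"
    "cls R (c \<boxdot> x) = c \<odot>\<^bsub>uq t\<^esub> cls R x" "cls R EZero = \<zero>\<^bsub>uq t\<^esub>" "cls R EOne = \<one>\<^bsub>uq t\<^esub>"
    by (simp_all add: uq_def)
  show "S (cls R EZero) = cls R EZero"
    unfolding ops by (rule U.linear_map_zero[OF U.staralg_axioms lin])
  show "S (cls R EOne) = cls R EOne"
    "S (cls R (x \<boxplus> y)) = S (cls R x) \<oplus>\<^bsub>uq t\<^esub> S (cls R y)"
    "S (cls R (x \<boxtimes> y)) = S (cls R y) \<otimes>\<^bsub>uq t\<^esub> S (cls R x)"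
    "S (cls R (c \<boxdot> x)) = c \<odot>\<^bsub>uq t\<^esub> S (cls R x)"
    "S (cls R x) \<in> carrier (uq t)"
    unfolding ops using S lin cl by (auto simp: antihoms_def linear_maps_def)
qed

lemma antihom_Gqinv:
  assumes "S \<in> antihoms (uq t) (uq t)" "S (uq_el t Gq) = uq_el t Gqinv"
  shows "S (uq_el t Gqinv) = uq_el t Gq"
proof -
  interpret U: uq_alg "uq t" t "uq_el t Ge" "uq_el t Gf" "uq_el t Gq" "uq_el t Gqinv"
    by (rule uq_alg_uq)
  have "S (cls R (Gen Gq \<boxtimes> Gen Gqinv)) = \<one>\<^bsub>uq t\<^esub>"
    using U.q_qi antihom_cls(2)[OF assms(1)] by (simp add: gen_eq_cls uq_def)
  then have "S (uq_el t Gqinv) \<otimes>\<^bsub>uq t\<^esub> uq_el t Gqinv = \<one>\<^bsub>uq t\<^esub>"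
    using antihom_cls(4)[OF assms(1)] assms(2) by (simp add: gen_eq_cls)
  then show ?thesis
    using U.inverse_unique[of "uq_el t Gqinv" "S (uq_el t Gqinv)" "uq_el t Gq"]
      antihom_cls(6)[OF assms(1), of "Gen Gqinv"] U.gens_closed U.qi_q by (simp add: gen_eq_cls)
qed

text \<open>Existence: S is star followed by the lift into the twisted algebra. Uniqueness is proved
  by \<open>uq_induct\<close>, since the universal property speaks of homomorphisms and S reverses
  products.\<close>

lemma uq_antipode_cls: "uq_antipode t (cls R x) = cls R (tau (EStar x))"
proof -
  interpret U: uq_alg "uq t" t "uq_el t Ge" "uq_el t Gf" "uq_el t Gq" "uq_el t Gqinv"
    by (rule uq_alg_uq)
  let ?W = "twisted_alg (uq t) (uq_el t Gq) (uq_el t Gqinv)"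
  note W = U.uq_alg_twisted
  let ?g = "case_uq_gen ((- lam) \<odot>\<^bsub>uq t\<^esub> uq_el t Gf) ((- inverse lam) \<odot>\<^bsub>uq t\<^esub> uq_el t Ge) (uq_el t Gqinv) (uq_el t Gq)"
  define L where "L = lift R ?W ?g"
  have "interp ?W ?g y = cls R (tau y)" for y
  proof (induction y)
    case (Gen a)
    then show ?case by (cases a) (auto simp: gen_eq_cls uq_def)
  next
    case (EStar y)
    have "star ?W (cls R (tau y)) = cls R (tau (EStar y))"
      unfolding twisted_alg_simps uq_def gen_eq_cls presented_simps conj_antipode.simps ..
    then show ?case using EStar by (simp only: interp.simps)
  qed (simp_all add: uq_def)
  then have L_cls: "L (cls R y) = cls R (tau y)" for y
    unfolding L_def by (simp only: uq_alg.lift_uq[OF W])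
  have L: "L \<in> star_homs (uq t) ?W"
    using staralg.lift_star_homs[OF uq_alg.axioms(1)[OF W] uq_alg.case_gens_closed[OF W] uq_alg.interp_relations[OF W]]
    by (simp add: L_def uq_def)
  define S where "S = (\<lambda>X\<in>carrier (uq t). L (star (uq t) X))"
  have star_cls: "star (uq t) (cls R y) = cls R (EStar y)" and cl: "cls R y \<in> carrier (uq t)" for y
    by (simp_all add: uq_def)
  have S_cls: "S (cls R y) = cls R (tau (EStar y))" for y
    by (simp only: S_def restrict_apply if_True cl star_cls L_cls)
  have S_gens: "S (uq_el t Gq) = uq_el t Gqinv" "S (uq_el t Ge) = - inverse lam \<odot>\<^bsub>uq t\<^esub> uq_el t Ge"
    "S (uq_el t Gf) = - lam \<odot>\<^bsub>uq t\<^esub> uq_el t Gf"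
    using U.gens_closed
    by (simp_all add: S_def U.star_q U.star_e U.star_f) (simp_all add: gen_eq_cls L_cls uq_def)
  have S: "S \<in> antihoms (uq t) (uq t)"
    using L unfolding antihoms_def star_homs_def linear_maps_def Ring.ring_hom_def
    by (auto simp: S_def U.star_add U.star_mult U.star_smult Pi_iff)
  have "uq_antipode t = S"
    unfolding uq_antipode_def Let_def
  proof (rule the_equality)
    show "S \<in> antihoms (uq t) (uq t) \<inter> extensional (carrier (uq t)) \<and>
        S (uq_el t Gq) = uq_el t Gqinv \<and>
        S (uq_el t Ge) = - inverse lam \<odot>\<^bsub>uq t\<^esub> uq_el t Ge \<and>
        S (uq_el t Gf) = - lam \<odot>\<^bsub>uq t\<^esub> uq_el t Gf"
      using S S_gens by (simp add: S_def)
    fix S' assume S': "S' \<in> antihoms (uq t) (uq t) \<inter> extensional (carrier (uq t)) \<and>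
        S' (uq_el t Gq) = uq_el t Gqinv \<and>
        S' (uq_el t Ge) = - inverse lam \<odot>\<^bsub>uq t\<^esub> uq_el t Ge \<and>
        S' (uq_el t Gf) = - lam \<odot>\<^bsub>uq t\<^esub> uq_el t Gf"
    then have S'_hom: "S' \<in> antihoms (uq t) (uq t)" by simp
    have "S' (cls R x) = S (cls R x)" for x
    proof (induction x rule: uq_induct)
      case (1 x y)
      then show ?case by (simp flip: cls_eq_iff)
    next
      case (2 a)
      then show ?case
        using S' S_gens antihom_Gqinv[OF S] antihom_Gqinv[OF S'_hom] by (cases a) (simp_all add: gen_eq_cls)
    qed (simp_all add: antihom_cls[OF S] antihom_cls[OF S'_hom])
    moreover have "S \<in> extensional (carrier (uq t))" by (simp add: S_def)
    ultimately show "S' = S"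
      using S' by (intro extensionalityI[of _ "carrier (uq t)"]) (auto simp only: carrier_uq IntD2)
  qed
  then show ?thesis by (simp only: S_cls)
qed

subsection \<open>The map x \<mapsto> S(x*) in the representations\<close>

text \<open>Entrywise conjugation followed by conjugation with an antidiagonal matrix. Reversing the
  basis negates the weights, as S inverts q; the powers of -\<lambda> supply the scalars in S(e) and
  S(f).\<close>

definition tauM :: "nat \<Rightarrow> complex mat \<Rightarrow> complex mat" where
  "tauM n A = mat (Suc n) (Suc n) (\<lambda>(i, j). (- lam) ^ i / (- lam) ^ j * cnj (A $$ (n - i, n - j)))"

lemma tauM_carrier [simp]: "tauM n A \<in> carrier_mat (Suc n) (Suc n)"
  by (simp add: tauM_def)

lemma tauM_dim [simp]: "dim_row (tauM n A) = Suc n" "dim_col (tauM n A) = Suc n"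
  by (simp_all add: tauM_def)

lemma tauM_index [simp]:
  "i \<le> n \<Longrightarrow> j \<le> n \<Longrightarrow> tauM n A $$ (i, j) = (- lam) ^ i / (- lam) ^ j * cnj (A $$ (n - i, n - j))"
  by (simp add: tauM_def)

lemma sum_atMost_rev: "(\<Sum>k\<le>n. g (n - k)) = (\<Sum>k\<le>n. g k)" for g :: "nat \<Rightarrow> complex"
  using sum.nat_diff_reindex[of g "Suc n"] by (simp add: lessThan_Suc_atMost)

lemma tauM_mult:
  assumes "A \<in> carrier_mat (Suc n) (Suc n)" "B \<in> carrier_mat (Suc n) (Suc n)"
  shows "tauM n (A * B) = tauM n A * tauM n B"
proof (rule op_alg_eqI[of _ n])
  fix i j assume ij: "i \<le> n" "j \<le> n"
  have "(tauM n A * tauM n B) $$ (i, j) =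
      (\<Sum>k\<le>n. (- lam) ^ i / (- lam) ^ j * (cnj (A $$ (n - i, n - k)) * cnj (B $$ (n - k, n - j))))"
    using ij by (subst mult_mat_index[of _ n]) (auto intro!: sum.cong)
  also have "\<dots> = (- lam) ^ i / (- lam) ^ j * (\<Sum>k\<le>n. cnj (A $$ (n - i, n - k)) * cnj (B $$ (n - k, n - j)))"
    by (simp only: sum_distrib_left)
  also have "(\<Sum>k\<le>n. cnj (A $$ (n - i, n - k)) * cnj (B $$ (n - k, n - j))) = cnj ((A * B) $$ (n - i, n - j))"
    using sum_atMost_rev[of "\<lambda>k. cnj (A $$ (n - i, k)) * cnj (B $$ (k, n - j))" n] ij assms
    by (subst mult_mat_index[of _ n]) auto
  finally show "tauM n (A * B) $$ (i, j) = (tauM n A * tauM n B) $$ (i, j)"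
    using ij by simp
qed (use assms in \<open>auto intro!: carrier_matI\<close>)

lemma tauM_tauM: "A \<in> carrier_mat (Suc n) (Suc n) \<Longrightarrow> tauM n (tauM n A) = A"
  by (rule op_alg_eqI[of _ n]) (auto simp: field_simps power_diff)

lemma tauM_add: "A \<in> carrier_mat (Suc n) (Suc n) \<Longrightarrow> B \<in> carrier_mat (Suc n) (Suc n) \<Longrightarrow>
    tauM n (A + B) = tauM n A + tauM n B"
  by (rule op_alg_eqI[of _ n]) (auto simp: algebra_simps)

lemma tauM_smult: "A \<in> carrier_mat (Suc n) (Suc n) \<Longrightarrow> tauM n (c \<cdot>\<^sub>m A) = cnj c \<cdot>\<^sub>m tauM n A"
  by (rule op_alg_eqI[of _ n]) auto

lemma tauM_zero: "tauM n (0\<^sub>m (Suc n) (Suc n)) = 0\<^sub>m (Suc n) (Suc n)"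
  by (rule op_alg_eqI[of _ n]) auto

lemma cnj_qv [simp]: "cnj (qv n i) = qv n i"
  by (simp add: qv_def)

text \<open>The entries of q satisfy q_i = \<lambda>^-i q_0, so the product does not depend on i.
  This reconciles the twisted involution with the ordinary adjoint of matrices.\<close>

lemma qv_power: "(qv n i)\<^sup>2 * ((- lam) ^ i)\<^sup>2 = (qv n 0)\<^sup>2"
  by (induction i) (simp_all add: qv_Suc power_mult_distrib field_simps)

lemma qv_reverse:
  assumes "i \<le> n"
  shows "qv n (n - i) = inverse (qv n i)"
proof -
  have "weight n (n - i) = - weight n i" using assms by (simp add: weight_def of_nat_diff)
  then show ?thesis by (simp add: qv_def exp_minus)
qed

lemma mult_rep_q_index:
  assumes "A \<in> carrier_mat (Suc n) (Suc n)" "i \<le> n" "j \<le> n"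
  shows "(A * rep_q t n) $$ (i, j) = A $$ (i, j) * qv n j"
proof -
  have "(A * rep_q t n) $$ (i, j) = (\<Sum>k\<le>n. if k = j then A $$ (i, k) * qv n k else 0)"
    using assms by (subst mult_mat_index[of _ n], simp_all only: rep_carrier)
      (rule sum.cong, auto simp: rep_q_eq)
  also have "\<dots> = (if j \<in> {..n} then A $$ (i, j) * qv n j else 0)"
    by (rule sum.delta) simp
  finally show ?thesis using assms by simp
qed

lemma rep_coeff_symmetric_Suc: "Suc j \<le> n \<Longrightarrow> rep_coeff t n (Suc (n - Suc j)) = rep_coeff t n (Suc j)"
  using rep_coeff_symmetric[of "Suc j" n] by (simp add: Suc_diff_Suc)

text \<open>On generators this is the symmetry of the coefficients under reversal; on adjoints the
  factor q_j^2 / q_i^2 coming from the twisted involution is absorbed by \<open>qv_power\<close>. It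
  follows that S descends to each block A_n.\<close>

lemma repE_tau: "repE n (tau x) = tauM n (repE n x)"
proof (induction x)
  case (Gen a)
  have "- lam \<cdot>\<^sub>m rep_f t n = tauM n (rep_e t n)"
    by (rule op_alg_eqI[of _ n])
      (auto simp: rep_index le_Suc_eq Suc_diff_le rep_coeff_symmetric_Suc)
  moreover have "- inverse lam \<cdot>\<^sub>m rep_e t n = tauM n (rep_f t n)"
    by (rule op_alg_eqI[of _ n])
      (auto simp: rep_index le_Suc_eq Suc_diff_le field_simps rep_coeff_symmetric_Suc)
  moreover have "rep_qi n = tauM n (rep_q t n)"
    by (rule op_alg_eqI[of _ n]) (auto simp: rep_index qv_reverse)
  moreover have "rep_q t n = tauM n (rep_qi n)"
    by (rule op_alg_eqI[of _ n]) (auto simp: rep_index qv_reverse)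
  ultimately show ?case by (cases a) simp_all
next
  case EOne
  show ?case by (rule op_alg_eqI[of _ n]) auto
next
  case (EStar x)
  show ?case
  proof (rule op_alg_eqI[of _ n])
    fix i j assume ij: "i \<le> n" "j \<le> n"
    have q: "(qv n j)\<^sup>2 * ((- lam) ^ j)\<^sup>2 = (qv n i)\<^sup>2 * ((- lam) ^ i)\<^sup>2" by (simp only: qv_power)
    have "repE n (tau (EStar x)) $$ (i, j) = inverse (qv n i) * (inverse (qv n i) *
        (cnj (tauM n (repE n x) $$ (j, i)) * qv n j)) * qv n j"
      using ij EStar
      by (simp add: mult_rep_q_index rep_mult_index mult_carrier_mat[of _ _ "Suc n"] del: index_mult_mat(1) tauM_index)
    also have "\<dots> = (qv n j)\<^sup>2 * ((- lam) ^ j)\<^sup>2 / ((qv n i)\<^sup>2 * ((- lam) ^ i)\<^sup>2) *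
        ((- lam) ^ i / (- lam) ^ j * repE n x $$ (n - j, n - i))"
      using ij by (simp add: divide_simps power2_eq_square)
    also have "\<dots> = (- lam) ^ i / (- lam) ^ j * repE n x $$ (n - j, n - i)"
      unfolding q by simp
    also have "\<dots> = tauM n (repE n (EStar x)) $$ (i, j)" using ij by simp
    finally show "repE n (tau (EStar x)) $$ (i, j) = tauM n (repE n (EStar x)) $$ (i, j)" .
  qed (auto intro!: carrier_matI)
qed (simp_all add: tauM_add tauM_mult tauM_smult tauM_zero)

section \<open>Linear functionals on U and identities for Sweedler sums\<close>

definition ulin :: "(uq_gen expr \<Rightarrow> complex) \<Rightarrow> bool" where
  "ulin \<phi> \<longleftrightarrow> (\<forall>x y. expr_eq R x y \<longrightarrow> \<phi> x = \<phi> y) \<and> (\<forall>x y. \<phi> (x \<boxplus> y) = \<phi> x + \<phi> y) \<and>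
    (\<forall>c x. \<phi> (c \<boxdot> x) = c * \<phi> x)"

lemma ulin_cong: "ulin \<phi> \<Longrightarrow> expr_eq R x y \<Longrightarrow> \<phi> x = \<phi> y"
  and ulin_add: "ulin \<phi> \<Longrightarrow> \<phi> (x \<boxplus> y) = \<phi> x + \<phi> y"
  and ulin_smult: "ulin \<phi> \<Longrightarrow> \<phi> (c \<boxdot> x) = c * \<phi> x"
  by (auto simp: ulin_def)

lemma ulin_zero: "ulin \<phi> \<Longrightarrow> \<phi> EZero = 0"
  using ulin_cong[of \<phi>, OF _ expr_eq.add_zero[of R EZero]] ulin_add[of \<phi> EZero EZero] by simp

lemma ulin_repE: "i \<le> n \<Longrightarrow> j \<le> n \<Longrightarrow> ulin (\<lambda>x. repE n x $$ (i, j))"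
  by (auto simp: ulin_def repE_cong)

lemma ulin_mult_right: "ulin \<phi> \<Longrightarrow> ulin (\<lambda>x. \<phi> (x \<boxtimes> y))"
  unfolding ulin_def
  by (metis expr_eq.add_mul expr_eq.cong_mul expr_eq.refl expr_eq.scale_mul)

lemma ulin_mult_left: "ulin \<phi> \<Longrightarrow> ulin (\<lambda>x. \<phi> (y \<boxtimes> x))"
  unfolding ulin_def
  by (metis expr_eq.mul_add expr_eq.cong_mul expr_eq.refl expr_eq.mul_scale)

lemma ulin_star: "ulin \<phi> \<Longrightarrow> ulin (\<lambda>x. cnj (\<phi> (EStar x)))"
  unfolding ulin_def
  by (auto simp: expr_eq.cong_star) (metis complex_cnj_add expr_eq.star_add,
    metis complex_cnj_cnj complex_cnj_mult expr_eq.star_scale)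

text \<open>The link to \<open>uq_comult\<close>, a function of the class. Choosing representatives
  is harmless because \<phi> and \<psi> respect \<open>expr_eq\<close>.\<close>

lemma tensor_functional_uq_comult:
  assumes "ulin \<phi>" "ulin \<psi>"
  shows "csum x (\<lambda>p r. \<phi> p * \<psi> r) = tensor_functional (\<lambda>X. \<phi> (SOME x. X = cls R x)) (\<lambda>X. \<psi> (SOME x. X = cls R x)) (uq_comult t (cls R x))"
proof -
  interpret U: uq_alg "uq t" t "uq_el t Ge" "uq_el t Gf" "uq_el t Gq" "uq_el t Gqinv"
    by (rule uq_alg_uq)
  interpret P: tensor_pair "uq t" "uq t" by unfold_locales
  have cls: "\<phi> (SOME y. cls R x = cls R y) = \<phi> x" if "ulin \<phi>" for \<phi> x
    using someI[of "\<lambda>y. cls R x = cls R y" x] ulin_cong[OF that] by (metis cls_eq_iff)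
  have lin: "linear_functional (uq t) (\<lambda>X. \<phi> (SOME x. X = cls R x))" if "ulin \<phi>" for \<phi>
    unfolding linear_functional_def
    by (auto simp: uq_def cls[OF that] ulin_add[OF that] ulin_smult[OF that] elim!: presented_cases)
  have "set (map (map_prod (cls R) (cls R)) xs) \<subseteq> carrier (uq t) \<times> carrier (uq t)" for xs
    by (auto simp: carrier_uq)
  then show ?thesis unfolding uq_comult_cls
    by (subst P.tensor_functional_tcls) (auto simp: lin assms comult_sum_def comp_def split_def cls)
qed

text \<open>By \<open>tensor_functional_uq_comult\<close> the sum sees x only through its
  class.\<close>

lemma csum_cong:
  assumes "ulin \<phi>" "ulin \<psi>" "expr_eq R x y"
  shows "csum x (\<lambda>p r. \<phi> p * \<psi> r) = csum y (\<lambda>p r. \<phi> p * \<psi> r)"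
  using assms(3) by (simp only: tensor_functional_uq_comult[OF assms(1,2)] flip: cls_eq_iff)

text \<open>The two iterated coproducts of an expression consist of the same terms up to order, so
  \<open>F\<close> may be arbitrary.\<close>

lemma csum_coassoc:
  "csum x (\<lambda>p r. csum p (\<lambda>a b. F a b r)) = csum x (\<lambda>p r. csum r (\<lambda>a b. F p a b))"
proof (induction x arbitrary: F)
  case (Gen a)
  show ?case by (cases a) simp_all
next
  case (EMul x y)
  have "csum (x \<boxtimes> y) (\<lambda>p r. csum p (\<lambda>a b. F a b r)) =
    csum x (\<lambda>p r. csum p (\<lambda>a b. csum y (\<lambda>p' r'. csum p' (\<lambda>a' b'. F (a \<boxtimes> a') (b \<boxtimes> b') (r \<boxtimes> r')))))"
    by (simp add: comult_sum_swap[of _ y])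
  also have "\<dots> = csum x (\<lambda>p r. csum p (\<lambda>a b. csum y (\<lambda>p' r'. csum r' (\<lambda>a' b'. F (a \<boxtimes> p') (b \<boxtimes> a') (r \<boxtimes> b')))))"
    by (simp add: EMul(2))
  also have "\<dots> = csum x (\<lambda>p r. csum r (\<lambda>a b. csum y (\<lambda>p' r'. csum r' (\<lambda>a' b'. F (p \<boxtimes> p') (a \<boxtimes> a') (b \<boxtimes> b')))))"
    by (rule EMul(1))
  also have "\<dots> = csum (x \<boxtimes> y) (\<lambda>p r. csum r (\<lambda>a b. F p a b))"
    by (simp add: comult_sum_swap[of _ y])
  finally show ?case .
qed simp_all

text \<open>Star preserves \<Delta> and S reverses it, hence so does the composite. Scalars may end
  up on different legs, so the identity is stated for values of linear functionals.\<close>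

lemma csum_tau:
  assumes "ulin \<phi>" "ulin \<psi>"
  shows "csum (tau x) (\<lambda>p r. \<phi> p * \<psi> r) = csum x (\<lambda>p r. \<phi> (tau r) * \<psi> (tau p))"
  using assms
proof (induction x arbitrary: \<phi> \<psi>)
  case (Gen a)
  then show ?case by (cases a) (simp_all add: ulin_smult)
next
  case (EMul x y)
  have "csum (tau (x \<boxtimes> y)) (\<lambda>p r. \<phi> p * \<psi> r) =
    csum (tau x) (\<lambda>p r. csum (tau y) (\<lambda>p' r'. \<phi> (p \<boxtimes> p') * \<psi> (r \<boxtimes> r')))" by simp
  also have "\<dots> = csum (tau x) (\<lambda>p r. csum y (\<lambda>p' r'. \<phi> (p \<boxtimes> tau r') * \<psi> (r \<boxtimes> tau p')))"
    by (simp add: EMul.IH(2) ulin_mult_left[OF EMul.prems(1)] ulin_mult_left[OF EMul.prems(2)])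
  also have "\<dots> = csum y (\<lambda>p' r'. csum (tau x) (\<lambda>p r. \<phi> (p \<boxtimes> tau r') * \<psi> (r \<boxtimes> tau p')))"
    by (rule comult_sum_swap)
  also have "\<dots> = csum y (\<lambda>p' r'. csum x (\<lambda>p r. \<phi> (tau r \<boxtimes> tau r') * \<psi> (tau p \<boxtimes> tau p')))"
    by (simp add: EMul.IH(1) ulin_mult_right[OF EMul.prems(1)] ulin_mult_right[OF EMul.prems(2)])
  also have "\<dots> = csum (x \<boxtimes> y) (\<lambda>p r. \<phi> (tau r) * \<psi> (tau p))"
    by (simp add: comult_sum_swap[of _ y])
  finally show ?case .
next
  case (EStar x)
  let ?c = "\<lambda>x. Gen Gqinv \<boxtimes> (Gen Gqinv \<boxtimes> x \<boxtimes> Gen Gq) \<boxtimes> Gen Gq"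
  \<comment> \<open>Star and the outer conjugation are both conjugate linear, so this functional is
    linear and the induction hypothesis applies to it.\<close>
  have ulin: "ulin (\<lambda>x. cnj (\<phi> (?c (EStar x))))" if "ulin \<phi>" for \<phi>
    using ulin_star[OF ulin_mult_left[OF ulin_mult_right[OF ulin_mult_left[OF ulin_mult_right[OF that]]]]] ulin_star
    by (auto intro: ulin_mult_left ulin_mult_right ulin_star that
        intro!: ulin_star[of "\<lambda>x. \<phi> (?c x)"])
  have "csum (tau (EStar x)) (\<lambda>p r. \<phi> p * \<psi> r) = csum (tau x) (\<lambda>p r. \<phi> (?c (EStar p)) * \<psi> (?c (EStar r)))"
    by simp
  also have "\<dots> = cnj (csum (tau x) (\<lambda>p r. cnj (\<phi> (?c (EStar p))) * cnj (\<psi> (?c (EStar r)))))"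
    by (simp flip: comult_sum_cnj)
  also have "\<dots> = cnj (csum x (\<lambda>p r. cnj (\<phi> (?c (EStar (tau r)))) * cnj (\<psi> (?c (EStar (tau p))))))"
    by (subst EStar.IH[OF ulin[OF EStar.prems(1)] ulin[OF EStar.prems(2)]]) simp
  also have "\<dots> = csum (EStar x) (\<lambda>p r. \<phi> (tau r) * \<psi> (tau p))"
    by (simp flip: comult_sum_cnj)
  finally show ?case .
next
  case (EScale c x)
  then show ?case by (simp add: ulin_smult comult_sum_mult_left ac_simps)
qed simp_all

end


section \<open>Tensor products of two irreducible representations\<close>

context quantum
begin

definition box :: "nat \<Rightarrow> nat \<Rightarrow> (nat \<times> nat) set" where
  "box n m = {..n} \<times> {..m}"

lemma finite_box [simp]: "finite (box n m)"
  by (simp add: box_def)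

lemma mem_box [simp]: "(i, k) \<in> box n m \<longleftrightarrow> i \<le> n \<and> k \<le> m"
  by (simp add: box_def)

text \<open>The matrix entries of (\<pi>_n \<otimes> \<pi>_m)\<Delta>(x) in the product
  basis.\<close>

definition tcoeff :: "nat \<Rightarrow> nat \<Rightarrow> uq_gen expr \<Rightarrow> nat \<times> nat \<Rightarrow> nat \<times> nat \<Rightarrow> complex" where
  "tcoeff n m x a b = csum x (\<lambda>p r. repE n p $$ (fst a, fst b) * repE m r $$ (snd a, snd b))"

lemma tcoeff_cong:
  "expr_eq R x y \<Longrightarrow> a \<in> box n m \<Longrightarrow> b \<in> box n m \<Longrightarrow> tcoeff n m x a b = tcoeff n m y a b"
  unfolding tcoeff_def by (rule csum_cong) (auto simp: box_def intro: ulin_repE)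

lemma tcoeff_linear:
  assumes "a \<in> box n m" "b \<in> box n m"
  shows "tcoeff n m (x \<boxplus> y) a b = tcoeff n m x a b + tcoeff n m y a b"
    "tcoeff n m (c \<boxdot> x) a b = c * tcoeff n m x a b"
    "tcoeff n m EZero a b = 0"
    "tcoeff n m EOne a b = (if a = b then 1 else 0)"
  using assms by (auto simp: tcoeff_def box_def mult.assoc comult_sum_mult_left split: if_splits)

lemma tcoeff_mult:
  assumes "a \<in> box n m" "c \<in> box n m"
  shows "tcoeff n m (x \<boxtimes> y) a c = (\<Sum>b\<in>box n m. tcoeff n m x a b * tcoeff n m y b c)"
proof -
  have *: "repE n (p \<boxtimes> p') $$ (fst a, fst c) * repE m (r \<boxtimes> r') $$ (snd a, snd c) =
      (\<Sum>b\<in>box n m. (repE n p $$ (fst a, fst b) * repE m r $$ (snd a, snd b)) *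
        (repE n p' $$ (fst b, fst c) * repE m r' $$ (snd b, snd c)))" for p p' r r'
  proof -
    have "repE n (p \<boxtimes> p') $$ (fst a, fst c) * repE m (r \<boxtimes> r') $$ (snd a, snd c) =
      (\<Sum>i\<le>n. repE n p $$ (fst a, i) * repE n p' $$ (i, fst c)) *
      (\<Sum>k\<le>m. repE m r $$ (snd a, k) * repE m r' $$ (k, snd c))"
      using assms by (auto simp: box_def mult_mat_index[of _ n] mult_mat_index[of _ m] simp del: index_mult_mat(1))
    also have "\<dots> = (\<Sum>b\<in>box n m. (repE n p $$ (fst a, fst b) * repE n p' $$ (fst b, fst c)) *
        (repE m r $$ (snd a, snd b) * repE m r' $$ (snd b, snd c)))"
      unfolding sum_product box_def sum.cartesian_product by (simp add: split_def)
    finally show ?thesis by (simp add: ac_simps)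
  qed
  show ?thesis
    unfolding tcoeff_def comult_sum_simps * comult_sum_sum comult_sum_mult_left comult_sum_mult_right ..
qed

text \<open>Vectors of the tensor product are functions on all pairs of indices. Results are 0
  outside the box, so equations between them can be stated as equations of functions.\<close>

definition act :: "nat \<Rightarrow> nat \<Rightarrow> uq_gen expr \<Rightarrow> (nat \<times> nat \<Rightarrow> complex) \<Rightarrow> nat \<times> nat \<Rightarrow> complex" where
  "act n m x v a = (if a \<in> box n m then \<Sum>b\<in>box n m. tcoeff n m x a b * v b else 0)"

lemma act_cong: "expr_eq R x y \<Longrightarrow> act n m x v = act n m y v"
  by (auto simp: act_def fun_eq_iff tcoeff_cong intro!: sum.cong)

lemma act_mult: "act n m (x \<boxtimes> y) v = act n m x (act n m y v)"
proof
  fix a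
  show "act n m (x \<boxtimes> y) v a = act n m x (act n m y v) a"
  proof (cases "a \<in> box n m")
    case True
    have "act n m (x \<boxtimes> y) v a =
        (\<Sum>c\<in>box n m. \<Sum>b\<in>box n m. tcoeff n m x a b * tcoeff n m y b c * v c)"
      using True by (auto simp: act_def tcoeff_mult sum_distrib_right intro!: sum.cong)
    also have "\<dots> = (\<Sum>b\<in>box n m. \<Sum>c\<in>box n m. tcoeff n m x a b * tcoeff n m y b c * v c)"
      by (rule sum.swap)
    also have "\<dots> = act n m x (act n m y v) a"
      using True by (auto simp: act_def sum_distrib_left mult.assoc intro!: sum.cong)
    finally show ?thesis .
  qed (simp add: act_def)
qed

lemma act_add: "act n m (x \<boxplus> y) v a = act n m x v a + act n m y v a"
  by (auto simp: act_def tcoeff_linear sum.distrib algebra_simps)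

lemma act_smult: "act n m (c \<boxdot> x) v a = c * act n m x v a"
  by (auto simp: act_def tcoeff_linear sum_distrib_left mult.assoc)

lemma act_zero: "act n m EZero v a = 0"
  by (auto simp: act_def tcoeff_linear)

lemma act_one: "(\<And>a. a \<notin> box n m \<Longrightarrow> v a = 0) \<Longrightarrow> act n m EOne v = v"
  by (auto simp: act_def tcoeff_linear fun_eq_iff if_distrib if_distribR cong: if_cong)

lemma act_vec_add: "act n m x (\<lambda>b. v b + w b) a = act n m x v a + act n m x w a"
  by (auto simp: act_def sum.distrib algebra_simps)

lemma act_vec_smult: "act n m x (\<lambda>b. c * v b) a = c * act n m x v a"
  by (auto simp: act_def sum_distrib_left algebra_simps)

lemma act_vec_zero: "act n m x (\<lambda>b. 0) a = 0"
  by (auto simp: act_def)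

lemma act_vec_sum: "act n m x (\<lambda>b. \<Sum>k\<in>K. v k b) a = (\<Sum>k\<in>K. act n m x (v k) a)"
  by (induction K rule: infinite_finite_induct) (simp_all add: act_vec_add act_vec_zero)

lemma act_outside: "a \<notin> box n m \<Longrightarrow> act n m x v a = 0"
  by (simp add: act_def)

lemma act_eq_sum:
  assumes "a \<in> box n m" "\<And>b. b \<in> box n m \<Longrightarrow> tcoeff n m x a b * v b = F b"
  shows "act n m x v a = sum F (box n m)"
  using assms by (simp add: act_def)

lemma act_q:
  assumes "i \<le> n" "k \<le> m"
  shows "act n m (Gen Gq) v (i, k) = qv n i * qv m k * v (i, k)"
    "act n m (Gen Gqinv) v (i, k) = inverse (qv n i * qv m k) * v (i, k)"
proof -
  have "act n m (Gen Gq) v (i, k) = (\<Sum>b\<in>box n m. if b = (i, k) then qv n i * qv m k * v b else 0)"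
    using assms by (intro act_eq_sum) (auto simp: tcoeff_def rep_index split: if_splits)
  then show "act n m (Gen Gq) v (i, k) = qv n i * qv m k * v (i, k)" using assms by (simp add: sum.delta)
  have "act n m (Gen Gqinv) v (i, k) = (\<Sum>b\<in>box n m. if b = (i, k) then inverse (qv n i * qv m k) * v b else 0)"
    using assms by (intro act_eq_sum) (auto simp: tcoeff_def rep_index split: if_splits)
  then show "act n m (Gen Gqinv) v (i, k) = inverse (qv n i * qv m k) * v (i, k)" using assms by (simp add: sum.delta)
qed

text \<open>The two terms come from q \<otimes> e and e \<otimes> q^-1. An index that leaves the box
  occurs only with a coefficient \<open>rc m (Suc m)\<close> or \<open>rc n (Suc n)\<close>, which
  is 0.\<close>

lemma act_e:
  assumes "i \<le> n" "k \<le> m"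
  shows "act n m (Gen Ge) v (i, k) =
    qv n i * rc m (Suc k) * v (i, Suc k) + rc n (Suc i) * inverse (qv m k) * v (Suc i, k)"
proof -
  have "act n m (Gen Ge) v (i, k) =
    (\<Sum>b\<in>box n m. (if b = (i, Suc k) then qv n i * rc m (Suc k) * v b else 0) +
      (if b = (Suc i, k) then rc n (Suc i) * inverse (qv m k) * v b else 0))"
    using assms by (intro act_eq_sum) (auto simp: tcoeff_def rep_index split: if_splits)
  also have "\<dots> = (if (i, Suc k) \<in> box n m then qv n i * rc m (Suc k) * v (i, Suc k) else 0) +
      (if (Suc i, k) \<in> box n m then rc n (Suc i) * inverse (qv m k) * v (Suc i, k) else 0)"
    by (simp only: sum.distrib sum.delta finite_box)
  also have "\<dots> = qv n i * rc m (Suc k) * v (i, Suc k) + rc n (Suc i) * inverse (qv m k) * v (Suc i, k)"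
    using assms by (auto simp: not_less_eq_eq le_Suc_eq dest!: antisym[of k m] antisym[of i n])
  finally show ?thesis .
qed

text \<open>For k = 0 or i = 0 the predecessor is truncated to 0, but then the coefficient
  \<open>rc m 0\<close> or \<open>rc n 0\<close> is 0.\<close>

lemma act_f:
  assumes "i \<le> n" "k \<le> m"
  shows "act n m (Gen Gf) v (i, k) =
    qv n i * rc m k * v (i, k - 1) + rc n i * inverse (qv m k) * v (i - 1, k)"
proof -
  have "act n m (Gen Gf) v (i, k) =
    (\<Sum>b\<in>box n m. (if b = (i, k - 1) then qv n i * rc m k * v b else 0) +
      (if b = (i - 1, k) then rc n i * inverse (qv m k) * v b else 0))"
    using assms by (intro act_eq_sum; cases i; cases k) (auto simp: tcoeff_def rep_index split: if_splits)
  also have "\<dots> = (if (i, k - 1) \<in> box n m then qv n i * rc m k * v (i, k - 1) else 0) +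
      (if (i - 1, k) \<in> box n m then rc n i * inverse (qv m k) * v (i - 1, k) else 0)"
    by (simp only: sum.distrib sum.delta finite_box)
  also have "\<dots> = qv n i * rc m k * v (i, k - 1) + rc n i * inverse (qv m k) * v (i - 1, k)"
    using assms by auto
  finally show ?thesis .
qed

section \<open>Weight vectors and the Clebsch-Gordan range\<close>

definition at_level :: "nat \<Rightarrow> nat \<Rightarrow> nat \<Rightarrow> (nat \<times> nat \<Rightarrow> complex) \<Rightarrow> bool" where
  "at_level n m L v \<longleftrightarrow> (\<forall>i k. v (i, k) \<noteq> 0 \<longrightarrow> i \<le> n \<and> k \<le> m \<and> i + k = L)"

lemma at_level_act_f:
  assumes "at_level n m L v"
  shows "at_level n m (Suc L) (act n m (Gen Gf) v)"
  unfolding at_level_def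
proof (intro allI impI)
  fix i k assume *: "act n m (Gen Gf) v (i, k) \<noteq> 0"
  then have ik: "i \<le> n" "k \<le> m" using act_outside[of "(i, k)" n m] by force+
  have "i + k = Suc L"
  proof (rule ccontr)
    assume "i + k \<noteq> Suc L"
    then have "k = 0 \<or> v (i, k - 1) = 0" "i = 0 \<or> v (i - 1, k) = 0"
      using assms unfolding at_level_def by fastforce+
    then have "act n m (Gen Gf) v (i, k) = 0" using ik by (auto simp: act_f)
    then show False using * by simp
  qed
  then show "i \<le> n \<and> k \<le> m \<and> i + k = Suc L" using ik by simp
qed

text \<open>If L > n, every pair (i, k) in the box on this level has k > 0, and e v = 0 expresses v
  (i, k) through v (i + 1, k - 1). This starts at i = n, where the other coefficient is 0, and
  descends in i. The case L > m is the mirror image.\<close>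

lemma act_e_injective:
  assumes "at_level n m L v" "L > n \<or> L > m" and e: "\<And>a. act n m (Gen Ge) v a = 0"
  shows "v = (\<lambda>a. 0)"
proof -
  have eq: "qv n i * rc m (Suc k) * v (i, Suc k) + rc n (Suc i) * inverse (qv m k) * v (Suc i, k) = 0"
    if "i \<le> n" "k \<le> m" for i k
    using e[of "(i, k)"] act_e[OF that, of v] by simp
  have pos: "rc n' i \<noteq> 0" if "0 < i" "i \<le> n'" for n' i
    using rep_coeff_pos[OF that] by simp
  have "v (i, k) = 0" if "i + k = L" for i k
  proof (cases "L > n")
    case True
    show ?thesis using that
    proof (induction "n - i" arbitrary: i k rule: less_induct)
      case less
      show ?case
      proof (cases "i \<le> n \<and> k \<le> m")
        case ik: True
        then obtain k' where k: "k = Suc k'" using True less.prems by (cases k) auto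
        have "rc n (Suc i) * v (Suc i, k') = 0"
        proof (cases "i = n")
          case False
          then have "v (Suc i, k') = 0" using less.hyps[of "Suc i" k'] less.prems ik k by auto
          then show ?thesis by simp
        qed simp
        then show ?thesis using eq[of i k'] ik k pos[of k m] by auto
      next
        case False
        then show ?thesis using assms(1) unfolding at_level_def by blast
      qed
    qed
  next
    case False
    then have True: "L > m" using assms(2) by simp
    show ?thesis using that
    proof (induction "m - k" arbitrary: i k rule: less_induct)
      case less
      show ?case
      proof (cases "i \<le> n \<and> k \<le> m")
        case ik: True
        then obtain i' where i: "i = Suc i'" using True less.prems by (cases i) auto
        have "rc m (Suc k) * v (i', Suc k) = 0"
        proof (cases "k = m")
          case False
          then have "v (i', Suc k) = 0" using less.hyps[of "Suc k" i'] less.prems ik i by auto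
          then show ?thesis by simp
        qed simp
        then show ?thesis using eq[of i' k] ik i pos[of i n] by auto
      next
        case False
        then show ?thesis using assms(1) unfolding at_level_def by blast
      qed
    qed
  qed
  moreover have "v (i, k) = 0" if "i + k \<noteq> L" for i k
    using assms(1) that unfolding at_level_def by blast
  ultimately show ?thesis by (metis ext surj_pair)
qed

text \<open>The vectors on which U acts through the \<pi>_k with k in \<open>spins n m\<close>. They
  form a submodule, and Clebsch-Gordan becomes the claim that it contains every basis
  vector.\<close>

definition killed :: "nat \<Rightarrow> nat \<Rightarrow> (nat \<times> nat \<Rightarrow> complex) \<Rightarrow> bool" where
  "killed n m v \<longleftrightarrow> (\<forall>x. (\<forall>k\<in>spins n m. repE k x = 0\<^sub>m (Suc k) (Suc k)) \<longrightarrow> (\<forall>a. act n m x v a = 0))"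

lemma killed_add: "killed n m v \<Longrightarrow> killed n m w \<Longrightarrow> killed n m (\<lambda>a. v a + w a)"
  by (simp add: killed_def act_vec_add)

lemma killed_smult: "killed n m v \<Longrightarrow> killed n m (\<lambda>a. c * v a)"
  by (simp add: killed_def act_vec_smult)

lemma killed_zero: "killed n m (\<lambda>a. 0)"
  by (simp add: killed_def act_vec_zero)

lemma killed_sum: "(\<And>k. k \<in> K \<Longrightarrow> killed n m (v k)) \<Longrightarrow> killed n m (\<lambda>a. \<Sum>k\<in>K. v k a)"
  by (simp add: killed_def act_vec_sum)

lemma killed_smultD: "killed n m (\<lambda>a. c * v a) \<Longrightarrow> c \<noteq> 0 \<Longrightarrow> killed n m v"
  using killed_smult[of n m "\<lambda>a. c * v a" "inverse c"] by (simp flip: mult.assoc)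

lemma killed_act:
  assumes "killed n m v"
  shows "killed n m (act n m y v)"
  unfolding killed_def
proof (intro allI impI)
  fix x a assume "\<forall>k\<in>spins n m. repE k x = 0\<^sub>m (Suc k) (Suc k)"
  then have "\<forall>k\<in>spins n m. repE k (x \<boxtimes> y) = 0\<^sub>m (Suc k) (Suc k)"
    by (simp add: left_mult_zero_mat[OF repE_carrier])
  then have "act n m (x \<boxtimes> y) v a = 0"
    using assms unfolding killed_def by blast
  then show "act n m x (act n m y v) a = 0" by (simp only: act_mult)
qed

text \<open>A highest weight vector generates a copy of an irreducible representation, and only
  those with spin in \<open>spins n m\<close> occur.\<close>

lemma killed_highest_weight:
  assumes v: "at_level n m L v" and e: "\<And>a. act n m (Gen Ge) v a = 0" and L: "L \<le> n" "L \<le> m"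
  shows "killed n m v"
proof -
  \<comment> \<open>A vector of level L has weight (n + m)/2 - L, and K is twice this
    number.\<close>
  define K where "K = n + m - 2 * L"
  have K: "K \<in> spins n m" using L by (auto simp: K_def spins_def)
  define g where "g s = (act n m (Gen Gf) ^^ s) v" for s
  have g_Suc: "g (Suc s) = act n m (Gen Gf) (g s)" for s by (simp add: g_def)
  have g_level: "at_level n m (L + s) (g s)" for s
    by (induction s) (use v in \<open>auto simp: g_def at_level_act_f\<close>)
  have qv_K: "qv n i * qv m k = qv K s" if "i + k = L + s" for i k s
  proof -
    have "real i = real L + real s - real k" using that by linarith
    then have "t * weight n i + t * weight m k = t * weight K s"
    proof -
      have "real K = real n + real m - 2 * real L" using L by (simp add: K_def of_nat_diff)
      then have "weight n i + weight m k = weight K s"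
        using \<open>real i = real L + real s - real k\<close> unfolding weight_def by linarith
      then show ?thesis by (simp flip: distrib_left)
    qed
    then show ?thesis by (simp add: qv_def flip: exp_add of_real_mult)
  qed
  have act_q_g: "act n m (Gen Gq) (g s) = (\<lambda>a. qv K s * g s a)"
    and act_qi_g: "act n m (Gen Gqinv) (g s) = (\<lambda>a. inverse (qv K s) * g s a)" for s
  proof -
    have "act n m (Gen Gq) (g s) (i, k) = qv K s * g s (i, k) \<and>
        act n m (Gen Gqinv) (g s) (i, k) = inverse (qv K s) * g s (i, k)" for i k
    proof (cases "i \<le> n \<and> k \<le> m \<and> i + k = L + s")
      case True
      then show ?thesis by (simp add: act_q qv_K)
    next
      case False
      then have "g s (i, k) = 0" using g_level[of s] unfolding at_level_def by blast
      then show ?thesis by (cases "(i, k) \<in> box n m") (simp_all add: act_q act_outside)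
    qed
    then show "act n m (Gen Gq) (g s) = (\<lambda>a. qv K s * g s a)"
      "act n m (Gen Gqinv) (g s) = (\<lambda>a. inverse (qv K s) * g s a)" by auto
  qed
  have comm: "act n m (Gen Ge) (act n m (Gen Gf) w) a = act n m (Gen Gf) (act n m (Gen Ge) w) a +
      inverse (lam - inverse lam) * (act n m (Gen Gq) (act n m (Gen Gq) w) a -
        act n m (Gen Gqinv) (act n m (Gen Gqinv) w) a)" for w a
  proof -
    let ?x = "Gen Ge \<boxtimes> Gen Gf \<boxplus> (-1) \<boxdot> (Gen Gf \<boxtimes> Gen Ge)"
    let ?y = "inverse (lam - inverse lam) \<boxdot> (Gen Gq \<boxtimes> Gen Gq \<boxplus> (-1) \<boxdot> (Gen Gqinv \<boxtimes> Gen Gqinv))"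
    have "expr_eq R ?x ?y" by (rule expr_eq.rel) (simp add: uq_relations_def Let_def)
    from act_cong[OF this, of n m w] have "act n m ?x w a = act n m ?y w a" by simp
    then show ?thesis by (simp add: act_add act_smult act_mult algebra_simps)
  qed
  \<comment> \<open>The classical computation of e on f^(s+1) v. Each commutator adds the same
    difference as \<open>rep_coeff_step\<close>, so the factor is the square of a coefficient of
    \<pi>_K.\<close>
  have act_e_g: "s \<le> K \<Longrightarrow> act n m (Gen Ge) (g (Suc s)) = (\<lambda>a. (rc K (Suc s))\<^sup>2 * g s a)" for s
  proof (induction s)
    case 0
    have "act n m (Gen Ge) v = (\<lambda>a. 0)" using e by auto
    then have "act n m (Gen Ge) (g (Suc 0)) a =
        inverse (lam - inverse lam) * ((qv K 0)\<^sup>2 - inverse ((qv K 0)\<^sup>2)) * g 0 a" for a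
      unfolding g_Suc comm act_q_g act_qi_g act_vec_smult
      by (simp add: g_def act_vec_zero) (simp add: g_def[symmetric] algebra_simps power2_eq_square)
    then show ?case using rep_coeff_step[of 0 K] by (simp add: fun_eq_iff)
  next
    case (Suc s)
    have "act n m (Gen Ge) (g (Suc (Suc s))) a = ((rc K (Suc s))\<^sup>2 +
        inverse (lam - inverse lam) * ((qv K (Suc s))\<^sup>2 - inverse ((qv K (Suc s))\<^sup>2))) * g (Suc s) a" for a
      unfolding g_Suc[of "Suc s"] comm act_q_g act_qi_g act_vec_smult Suc.IH[OF Suc_leD[OF Suc.prems]]
      by (simp add: g_Suc[symmetric] algebra_simps power2_eq_square)
    moreover have "(rc K (Suc s))\<^sup>2 + inverse (lam - inverse lam) * ((qv K (Suc s))\<^sup>2 - inverse ((qv K (Suc s))\<^sup>2)) =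
        (rc K (Suc (Suc s)))\<^sup>2"
      unfolding rep_coeff_step[OF Suc.prems, symmetric] by simp
    ultimately show ?case by (simp only:)
  qed
  \<comment> \<open>The vector f^(K+1) v is annihilated by e, because the last coefficient of
    \<pi>_K is 0, and its level n + m - L + 1 exceeds both n and m.\<close>
  have g_last: "g (Suc K) = (\<lambda>a. 0)"
  proof (rule act_e_injective[OF g_level])
    show "n < L + Suc K \<or> m < L + Suc K" using L by (auto simp: K_def)
    show "act n m (Gen Ge) (g (Suc K)) a = 0" for a by (simp add: act_e_g)
  qed
  \<comment> \<open>Dividing f^s v by the product of the first s coefficients gives vectors on which
    U acts exactly by the matrices of \<pi>_K.\<close>
  define c where "c s = (\<Prod>j<s. rc K (Suc j))" for s
  have c_nz: "c s \<noteq> 0" if "s \<le> K" for s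
  proof -
    have "rc K (Suc j) \<noteq> 0" if "j < s" for j
      using rep_coeff_pos[of "Suc j" K] that \<open>s \<le> K\<close> by simp
    then show ?thesis by (simp add: c_def)
  qed
  have c_Suc: "c (Suc s) = c s * rc K (Suc s)" for s by (simp add: c_def)
  define h where "h s a = inverse (c s) * g s a" for s a
  have act_h: "act n m x (h s) a = inverse (c s) * act n m x (g s) a" for x s a
    unfolding h_def by (rule act_vec_smult)
  have main: "\<forall>s\<le>K. act n m x (h s) = (\<lambda>a. \<Sum>s'\<le>K. repE K x $$ (s', s) * h s' a)" for x
  proof (induction x rule: uq_induct)
    case (1 x y)
    then show ?case using act_cong[OF 1(1)] repE_cong[OF 1(1)] by simp
  next
    case (2 a)
    have delta: "(\<Sum>s'\<le>K. (if s' = s then d s' else 0) * h s' a) = d s * h s a" if "s \<le> K" for s d a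
      using that by (simp add: if_distribR if_distrib cong: if_cong)
    have delta': "(\<Sum>s'\<le>K. (if s = s' then d s' else 0) * h s' a) = d s * h s a" if "s \<le> K" for s d a
      using delta[OF that, of d a] by (simp add: eq_commute[of s])
    have idx: "(\<Sum>s'\<le>K. A $$ (s', s) * h s' a) = (\<Sum>s'\<le>K. B s' * h s' a)"
      if "\<And>s'. s' \<le> K \<Longrightarrow> A $$ (s', s) = B s'" for A B s a
      using that by (auto intro!: sum.cong)
    show ?case
    proof (intro allI impI ext)
      fix s b assume s: "s \<le> K"
      show "act n m (Gen a) (h s) b = (\<Sum>s'\<le>K. repE K (Gen a) $$ (s', s) * h s' b)"
      proof (cases a)
        case Gq
        then show ?thesis using s
          by (simp add: act_h act_q_g idx[where B = "\<lambda>s'. if s' = s then qv K s else 0"] rep_index delta)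
            (simp add: h_def)
      next
        case Gqinv
        then show ?thesis using s
          by (simp add: act_h act_qi_g idx[where B = "\<lambda>s'. if s' = s then inverse (qv K s) else 0"] rep_index delta)
            (simp add: h_def)
      next
        case Ge
        show ?thesis
        proof (cases s)
          case 0
          have "(\<Sum>s'\<le>K. repE K (Gen a) $$ (s', s) * h s' b) = 0"
            using s 0 Ge by (intro sum.neutral) (auto simp: rep_index)
          moreover have "act n m (Gen a) (h s) b = 0" using Ge 0 e by (simp add: act_h g_def)
          ultimately show ?thesis by simp
        next
          case (Suc s0)
          have "(\<Sum>s'\<le>K. repE K (Gen a) $$ (s', s) * h s' b) = rc K s * h s0 b"
            using s Suc Ge
            by (simp add: idx[where B = "\<lambda>s'. if s0 = s' then rc K s else 0"] rep_index delta')
          moreover have "act n m (Gen a) (h s) b = inverse (c s) * ((rc K s)\<^sup>2 * g s0 b)"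
            using Ge Suc s by (simp add: act_h act_e_g)
          moreover have "inverse (c s) * ((rc K s)\<^sup>2 * g s0 b) = rc K s * h s0 b"
            using Suc s c_nz[of s] c_nz[of s0] by (simp add: h_def c_Suc power2_eq_square field_simps)
          ultimately show ?thesis by simp
        qed
      next
        case Gf
        show ?thesis
        proof (cases "s = K")
          case True
          have "(\<Sum>s'\<le>K. repE K (Gen a) $$ (s', s) * h s' b) = 0"
            using s True Gf by (intro sum.neutral) (auto simp: rep_index)
          moreover have "act n m (Gen a) (h s) b = 0"
            using Gf True g_last by (simp add: act_h flip: g_Suc)
          ultimately show ?thesis by simp
        next
          case False
          then have s': "Suc s \<le> K" using s by simp
          have "(\<Sum>s'\<le>K. repE K (Gen a) $$ (s', s) * h s' b) = rc K (Suc s) * h (Suc s) b"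
            using s s' Gf
            by (simp add: idx[where B = "\<lambda>s'. if s' = Suc s then rc K (Suc s) else 0"] rep_index delta)
          moreover have "act n m (Gen a) (h s) b = inverse (c s) * g (Suc s) b"
            using Gf by (simp add: act_h flip: g_Suc)
          moreover have "inverse (c s) * g (Suc s) b = rc K (Suc s) * h (Suc s) b"
            using s' c_nz[of "Suc s"] c_nz[of s] by (simp add: h_def c_Suc field_simps)
          ultimately show ?thesis by simp
        qed
      qed
    qed
  next
    case 3
    show ?case by (auto simp: act_zero fun_eq_iff)
  next
    case 4
    have "act n m EOne (h s) = h s" for s
      using g_level[of s] by (intro act_one) (auto simp: h_def at_level_def)
    then show ?case
      by (auto simp: fun_eq_iff if_distribR if_distrib intro!: sum.cong cong: if_cong)
  next
    case (5 x y)
    show ?case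
    proof (intro allI impI ext)
      fix s a assume s: "s \<le> K"
      show "act n m (x \<boxplus> y) (h s) a = (\<Sum>s'\<le>K. repE K (x \<boxplus> y) $$ (s', s) * h s' a)"
        using 5 s by (simp add: act_add distrib_right sum.distrib)
    qed
  next
    case (6 x y)
    show ?case
    proof (intro allI impI ext)
      fix s a assume s: "s \<le> K"
      have "act n m (x \<boxtimes> y) (h s) a = act n m x (\<lambda>a. \<Sum>s'\<le>K. repE K y $$ (s', s) * h s' a) a"
        using 6(2) s by (simp add: act_mult)
      also have "\<dots> = (\<Sum>s'\<le>K. repE K y $$ (s', s) * act n m x (h s') a)"
        by (simp add: act_vec_sum act_vec_smult)
      also have "\<dots> = (\<Sum>s'\<le>K. \<Sum>s''\<le>K. repE K y $$ (s', s) * (repE K x $$ (s'', s') * h s'' a))"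
        using 6(1) by (simp add: sum_distrib_left)
      also have "\<dots> = (\<Sum>s''\<le>K. \<Sum>s'\<le>K. repE K y $$ (s', s) * (repE K x $$ (s'', s') * h s'' a))"
        by (rule sum.swap)
      also have "\<dots> = (\<Sum>s''\<le>K. repE K (x \<boxtimes> y) $$ (s'', s) * h s'' a)"
        using s by (intro sum.cong)
          (auto simp: mult_mat_index[of _ K] sum_distrib_left sum_distrib_right ac_simps simp del: index_mult_mat(1))
      finally show "act n m (x \<boxtimes> y) (h s) a = (\<Sum>s''\<le>K. repE K (x \<boxtimes> y) $$ (s'', s) * h s'' a)" .
    qed
  next
    case (7 c x)
    show ?case
    proof (intro allI impI ext)
      fix s a assume s: "s \<le> K"
      show "act n m (c \<boxdot> x) (h s) a = (\<Sum>s'\<le>K. repE K (c \<boxdot> x) $$ (s', s) * h s' a)"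
        using 7 s by (simp add: act_smult sum_distrib_left mult.assoc)
    qed
  qed
  have "h 0 = v" by (auto simp: h_def c_def g_def)
  show ?thesis
    unfolding killed_def
  proof (intro allI impI)
    fix x a assume "\<forall>k\<in>spins n m. repE k x = 0\<^sub>m (Suc k) (Suc k)"
    then have "repE K x = 0\<^sub>m (Suc K) (Suc K)" using K by blast
    then show "act n m x v a = 0" using main[of x] \<open>h 0 = v\<close> by (auto dest!: spec[of _ 0])
  qed
qed


definition basis_vec :: "nat \<times> nat \<Rightarrow> nat \<times> nat \<Rightarrow> complex" where
  "basis_vec a b = (if b = a then 1 else 0)"

lemma act_f_basis_vec:
  assumes "a \<le> n" "b \<le> m"
  shows "act n m (Gen Gf) (basis_vec (a, b)) =
    (\<lambda>p. qv n a * rc m (Suc b) * basis_vec (a, Suc b) p + rc n (Suc a) * inverse (qv m b) * basis_vec (Suc a, b) p)"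
proof
  fix p :: "nat \<times> nat"
  obtain i k where p: "p = (i, k)" by force
  show "act n m (Gen Gf) (basis_vec (a, b)) p =
    qv n a * rc m (Suc b) * basis_vec (a, Suc b) p + rc n (Suc a) * inverse (qv m b) * basis_vec (Suc a, b) p"
  proof (cases "i \<le> n \<and> k \<le> m")
    case True
    then show ?thesis using p by (cases i; cases k) (auto simp: act_f basis_vec_def)
  next
    case False
    then have "basis_vec (a, Suc b) p = 0 \<or> b = m" "basis_vec (Suc a, b) p = 0 \<or> a = n"
      using assms p by (auto simp: basis_vec_def)
    then show ?thesis using False p by (auto simp: act_outside)
  qed
qed

text \<open>Modulo the image of \<open>f\<close> all basis vectors of a given level are multiples of each other,
  with coefficients of alternating signs. Below the level \<open>min n m\<close> the coordinates of the
  highest weight vector alternate as well, so that it does not lie in the image of \<open>f\<close>.\<close>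

lemma killed_basis_vec: "a \<le> n \<Longrightarrow> b \<le> m \<Longrightarrow> killed n m (basis_vec (a, b))"
proof (induction "a + b" arbitrary: a b rule: less_induct)
  case less
  define L where "L = a + b"
  have pos: "0 < rep_coeff t n' i" if "0 < i" "i \<le> n'" for n' i
    using rep_coeff_pos[OF that] .
  \<comment> \<open>The vectors one level below are killed by induction; f sends each of them to a
    combination of two neighbours on level L.\<close>
  have step: "killed n m (\<lambda>p. qv n i * rc m (Suc k) * basis_vec (i, Suc k) p +
      rc n (Suc i) * inverse (qv m k) * basis_vec (Suc i, k) p)"
    if "i \<le> n" "k \<le> m" "Suc (i + k) = L" for i k
    using killed_act[OF less.hyps[of i k], of "Gen Gf"] act_f_basis_vec[OF that(1,2)] that L_def by simp
  \<comment> \<open>A two-term relation passes the property from one neighbour to the other. For i =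
    n one coefficient is 0, so propagation can start there.\<close>
  have right: "killed n m (basis_vec (i, Suc k))"
    if "i \<le> n" "Suc k \<le> m" "Suc (i + k) = L" "i = n \<or> killed n m (basis_vec (Suc i, k))" for i k
  proof -
    have "killed n m (\<lambda>p. (- (rc n (Suc i) * inverse (qv m k))) * basis_vec (Suc i, k) p)"
      using that(4) killed_smult[of n m "basis_vec (Suc i, k)" "- (rc n (Suc i) * inverse (qv m k))"] killed_zero
      by auto
    from killed_add[OF step[of i k] this] have "killed n m (\<lambda>p. qv n i * rc m (Suc k) * basis_vec (i, Suc k) p)"
      using that by simp
    then show ?thesis using pos[of "Suc k" m] that by (auto dest!: killed_smultD)
  qed
  have left: "killed n m (basis_vec (Suc i, k))"
    if "Suc i \<le> n" "k \<le> m" "Suc (i + k) = L" "k = m \<or> killed n m (basis_vec (i, Suc k))" for i k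
  proof -
    have "killed n m (\<lambda>p. (- (qv n i * rc m (Suc k))) * basis_vec (i, Suc k) p)"
      using that(4) killed_smult[of n m "basis_vec (i, Suc k)" "- (qv n i * rc m (Suc k))"] killed_zero
      by auto
    from killed_add[OF step[of i k] this] have "killed n m (\<lambda>p. rc n (Suc i) * inverse (qv m k) * basis_vec (Suc i, k) p)"
      using that by simp
    then show ?thesis using pos[of "Suc i" n] that by (auto dest!: killed_smultD)
  qed
  have "i \<le> n \<longrightarrow> k \<le> m \<longrightarrow> i + k = L \<longrightarrow> killed n m (basis_vec (i, k))" for i k
  proof (cases "L > n")
    case True
    show ?thesis
    proof (induction "n - i" arbitrary: i k rule: less_induct)
      case less
      show ?case
      proof (intro impI)
        assume ik: "i \<le> n" "k \<le> m" "i + k = L"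
        then obtain k' where k: "k = Suc k'" using True by (cases k) auto
        have "i = n \<or> killed n m (basis_vec (Suc i, k'))"
          using less[of "Suc i" k'] ik k by (cases "i = n") auto
        then show "killed n m (basis_vec (i, k))" using right[of i k'] ik k by simp
      qed
    qed
  next
    case Ln: False
    show ?thesis
    proof (cases "L > m")
      case True
      show ?thesis
      proof (induction "m - k" arbitrary: i k rule: less_induct)
        case less
        show ?case
        proof (intro impI)
          assume ik: "i \<le> n" "k \<le> m" "i + k = L"
          then obtain i' where i: "i = Suc i'" using True by (cases i) auto
          have "k = m \<or> killed n m (basis_vec (i', Suc k))"
            using less[of "Suc k" i'] ik i by (cases "k = m") auto
          then show "killed n m (basis_vec (i, k))" using left[of i' k] ik i by simp
        qed
      qed
    next
      case False
      then have L: "L \<le> n" "L \<le> m" using Ln by auto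
      \<comment> \<open>\<open>A\<close> and \<open>B\<close> are the coefficients of the equation e
        v = 0 along the level and, f being adjoint to e, also those of the relations in
        \<open>step\<close>.\<close>
      define A where "A j = exp (t * weight n j) * rep_coeff t m (L - j)" for j
      define B where "B j = rep_coeff t n (Suc j) * inverse (exp (t * weight m (L - Suc j)))" for j
      have A: "A j > 0" and B: "B j > 0" if "j < L" for j
        using that L by (auto simp: A_def B_def intro!: mult_pos_pos pos)
      have A_complex: "complex_of_real (A j) = qv n j * rc m (L - j)"
        and B_complex: "complex_of_real (B j) = rc n (Suc j) * inverse (qv m (L - Suc j))" for j
        by (simp_all add: A_def B_def qv_def)
      \<comment> \<open>These numbers satisfy A j * \<gamma> j = B j * \<gamma> (Suc j), so with
        alternating signs they are the coordinates of a highest weight vector.\<close>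
      define \<gamma> where "\<gamma> j = (\<Prod>l<j. A l / B l)" for j
      have \<gamma>: "\<gamma> j > 0" if "j \<le> L" for j
        using that A B by (auto simp: \<gamma>_def intro!: prod_pos)
      define v where "v p = (\<Sum>j\<le>L. (- 1) ^ j * complex_of_real (\<gamma> j) * basis_vec (j, L - j) p)" for p
      have v: "v (i, k) = (if i + k = L then (- 1) ^ i * complex_of_real (\<gamma> i) else 0)" for i k
      proof -
        have "v (i, k) = (\<Sum>j\<le>L. if j = i then (if i + k = L then (- 1) ^ i * complex_of_real (\<gamma> i) else 0) else 0)"
          unfolding v_def by (rule sum.cong) (auto simp: basis_vec_def)
        then show ?thesis by (simp add: sum.delta)
      qed
      have "killed n m v"
      proof (rule killed_highest_weight)
        show "at_level n m L v" using L by (auto simp: at_level_def v)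
        fix p :: "nat \<times> nat"
        obtain i k where p: "p = (i, k)" by force
        show "act n m (Gen Ge) v p = 0"
        proof (cases "i \<le> n \<and> k \<le> m \<and> Suc (i + k) = L")
          case True
          then have k: "k = L - Suc i" "Suc k = L - i" "i < L" by auto
          have "act n m (Gen Ge) v p = complex_of_real (A i) * ((- 1) ^ i * complex_of_real (\<gamma> i)) +
              complex_of_real (B i) * ((- 1) ^ Suc i * complex_of_real (\<gamma> (Suc i)))"
            using True k p by (simp add: act_e v A_complex B_complex)
          also have "complex_of_real (\<gamma> (Suc i)) = complex_of_real (\<gamma> i) * (complex_of_real (A i) / complex_of_real (B i))"
            by (simp add: \<gamma>_def)
          finally show ?thesis using B[OF k(3)] by (simp add: field_simps)
        next
          case False
          then show ?thesis using p by (cases "i \<le> n \<and> k \<le> m") (auto simp: act_e v act_outside)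
        qed
      qed (use L in auto)
      have rel: "\<exists>d > 0. killed n m (\<lambda>p. basis_vec (j, L - j) p - (- 1) ^ j * complex_of_real d * basis_vec (0, L) p)"
        if "j \<le> L" for j
        using that
      proof (induction j)
        case 0
        then show ?case using killed_zero by (intro exI[of _ 1]) simp
      next
        case (Suc j)
        then obtain d where d: "d > 0"
          "killed n m (\<lambda>p. basis_vec (j, L - j) p - (- 1) ^ j * complex_of_real d * basis_vec (0, L) p)" by auto
        have j: "j < L" using Suc.prems by simp
        then have "killed n m (\<lambda>p. complex_of_real (A j) * basis_vec (j, L - j) p + complex_of_real (B j) * basis_vec (Suc j, L - Suc j) p)"
          using step[of j "L - Suc j"] L by (simp add: A_complex B_complex Suc_diff_Suc)
        from killed_add[OF killed_smult[OF this, of "inverse (complex_of_real (B j))"]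
            killed_smult[OF d(2), of "- (complex_of_real (A j) / complex_of_real (B j))"]]
        have "killed n m (\<lambda>p. basis_vec (Suc j, L - Suc j) p - (- 1) ^ Suc j * complex_of_real (A j / B j * d) * basis_vec (0, L) p)"
          by (rule back_subst[of "killed n m"]) (use B[OF j] in \<open>auto simp: fun_eq_iff field_simps\<close>)
        then show ?case using d(1) A[OF j] B[OF j] by (intro exI[of _ "A j / B j * d"]) simp
      qed
      then obtain d where d: "\<And>j. j \<le> L \<Longrightarrow> d j > 0"
        "\<And>j. j \<le> L \<Longrightarrow> killed n m (\<lambda>p. basis_vec (j, L - j) p - (- 1) ^ j * complex_of_real (d j) * basis_vec (0, L) p)"
        by metis
      \<comment> \<open>Replacing each basis vector in \<open>v\<close> by its multiple of
        \<open>basis_vec (0, L)\<close> pairs equal signs. The total is a sum of positive numbers,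
        so it cannot cancel.\<close>
      have "killed n m (\<lambda>p. \<Sum>j\<le>L. (- 1) ^ j * complex_of_real (\<gamma> j) *
          (basis_vec (j, L - j) p - (- 1) ^ j * complex_of_real (d j) * basis_vec (0, L) p))"
        using d(2) by (intro killed_sum killed_smult) auto
      from killed_add[OF \<open>killed n m v\<close> killed_smult[OF this, of "-1"]]
      have "killed n m (\<lambda>p. (\<Sum>j\<le>L. (- 1) ^ j * complex_of_real (\<gamma> j) * (- 1) ^ j * complex_of_real (d j)) * basis_vec (0, L) p)"
        by (simp add: v_def algebra_simps sum_subtractf sum_distrib_left sum_negf)
      moreover have "(\<Sum>j\<le>L. (- 1) ^ j * complex_of_real (\<gamma> j) * (- 1) ^ j * complex_of_real (d j)) =
          complex_of_real (\<Sum>j\<le>L. \<gamma> j * d j)"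
        by (auto intro!: sum.cong simp flip: power_add mult_2 simp: mult.assoc mult.left_commute[of "(- 1) ^ _"])
      moreover have "(\<Sum>j\<le>L. \<gamma> j * d j) > 0" using \<gamma> d(1) by (intro sum_pos) auto
      ultimately have first: "killed n m (basis_vec (0, L))"
        by (metis killed_smultD of_real_eq_0_iff less_irrefl)
      show ?thesis
      proof (induction i arbitrary: k)
        case 0
        then show ?case using first by simp
      next
        case (Suc i)
        show ?case using left[of i k] Suc[of "Suc k"] L by auto
      qed
    qed
  qed
  then show ?case using less.prems L_def by simp
qed

text \<open>The form of Clebsch-Gordan that makes \<Delta>_A well defined: the coefficient is a
  coordinate of x acting on a basis vector, and basis vectors are killed.\<close>

lemma tcoeff_eq_zero:
  assumes "\<And>k. k \<in> spins n m \<Longrightarrow> repE k x = 0\<^sub>m (Suc k) (Suc k)" "a \<in> box n m" "b \<in> box n m"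
  shows "tcoeff n m x a b = 0"
proof -
  have "act n m x (basis_vec b) a = 0"
    using killed_basis_vec[of "fst b" n "snd b" m] assms
    by (auto simp: killed_def box_def)
  moreover have "act n m x (basis_vec b) a = (\<Sum>c\<in>box n m. if c = b then tcoeff n m x a c else 0)"
    using assms by (intro act_eq_sum) (auto simp: basis_vec_def)
  ultimately show ?thesis using assms(3) by (simp add: sum.delta)
qed

section \<open>Joint surjectivity of the irreducible representations\<close>

primrec gen_power :: "uq_gen \<Rightarrow> nat \<Rightarrow> uq_gen expr" where
  "gen_power a 0 = EOne"
| "gen_power a (Suc p) = Gen a \<boxtimes> gen_power a p"

lemma repE_power_e:
  "i \<le> k \<Longrightarrow> j \<le> k \<Longrightarrow> repE k (gen_power Ge p) $$ (i, j) =
    (if j = i + p then \<Prod>l<p. rc k (Suc (i + l)) else 0)"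
proof (induction p arbitrary: i)
  case (Suc p)
  then show ?case
    by (auto simp: rep_mult_index prod.lessThan_Suc_shift simp del: index_mult_mat(1) prod.lessThan_Suc)
qed auto

lemma repE_power_f:
  "i \<le> k \<Longrightarrow> j \<le> k \<Longrightarrow> repE k (gen_power Gf p) $$ (i, j) =
    (if i = j + p then \<Prod>l<p. rc k (Suc (j + l)) else 0)"
proof (induction p arbitrary: i)
  case (Suc p)
  then show ?case
    by (cases i) (auto simp: rep_mult_index simp del: index_mult_mat(1))
qed auto

text \<open>The element is a multiple of f^i e^N f^(N-j). In \<pi>_N the middle power has rank one,
  from lowest to highest weight, and the outer powers move these to j and i. For k < N already e^N
  acts as 0.\<close>

lemma exists_matrix_unit:
  assumes "i \<le> N" "j \<le> N"
  shows "\<exists>x. (\<forall>k<N. repE k x = 0\<^sub>m (Suc k) (Suc k)) \<and>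
    repE N x = mat (Suc N) (Suc N) (\<lambda>p. if p = (i, j) then 1 else 0)"
proof -
  have nz: "(\<Prod>l<p. rc N (Suc (s + l))) \<noteq> 0" if "s + p \<le> N" for s p
  proof -
    have "rc N (Suc (s + l)) \<noteq> 0" if "l < p" for l
      using rep_coeff_pos[of "Suc (s + l)" N] that \<open>s + p \<le> N\<close> by simp
    then show ?thesis by simp
  qed
  define c where "c = (\<Prod>l<i. rc N (Suc (0 + l))) * (\<Prod>l<N. rc N (Suc (0 + l))) * (\<Prod>l<N - j. rc N (Suc (j + l)))"
  have c: "c \<noteq> 0" using nz[of 0 i] nz[of 0 N] nz[of j "N - j"] assms by (simp add: c_def)
  let ?x = "inverse c \<boxdot> (gen_power Gf i \<boxtimes> (gen_power Ge N \<boxtimes> gen_power Gf (N - j)))"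
  have mc: "A * B \<in> carrier_mat (Suc n) (Suc n)"
    if "A \<in> carrier_mat (Suc n) (Suc n)" "B \<in> carrier_mat (Suc n) (Suc n)" for A B :: "complex mat" and n
    using that by simp
  have "repE k ?x = 0\<^sub>m (Suc k) (Suc k)" if "k < N" for k
  proof -
    have "repE k (gen_power Ge N) = 0\<^sub>m (Suc k) (Suc k)"
      using that by (intro op_alg_eqI[of _ k]) (auto simp: repE_power_e)
    then show ?thesis
      by (simp add: left_mult_zero_mat[OF repE_carrier] right_mult_zero_mat[OF repE_carrier])
  qed
  moreover have "repE N ?x = mat (Suc N) (Suc N) (\<lambda>p. if p = (i, j) then 1 else 0)"
  proof (rule op_alg_eqI[of _ N])
    fix a b assume ab: "a \<le> N" "b \<le> N"
    have "(repE N (gen_power Ge N) * repE N (gen_power Gf (N - j))) $$ (s, b) =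
        (\<Sum>k\<le>N. if k = N then (if s = 0 \<and> b = j then
          (\<Prod>l<N. rc N (Suc (0 + l))) * (\<Prod>l<N - j. rc N (Suc (j + l))) else 0) else 0)" if "s \<le> N" for s
      using that ab assms unfolding mult_mat_index[OF repE_carrier repE_carrier that ab(2)]
      by (intro sum.cong) (auto simp: repE_power_e repE_power_f)
    then have 1: "(repE N (gen_power Ge N) * repE N (gen_power Gf (N - j))) $$ (s, b) =
        (if s = 0 \<and> b = j then (\<Prod>l<N. rc N (Suc (0 + l))) * (\<Prod>l<N - j. rc N (Suc (j + l))) else 0)"
      if "s \<le> N" for s using that by (simp add: sum.delta)
    have "(repE N (gen_power Gf i) * (repE N (gen_power Ge N) * repE N (gen_power Gf (N - j)))) $$ (a, b) =
        (\<Sum>s\<le>N. if s = 0 then (if a = i \<and> b = j then c else 0) else 0)"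
      using ab assms unfolding mult_mat_index[OF repE_carrier mc[OF repE_carrier repE_carrier] ab]
      by (intro sum.cong) (auto simp: 1 repE_power_f c_def simp del: index_mult_mat(1))
    also have "\<dots> = (if a = i \<and> b = j then c else 0)" by (simp add: sum.delta)
    finally show "repE N ?x $$ (a, b) = mat (Suc N) (Suc N) (\<lambda>p. if p = (i, j) then 1 else 0) $$ (a, b)"
      using ab c by (simp del: index_mult_mat(1))
  qed auto
  ultimately show ?thesis by blast
qed

text \<open>The system is triangular: the component at N can be changed at will without touching
  those below, so components are corrected in increasing order.\<close>

lemma repE_jointly_surjective:
  assumes "\<And>k. k \<le> N \<Longrightarrow> a k \<in> carrier_mat (Suc k) (Suc k)"
  shows "\<exists>x. \<forall>k\<le>N. repE k x = a k"
proof -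
  have top: "\<exists>x. (\<forall>k<N. repE k x = 0\<^sub>m (Suc k) (Suc k)) \<and> repE N x = A"
    if A: "A \<in> carrier_mat (Suc N) (Suc N)" for N A
  proof -
    have "finite P \<Longrightarrow> P \<subseteq> box N N \<Longrightarrow> \<exists>x. (\<forall>k<N. repE k x = 0\<^sub>m (Suc k) (Suc k)) \<and>
        repE N x = mat (Suc N) (Suc N) (\<lambda>p. if p \<in> P then A $$ p else 0)" for P
    proof (induction P rule: finite_induct)
      case empty
      show ?case by (rule exI[of _ EZero]) (auto intro!: eq_matI)
    next
      case (insert p P)
      then obtain x where x: "\<forall>k<N. repE k x = 0\<^sub>m (Suc k) (Suc k)"
        "repE N x = mat (Suc N) (Suc N) (\<lambda>p. if p \<in> P then A $$ p else 0)" by auto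
      obtain y where y: "\<forall>k<N. repE k y = 0\<^sub>m (Suc k) (Suc k)"
        "repE N y = mat (Suc N) (Suc N) (\<lambda>q. if q = p then 1 else 0)"
        using exists_matrix_unit[of "fst p" N "snd p"] insert.prems by (auto simp: box_def)
      show ?case
        using x y insert.hyps(2) by (intro exI[of _ "x \<boxplus> A $$ p \<boxdot> y"]) (auto intro!: eq_matI)
    qed
    from this[of "box N N"] obtain x where x: "\<forall>k<N. repE k x = 0\<^sub>m (Suc k) (Suc k)"
      "repE N x = mat (Suc N) (Suc N) (\<lambda>p. if p \<in> box N N then A $$ p else 0)" by auto
    moreover have "mat (Suc N) (Suc N) (\<lambda>p. if p \<in> box N N then A $$ p else 0) = A"
      using A by (intro eq_matI) auto
    ultimately show ?thesis by auto
  qed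
  show ?thesis using assms
  proof (induction N)
    case 0
    then show ?case using top[of "a 0" 0] by auto
  next
    case (Suc N)
    then obtain x where x: "\<forall>k\<le>N. repE k x = a k" by auto
    have "a (Suc N) + (-1) \<cdot>\<^sub>m repE (Suc N) x \<in> carrier_mat (Suc (Suc N)) (Suc (Suc N))"
      using Suc.prems[of "Suc N"] by simp
    from top[OF this] obtain y where y: "\<forall>k<Suc N. repE k y = 0\<^sub>m (Suc k) (Suc k)"
      "repE (Suc N) y = a (Suc N) + (-1) \<cdot>\<^sub>m repE (Suc N) x" by auto
    have "repE k (x \<boxplus> y) = a k" if "k \<le> Suc N" for k
    proof (cases "k = Suc N")
      case True
      then show ?thesis using y(2) Suc.prems[of "Suc N"] by (intro op_alg_eqI[of _ k]) auto
    next
      case False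
      then show ?thesis using x y(1) that Suc.prems[of k] by simp
    qed
    then show ?case by blast
  qed
qed

end


section \<open>The dual B\<close>

lemma MA_simps [simp]:
  "a \<in> carrier MA \<longleftrightarrow> (\<forall>n. a n \<in> carrier_mat (Suc n) (Suc n))"
  "a \<otimes>\<^bsub>MA\<^esub> b = (\<lambda>n. a n * b n)"
  "a \<oplus>\<^bsub>MA\<^esub> b = (\<lambda>n. a n + b n)"
  "c \<odot>\<^bsub>MA\<^esub> a = (\<lambda>n. c \<cdot>\<^sub>m a n)"
  "star MA a = (\<lambda>n. mat_adjoint (a n))"
  "\<one>\<^bsub>MA\<^esub> = (\<lambda>n. 1\<^sub>m (Suc n))"
  by (simp_all add: MA_def)

lemma mem_A_set:
  "a \<in> A_set \<longleftrightarrow> (\<forall>n. a n \<in> carrier_mat (Suc n) (Suc n)) \<and> finite {n. a n \<noteq> 0\<^sub>m (Suc n) (Suc n)}"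
  by (simp add: A_set_def)

lemma A_set_carrier: "a \<in> A_set \<Longrightarrow> a n \<in> carrier_mat (Suc n) (Suc n)"
  by (simp add: mem_A_set)

lemma A_setI:
  assumes "\<And>n. a n \<in> carrier_mat (Suc n) (Suc n)" "finite K"
    and "\<And>n. n \<notin> K \<Longrightarrow> a n = 0\<^sub>m (Suc n) (Suc n)"
  shows "a \<in> A_set"
proof -
  have "{n. a n \<noteq> 0\<^sub>m (Suc n) (Suc n)} \<subseteq> K" using assms(3) by auto
  then show ?thesis using assms(1,2) finite_subset by (auto simp: mem_A_set)
qed

lemma A_set_add:
  assumes "a \<in> A_set" "b \<in> A_set" shows "(\<lambda>n. a n + b n) \<in> A_set"
  by (rule A_setI[of _ "{n. a n \<noteq> 0\<^sub>m (Suc n) (Suc n)} \<union> {n. b n \<noteq> 0\<^sub>m (Suc n) (Suc n)}"])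
    (use assms in \<open>auto simp: mem_A_set\<close>)

lemma A_set_smult:
  assumes "a \<in> A_set" shows "(\<lambda>n. c \<cdot>\<^sub>m a n) \<in> A_set"
  by (rule A_setI[of _ "{n. a n \<noteq> 0\<^sub>m (Suc n) (Suc n)}"]) (use assms in \<open>auto simp: mem_A_set\<close>)

lemma A_set_mult:
  assumes "a \<in> A_set" "b \<in> A_set" shows "(\<lambda>n. a n * b n) \<in> A_set"
proof (rule A_setI[of _ "{n. a n \<noteq> 0\<^sub>m (Suc n) (Suc n)}"])
  fix n show "a n * b n \<in> carrier_mat (Suc n) (Suc n)"
    using mult_carrier_mat[OF A_set_carrier[OF assms(1)] A_set_carrier[OF assms(2)]] .
  assume "n \<notin> {n. a n \<noteq> 0\<^sub>m (Suc n) (Suc n)}"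
  then show "a n * b n = 0\<^sub>m (Suc n) (Suc n)"
    using left_mult_zero_mat[OF A_set_carrier[OF assms(2)]] by simp
qed (use assms in \<open>simp add: mem_A_set\<close>)

lemma component_A_set [simp]: "x \<in> carrier_mat (Suc k) (Suc k) \<Longrightarrow> component k x \<in> A_set"
  by (rule A_setI[of _ "{k}"]) (auto simp: component_def)

lemma component_index: "component k x n = (if n = k then x else 0\<^sub>m (Suc n) (Suc n))"
  by (simp add: component_def)

lemma component_add: "x \<in> carrier_mat (Suc k) (Suc k) \<Longrightarrow> y \<in> carrier_mat (Suc k) (Suc k) \<Longrightarrow>
    component k (x + y) = (\<lambda>n. component k x n + component k y n)"
  by (auto simp: component_def fun_eq_iff)

lemma component_smult: "component k (c \<cdot>\<^sub>m x) = (\<lambda>n. c \<cdot>\<^sub>m component k x n)"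
  by (auto simp: component_def fun_eq_iff)

lemma B_set_extensional: "b \<in> B_set \<Longrightarrow> b \<in> extensional A_set"
  and B_set_add: "b \<in> B_set \<Longrightarrow> a \<in> A_set \<Longrightarrow> a' \<in> A_set \<Longrightarrow> b (\<lambda>n. a n + a' n) = b a + b a'"
  and B_set_smult: "b \<in> B_set \<Longrightarrow> a \<in> A_set \<Longrightarrow> b (\<lambda>n. c \<cdot>\<^sub>m a n) = c * b a"
  and B_set_blocks: "b \<in> B_set \<Longrightarrow> finite (blocks b)"
  by (simp_all add: B_set_def)

lemma B_setI:
  assumes "b \<in> extensional A_set"
    and "\<And>a a'. a \<in> A_set \<Longrightarrow> a' \<in> A_set \<Longrightarrow> b (\<lambda>n. a n + a' n) = b a + b a'"
    and "\<And>c a. a \<in> A_set \<Longrightarrow> b (\<lambda>n. c \<cdot>\<^sub>m a n) = c * b a"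
    and "finite K" "\<And>k x. k \<notin> K \<Longrightarrow> x \<in> carrier_mat (Suc k) (Suc k) \<Longrightarrow> b (component k x) = 0"
  shows "b \<in> B_set"
proof -
  have "blocks b \<subseteq> K" using assms(5) by (auto simp: blocks_def)
  then show ?thesis using assms finite_subset by (auto simp: B_set_def)
qed

lemma B_set_component_zero:
  assumes "b \<in> B_set" shows "b (component k (0\<^sub>m (Suc k) (Suc k))) = 0"
proof -
  have "component k (0\<^sub>m (Suc k) (Suc k)) = (\<lambda>n. 0 \<cdot>\<^sub>m component k (0\<^sub>m (Suc k) (Suc k)) n)"
    by (auto simp: component_def fun_eq_iff)
  then show ?thesis
    using B_set_smult[OF assms component_A_set[OF zero_carrier_mat], of 0] by (metis mult_zero_left)
qed

text \<open>An element of A is a finite sum of its components, and those outside the blocks of b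
  contribute 0. The right-hand side makes sense on all of M(A), which is what
  \<open>pairingM\<close> exploits.\<close>

lemma B_set_expand:
  assumes b: "b \<in> B_set" and a: "a \<in> A_set"
  shows "b a = (\<Sum>n\<in>blocks b. b (component n (a n)))"
proof -
  have 1: "finite K \<Longrightarrow> (\<And>n. n \<notin> K \<Longrightarrow> a n = 0\<^sub>m (Suc n) (Suc n)) \<Longrightarrow> a \<in> A_set \<Longrightarrow>
      b a = (\<Sum>n\<in>K. b (component n (a n)))" for K a
  proof (induction K arbitrary: a rule: finite_induct)
    case empty
    then have "a = component 0 (0\<^sub>m (Suc 0) (Suc 0))" by (auto simp: component_def fun_eq_iff)
    then show ?case using B_set_component_zero[OF b, of 0] by simp
  next
    case (insert k K)
    let ?a = "a(k := 0\<^sub>m (Suc k) (Suc k))"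
    have carrier: "a k \<in> carrier_mat (Suc k) (Suc k)" using A_set_carrier[OF insert.prems(2)] .
    have "?a \<in> A_set"
      using insert.prems insert.hyps(1) by (intro A_setI[of _ K]) (auto simp: mem_A_set)
    moreover have "a = (\<lambda>n. component k (a k) n + ?a n)"
      using A_set_carrier[OF insert.prems(2)] by (auto simp: component_def fun_eq_iff)
    ultimately have "b a = b (component k (a k)) + b ?a"
      using B_set_add[OF b, of "component k (a k)" ?a] carrier by (metis component_A_set)
    also have "b ?a = (\<Sum>n\<in>K. b (component n (?a n)))"
      using insert.prems(1) by (intro insert.IH[OF _ \<open>?a \<in> A_set\<close>]) auto
    also have "\<dots> = (\<Sum>n\<in>K. b (component n (a n)))"
      using insert.hyps(2) by (intro sum.cong) auto
    finally show ?case using insert.hyps by simp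
  qed
  let ?S = "{n. a n \<noteq> 0\<^sub>m (Suc n) (Suc n)}"
  have S: "finite ?S" using a by (simp add: mem_A_set)
  have "b a = (\<Sum>n\<in>?S \<union> blocks b. b (component n (a n)))"
    using S a B_set_blocks[OF b] by (intro 1) auto
  also have "\<dots> = (\<Sum>n\<in>blocks b. b (component n (a n)))"
    using S B_set_blocks[OF b] A_set_carrier[OF a]
    by (intro sum.mono_neutral_right) (auto simp: blocks_def)
  finally show ?thesis .
qed

section \<open>Elements of B as functionals on U\<close>

context quantum
begin

text \<open>The family of all \<pi>_n(x) lies in M(A) and in general not in A, so b is evaluated
  through its finitely many blocks.\<close>

definition hat :: "((nat \<Rightarrow> complex mat) \<Rightarrow> complex) \<Rightarrow> uq_gen expr \<Rightarrow> complex" where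
  "hat b x = pairingM (\<lambda>n. repE n x) b"

lemma hat_eq:
  assumes "b \<in> B_set" "a \<in> A_set" "\<And>k. k \<in> blocks b \<Longrightarrow> repE k x = a k"
  shows "hat b x = b a"
  using assms(3) B_set_expand[OF assms(1,2)] by (simp add: hat_def pairingM_def)

lemma hat_cong: "(\<And>k. repE k x = repE k y) \<Longrightarrow> hat b x = hat b y"
  by (simp add: hat_def)

lemma ulin_hat: "b \<in> B_set \<Longrightarrow> ulin (hat b)"
  unfolding ulin_def hat_def pairingM_def
  by (simp add: repE_cong component_add component_smult B_set_add B_set_smult sum.distrib sum_distrib_left)

lemma exists_expr:
  assumes "finite K" "\<And>n. a n \<in> carrier_mat (Suc n) (Suc n)"
  shows "\<exists>x. \<forall>k\<in>K. repE k x = a k"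
proof -
  obtain N where "\<And>k. k \<in> K \<Longrightarrow> k \<le> N" using assms(1) by (meson finite_nat_set_iff_bounded_le)
  moreover obtain x where "\<forall>k\<le>N. repE k x = a k" using repE_jointly_surjective[of N a] assms(2) by blast
  ultimately show ?thesis by blast
qed

text \<open>Truncation turns the family \<pi>_n(x) into an element of A without changing it on the
  blocks that matter.\<close>

lemma exists_A_set:
  assumes "finite K"
  shows "\<exists>a\<in>A_set. \<forall>k\<in>K. a k = repE k x"
  by (rule bexI[of _ "\<lambda>k. if k \<in> K then repE k x else 0\<^sub>m (Suc k) (Suc k)"])
    (auto intro: A_setI[OF _ assms])

lemma B_set_eqI:
  assumes "b \<in> B_set" "b' \<in> B_set" "\<And>x. hat b x = hat b' x"
  shows "b = b'"
proof (rule extensionalityI[OF B_set_extensional[OF assms(1)] B_set_extensional[OF assms(2)]])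
  fix a assume a: "a \<in> A_set"
  obtain x where "\<forall>k\<in>blocks b \<union> blocks b'. repE k x = a k"
    using exists_expr[of "blocks b \<union> blocks b'" a] A_set_carrier[OF a] B_set_blocks assms(1,2) by blast
  then have "b a = hat b x" "b' a = hat b' x"
    using hat_eq[OF assms(1) a, of x] hat_eq[OF assms(2) a, of x] by auto
  then show "b a = b' a" using assms(3) by simp
qed

lemma linear_functional_component: "b \<in> B_set \<Longrightarrow> linear_functional (op_alg n) (\<lambda>x. b (component n x))"
  by (simp add: linear_functional_def component_add component_smult B_set_add B_set_smult)

section \<open>The coproduct of A and the product of B\<close>

definition unit_mat :: "nat \<Rightarrow> nat \<times> nat \<Rightarrow> complex mat" where
  "unit_mat n p = mat (Suc n) (Suc n) (\<lambda>q. if q = p then 1 else 0)"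

lemma unit_mat_carrier [simp]: "unit_mat n p \<in> carrier_mat (Suc n) (Suc n)"
  by (simp add: unit_mat_def)

lemma lcomb_unit_mat:
  assumes "distinct ps" "A \<in> carrier_mat (Suc n) (Suc n)"
  shows "lcomb (op_alg n) (map (\<lambda>p. (A $$ p, unit_mat n p)) ps) =
    mat (Suc n) (Suc n) (\<lambda>q. if q \<in> set ps then A $$ q else 0)"
  using assms(1) by (induction ps) (auto intro!: eq_matI simp: unit_mat_def)

lemma op_alg_expansion:
  "\<exists>ps. set ps = box n n \<and>
    (\<forall>A\<in>carrier_mat (Suc n) (Suc n). A = lcomb (op_alg n) (map (\<lambda>p. (A $$ p, unit_mat n p)) ps))"
proof -
  obtain ps where ps: "set ps = box n n" "distinct ps" using finite_distinct_list[of "box n n"] by auto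
  have "A = lcomb (op_alg n) (map (\<lambda>p. (A $$ p, unit_mat n p)) ps)"
    if "A \<in> carrier_mat (Suc n) (Suc n)" for A
    unfolding lcomb_unit_mat[OF ps(2) that] using that ps(1) by (auto intro!: eq_matI)
  then show ?thesis using ps(1) by auto
qed

text \<open>Two lifts of \<open>a\<close> differ by an element that vanishes in all \<pi>_k with k
  in \<open>spins n m\<close>, so \<open>tcoeff_eq_zero\<close> gives them equal coefficients;
  matrix entries on both legs then separate the tensors.\<close>

lemma A_comult_eq:
  assumes x: "\<And>k. k \<in> spins n m \<Longrightarrow> repE k x = a k"
  shows "A_comult t a n m =
    tcls (op_alg n) (op_alg m) (map (map_prod (repE n) (repE m)) (expr_comult uq_delta x))"
proof -
  interpret U: uq_alg "uq t" t "uq_el t Ge" "uq_el t Gf" "uq_el t Gq" "uq_el t Gqinv"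
    by (rule uq_alg_uq)
  interpret P: tensor_pair "uq t" "uq t" by unfold_locales
  interpret O: tensor_pair "op_alg n" "op_alg m" by (simp add: tensor_pair_def staralg_op_alg)
  let ?D = "\<lambda>x. map (map_prod (repE n) (repE m)) (expr_comult uq_delta x)"
  have map: "tensor_map (op_alg n) (op_alg m) (rep t n) (rep t m) (uq_comult t (cls R y)) =
      tcls (op_alg n) (op_alg m) (?D y)" for y
  proof -
    have "P.valid (map (map_prod (cls R) (cls R)) (expr_comult uq_delta y))" by (auto simp: carrier_uq)
    then show ?thesis unfolding uq_comult_cls
      by (subst P.tensor_map_tcls) (auto simp: staralg_op_alg rep_linear rep_cls comp_def split_def map_prod_def)
  qed
  have eq: "tcls (op_alg n) (op_alg m) (?D y) = tcls (op_alg n) (op_alg m) (?D x)"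
    if y: "\<And>k. k \<in> spins n m \<Longrightarrow> repE k y = a k" for y
  proof -
    have coeff: "tcoeff n m y p q = tcoeff n m x p q" if "p \<in> box n m" "q \<in> box n m" for p q
    proof -
      have "repE k (y \<boxplus> (-1) \<boxdot> x) = 0\<^sub>m (Suc k) (Suc k)" if "k \<in> spins n m" for k
      proof -
        have "repE k y = repE k x" using x[OF that] y[OF that] by simp
        then show ?thesis by (intro op_alg_eqI[of _ k]) auto
      qed
      from tcoeff_eq_zero[OF this \<open>p \<in> box n m\<close> \<open>q \<in> box n m\<close>]
      show ?thesis using that by (simp add: tcoeff_linear)
    qed
    obtain ps where ps: "set ps = box n n"
      "\<forall>A\<in>carrier_mat (Suc n) (Suc n). A = lcomb (op_alg n) (map (\<lambda>p. (A $$ p, unit_mat n p)) ps)"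
      using op_alg_expansion by blast
    have "tensor_eq (op_alg n) (op_alg m) (?D y) (?D x)"
    proof (rule O.tensor_eqI[where b = "unit_mat n" and \<phi> = "\<lambda>p A. A $$ p" and ps = ps
          and F = "(\<lambda>q A. A $$ q) ` box m m"])
      show "v = lcomb (op_alg n) (map (\<lambda>p. (v $$ p, unit_mat n p)) ps)"
        if "(v, w) \<in> set (?D y @ ?D x)" for v w using ps(2) that by auto
      show "w = w'" if "w \<in> carrier (op_alg m)" "w' \<in> carrier (op_alg m)"
        "\<And>\<psi>. \<psi> \<in> (\<lambda>q A. A $$ q) ` box m m \<Longrightarrow> \<psi> w = \<psi> w'" for w w'
        using that(1,2) that(3)[of "\<lambda>A. A $$ q" for q] by (intro op_alg_eqI[of _ m]) auto
      show "linear_functional (op_alg m) \<psi>" if "\<psi> \<in> (\<lambda>q A. A $$ q) ` box m m" for \<psi>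
        using that by (auto simp: linear_functional_def box_def)
      fix p \<psi> assume "p \<in> set ps" "\<psi> \<in> (\<lambda>q (A :: complex mat). A $$ q) ` box m m"
      then obtain q where q: "q \<in> box m m" "\<psi> = (\<lambda>A. A $$ q)" and p: "p \<in> box n n"
        using ps(1) by auto
      have "(\<Sum>(v, w)\<leftarrow>?D z. v $$ p * \<psi> w) = tcoeff n m z (fst p, fst q) (snd p, snd q)" for z
        by (simp add: q(2) tcoeff_def comult_sum_def comp_def split_def)
      then show "(\<Sum>(v, w)\<leftarrow>?D y. v $$ p * \<psi> w) = (\<Sum>(v, w)\<leftarrow>?D x. v $$ p * \<psi> w)"
        using p q(1) by (auto simp: box_def intro: coeff)
    qed auto
    then show ?thesis by (rule O.tcls_eqI)
  qed
  show ?thesis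
    unfolding A_comult_def
  proof (rule the_equality)
    show "\<exists>X\<in>carrier (uq t). (\<forall>k\<in>spins n m. rep t k X = a k) \<and>
        tcls (op_alg n) (op_alg m) (?D x) = tensor_map (op_alg n) (op_alg m) (rep t n) (rep t m) (uq_comult t X)"
      using x by (intro bexI[of _ "cls R x"]) (auto simp: rep_cls map carrier_uq)
    fix T assume "\<exists>X\<in>carrier (uq t). (\<forall>k\<in>spins n m. rep t k X = a k) \<and>
        T = tensor_map (op_alg n) (op_alg m) (rep t n) (rep t m) (uq_comult t X)"
    then show "T = tcls (op_alg n) (op_alg m) (?D x)"
      using eq by (auto simp: carrier_uq rep_cls map)
  qed
qed

lemma B_simps:
  "carrier (B_alg t) = B_set"
  "\<one>\<^bsub>B_alg t\<^esub> = restrict A_counit A_set"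
  "\<zero>\<^bsub>B_alg t\<^esub> = (\<lambda>a\<in>A_set. 0)"
  "b \<oplus>\<^bsub>B_alg t\<^esub> b' = (\<lambda>a\<in>A_set. b a + b' a)"
  "c \<odot>\<^bsub>B_alg t\<^esub> b = (\<lambda>a\<in>A_set. c * b a)"
  by (simp_all add: B_alg_def)

text \<open>A single lift x serves all pairs of blocks, so the double sum of the pairing merges into
  one Sweedler sum. The flip puts b' on the first leg.\<close>

lemma B_mult_eq:
  assumes b: "b \<in> B_set" "b' \<in> B_set" and a: "a \<in> A_set"
    and x: "\<And>n m k. n \<in> blocks b' \<Longrightarrow> m \<in> blocks b \<Longrightarrow> k \<in> spins n m \<Longrightarrow> repE k x = a k"
  shows "(b \<otimes>\<^bsub>B_alg t\<^esub> b') a = csum x (\<lambda>p r. hat b' p * hat b r)"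
proof -
  have "tensor_functional (\<lambda>y. b' (component n y)) (\<lambda>y. b (component m y)) (A_comult t a n m) =
      csum x (\<lambda>p r. b' (component n (repE n p)) * b (component m (repE m r)))"
    if nm: "n \<in> blocks b'" "m \<in> blocks b" for n m
  proof -
    interpret O: tensor_pair "op_alg n" "op_alg m" by (simp add: tensor_pair_def staralg_op_alg)
    have "O.valid (map (map_prod (repE n) (repE m)) (expr_comult uq_delta x))" by auto
    moreover have "A_comult t a n m =
        tcls (op_alg n) (op_alg m) (map (map_prod (repE n) (repE m)) (expr_comult uq_delta x))"
      by (rule A_comult_eq) (rule x[OF nm])
    ultimately show ?thesis
      using O.tensor_functional_tcls[OF linear_functional_component[OF b(2)] linear_functional_component[OF b(1)]]
      by (simp add: comult_sum_def comp_def split_def)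
  qed
  then have "(b \<otimes>\<^bsub>B_alg t\<^esub> b') a = (\<Sum>n\<in>blocks b'. \<Sum>m\<in>blocks b.
      csum x (\<lambda>p r. b' (component n (repE n p)) * b (component m (repE m r))))"
    using a by (simp add: B_alg_def pairing2_def)
  also have "\<dots> = csum x (\<lambda>p r. hat b' p * hat b r)"
    by (simp add: hat_def pairingM_def sum_product comult_sum_sum)
  finally show ?thesis .
qed

definition mult_spins :: "nat set \<Rightarrow> nat set \<Rightarrow> nat set" where
  "mult_spins N M = (\<Union>n\<in>N. \<Union>m\<in>M. spins n m)"

lemma finite_mult_spins: "finite N \<Longrightarrow> finite M \<Longrightarrow> finite (mult_spins N M)"
proof -
  have "spins n m \<subseteq> {..n + m}" for n m by (auto simp: spins_def)
  then have "finite (spins n m)" for n m using finite_subset by blast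
  then show "finite N \<Longrightarrow> finite M \<Longrightarrow> finite (mult_spins N M)" by (simp add: mult_spins_def)
qed

text \<open>Linearity is read off from lifts: a sum of lifts lifts the sum. The product lives on the
  blocks in \<open>mult_spins\<close>, a finite set.\<close>

lemma B_mult_closed:
  assumes b: "b \<in> B_set" "b' \<in> B_set"
  shows "b \<otimes>\<^bsub>B_alg t\<^esub> b' \<in> B_set"
proof -
  let ?K = "mult_spins (blocks b') (blocks b)"
  have K: "finite ?K" using assms by (intro finite_mult_spins B_set_blocks)
  have eq: "(b \<otimes>\<^bsub>B_alg t\<^esub> b') a = csum x (\<lambda>p r. hat b' p * hat b r)"
    if "a \<in> A_set" "\<forall>k\<in>?K. repE k x = a k" for a x
    using that by (intro B_mult_eq b) (auto simp: mult_spins_def)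
  show ?thesis
  proof (rule B_setI[OF _ _ _ K])
    show "b \<otimes>\<^bsub>B_alg t\<^esub> b' \<in> extensional A_set" by (simp add: B_alg_def)
    fix a assume a: "a \<in> A_set"
    obtain x where x: "\<forall>k\<in>?K. repE k x = a k" using exists_expr[OF K] A_set_carrier[OF a] by blast
    show "(b \<otimes>\<^bsub>B_alg t\<^esub> b') (\<lambda>n. c \<cdot>\<^sub>m a n) = c * (b \<otimes>\<^bsub>B_alg t\<^esub> b') a" for c
      using eq[OF A_set_smult[OF a], of "c \<boxdot> x" c] eq[OF a x] x
      by (simp add: ulin_smult[OF ulin_hat[OF b(2)]] comult_sum_mult_left mult.assoc)
    fix a' assume a': "a' \<in> A_set"
    obtain x' where x': "\<forall>k\<in>?K. repE k x' = a' k" using exists_expr[OF K] A_set_carrier[OF a'] by blast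
    show "(b \<otimes>\<^bsub>B_alg t\<^esub> b') (\<lambda>n. a n + a' n) = (b \<otimes>\<^bsub>B_alg t\<^esub> b') a + (b \<otimes>\<^bsub>B_alg t\<^esub> b') a'"
      using eq[OF A_set_add[OF a a'], of "x \<boxplus> x'"] eq[OF a x] eq[OF a' x'] x x' by simp
  next
    fix k and x :: "complex mat" assume k: "k \<notin> ?K" "x \<in> carrier_mat (Suc k) (Suc k)"
    \<comment> \<open>The component vanishes on all blocks in \<open>?K\<close>, so the expression
      \<open>EZero\<close> is an admissible lift.\<close>
    have "(b \<otimes>\<^bsub>B_alg t\<^esub> b') (component k x) = csum EZero (\<lambda>p r. hat b' p * hat b r)"
      using k by (intro eq) (auto simp: component_index)
    then show "(b \<otimes>\<^bsub>B_alg t\<^esub> b') (component k x) = 0" by simp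
  qed
qed

text \<open>The family \<pi>_n(x) is truncated to the blocks relevant to either side; x is then a
  lift of the truncation and \<open>B_mult_eq\<close> applies.\<close>

lemma hat_mult:
  assumes b: "b \<in> B_set" "b' \<in> B_set"
  shows "hat (b \<otimes>\<^bsub>B_alg t\<^esub> b') x = csum x (\<lambda>p r. hat b' p * hat b r)"
proof -
  let ?K = "mult_spins (blocks b') (blocks b) \<union> blocks (b \<otimes>\<^bsub>B_alg t\<^esub> b')"
  have K: "finite ?K" using b B_mult_closed[OF b] by (simp add: finite_mult_spins B_set_blocks)
  obtain a where a: "a \<in> A_set" "\<forall>k\<in>?K. a k = repE k x" using exists_A_set[OF K] by blast
  have "hat (b \<otimes>\<^bsub>B_alg t\<^esub> b') x = (b \<otimes>\<^bsub>B_alg t\<^esub> b') a"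
    using a by (intro hat_eq B_mult_closed b) auto
  also have "\<dots> = csum x (\<lambda>p r. hat b' p * hat b r)"
  proof (rule B_mult_eq[OF b a(1)])
    fix n m k assume "n \<in> blocks b'" "m \<in> blocks b" "k \<in> spins n m"
    then have "k \<in> ?K" by (auto simp: mult_spins_def)
    then show "repE k x = a k" using a(2) by simp
  qed
  finally show ?thesis .
qed

section \<open>The involution of B\<close>

lemma mat_adjoint_adjoint: "A \<in> carrier_mat (Suc n) (Suc n) \<Longrightarrow> mat_adjoint (mat_adjoint A) = (A :: complex mat)"
  by (rule op_alg_eqI[of _ n]) auto

text \<open>By \<open>repE_tau\<close> the matrix of S(x) in \<pi>_n is a function of that of x, so
  the description does not depend on the chosen lift.\<close>

lemma A_antipode_star:
  assumes "\<And>n. a n \<in> carrier_mat (Suc n) (Suc n)"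
  shows "A_antipode t (star MA a) = (\<lambda>n. tauM n (a n))"
proof
  fix n
  have S: "rep t n (uq_antipode t (cls R x)) = tauM n (mat_adjoint (repE n x))" for x
    using repE_tau[of n "EStar x"] by (simp only: uq_antipode_cls rep_cls repE_simps)
  show "A_antipode t (star MA a) n = tauM n (a n)"
    unfolding A_antipode_def
  proof (rule the_equality)
    obtain x where x: "repE n x = mat_adjoint (a n)"
      using exists_expr[of "{n}" "\<lambda>n. mat_adjoint (a n)"] assms by auto
    then show "\<exists>X\<in>carrier (uq t). rep t n X = star MA a n \<and> tauM n (a n) = rep t n (uq_antipode t X)"
      using mat_adjoint_adjoint[OF assms] by (intro bexI[of _ "cls R x"]) (auto simp: rep_cls S carrier_uq)
    fix y assume "\<exists>X\<in>carrier (uq t). rep t n X = star MA a n \<and> y = rep t n (uq_antipode t X)"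
    then show "y = tauM n (a n)" using mat_adjoint_adjoint[OF assms] by (auto simp: carrier_uq rep_cls S)
  qed
qed

lemma A_set_tauM: "a \<in> A_set \<Longrightarrow> (\<lambda>n. tauM n (a n)) \<in> A_set"
  by (rule A_setI[of _ "{n. a n \<noteq> 0\<^sub>m (Suc n) (Suc n)}"]) (auto simp: mem_A_set tauM_zero)

lemma B_star_eq: "a \<in> A_set \<Longrightarrow> star (B_alg t) b a = cnj (b (\<lambda>n. tauM n (a n)))"
  using A_antipode_star[of a, OF A_set_carrier[of a]] by (simp add: B_alg_def del: MA_simps(5))

lemma B_star_closed:
  assumes b: "b \<in> B_set"
  shows "star (B_alg t) b \<in> B_set"
proof (rule B_setI[OF _ _ _ B_set_blocks[OF b]])
  show "star (B_alg t) b \<in> extensional A_set" by (simp add: B_alg_def)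
  fix a c assume a: "a \<in> A_set"
  have "(\<lambda>n. tauM n (c \<cdot>\<^sub>m a n)) = (\<lambda>n. cnj c \<cdot>\<^sub>m tauM n (a n))"
    using tauM_smult[OF A_set_carrier[OF a]] by simp
  then show "star (B_alg t) b (\<lambda>n. c \<cdot>\<^sub>m a n) = c * star (B_alg t) b a"
    using a by (simp add: B_star_eq A_set_smult B_set_smult[OF b A_set_tauM])
next
  fix a a' assume a: "a \<in> A_set" "a' \<in> A_set"
  have "(\<lambda>n. tauM n (a n + a' n)) = (\<lambda>n. tauM n (a n) + tauM n (a' n))"
    using tauM_add[OF A_set_carrier[OF a(1)] A_set_carrier[OF a(2)]] by simp
  then show "star (B_alg t) b (\<lambda>n. a n + a' n) = star (B_alg t) b a + star (B_alg t) b a'"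
    using a by (simp add: B_star_eq A_set_add B_set_add[OF b A_set_tauM A_set_tauM])
next
  fix k and x :: "complex mat" assume k: "k \<notin> blocks b" "x \<in> carrier_mat (Suc k) (Suc k)"
  have "(\<lambda>n. tauM n (component k x n)) = component k (tauM k x)"
    by (auto simp: component_def fun_eq_iff tauM_zero)
  then show "star (B_alg t) b (component k x) = 0"
    using k by (auto simp: B_star_eq blocks_def)
qed

lemma hat_star:
  assumes b: "b \<in> B_set"
  shows "hat (star (B_alg t) b) x = cnj (hat b (tau x))"
proof -
  let ?K = "blocks b \<union> blocks (star (B_alg t) b)"
  have K: "finite ?K" using b B_star_closed[OF b] by (simp add: B_set_blocks)
  obtain a where a: "a \<in> A_set" "\<forall>k\<in>?K. a k = repE k x" using exists_A_set[OF K] by blast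
  have "hat (star (B_alg t) b) x = star (B_alg t) b a"
    using a by (intro hat_eq B_star_closed b) auto
  also have "\<dots> = cnj (b (\<lambda>n. tauM n (a n)))" using a by (simp add: B_star_eq)
  also have "b (\<lambda>n. tauM n (a n)) = hat b (tau x)"
    using a by (intro hat_eq[symmetric] b A_set_tauM) (auto simp: repE_tau)
  finally show ?thesis .
qed

section \<open>Linear structure, unit and the axioms of B\<close>

lemma B_linear_closed:
  "\<zero>\<^bsub>B_alg t\<^esub> \<in> B_set"
  "b \<in> B_set \<Longrightarrow> b' \<in> B_set \<Longrightarrow> b \<oplus>\<^bsub>B_alg t\<^esub> b' \<in> B_set"
  "b \<in> B_set \<Longrightarrow> c \<odot>\<^bsub>B_alg t\<^esub> b \<in> B_set"
proof -
  show "\<zero>\<^bsub>B_alg t\<^esub> \<in> B_set"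
    by (rule B_setI[of _ "{}"]) (auto simp: B_simps A_set_add A_set_smult)
  show "b \<oplus>\<^bsub>B_alg t\<^esub> b' \<in> B_set" if b: "b \<in> B_set" "b' \<in> B_set"
    by (rule B_setI[of _ "blocks b \<union> blocks b'"])
      (auto simp: B_simps A_set_add A_set_smult B_set_add[OF b(1)] B_set_add[OF b(2)] B_set_smult[OF b(1)]
        B_set_smult[OF b(2)] B_set_blocks b algebra_simps, auto simp: blocks_def)
  show "c \<odot>\<^bsub>B_alg t\<^esub> b \<in> B_set" if b: "b \<in> B_set"
    by (rule B_setI[of _ "blocks b"])
      (auto simp: B_simps A_set_add A_set_smult B_set_add[OF b] B_set_smult[OF b]
        B_set_blocks b algebra_simps, auto simp: blocks_def)
qed

lemma coordinate_in_B_set: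
  assumes "i \<le> n" "j \<le> n"
  shows "(\<lambda>a\<in>A_set. a n $$ (i, j)) \<in> B_set"
proof (rule B_setI[of _ "{n}"])
  fix a a' assume a: "a \<in> A_set" "a' \<in> A_set"
  then have "a n \<in> carrier_mat (Suc n) (Suc n)" "a' n \<in> carrier_mat (Suc n) (Suc n)"
    by (auto simp: A_set_carrier)
  then show "(\<lambda>a\<in>A_set. a n $$ (i, j)) (\<lambda>n. a n + a' n) =
      (\<lambda>a\<in>A_set. a n $$ (i, j)) a + (\<lambda>a\<in>A_set. a n $$ (i, j)) a'"
    using assms a by (simp add: A_set_add)
next
  fix a c assume a: "a \<in> A_set"
  then have "a n \<in> carrier_mat (Suc n) (Suc n)" by (auto simp: A_set_carrier)
  then show "(\<lambda>a\<in>A_set. a n $$ (i, j)) (\<lambda>n. c \<cdot>\<^sub>m a n) = c * (\<lambda>a\<in>A_set. a n $$ (i, j)) a"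
    using assms a by (simp add: A_set_smult)
qed (use assms in \<open>auto simp: component_index\<close>)

lemma hat_coordinate:
  assumes "i \<le> n" "j \<le> n"
  shows "hat (\<lambda>a\<in>A_set. a n $$ (i, j)) x = repE n x $$ (i, j)"
proof -
  let ?b = "\<lambda>a\<in>A_set. a n $$ (i, j)"
  have K: "finite (blocks ?b \<union> {n})" using B_set_blocks[OF coordinate_in_B_set[OF assms]] by simp
  obtain a where a: "a \<in> A_set" "\<forall>k\<in>blocks ?b \<union> {n}. a k = repE k x"
    using exists_A_set[OF K] by blast
  then have "hat ?b x = ?b a" by (intro hat_eq coordinate_in_B_set assms) auto
  then show ?thesis using a by simp
qed

lemma B_one: "\<one>\<^bsub>B_alg t\<^esub> = (\<lambda>a\<in>A_set. a 0 $$ (0, 0))"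
  by (auto simp: B_simps A_counit_def)

lemma hat_linear:
  "hat \<zero>\<^bsub>B_alg t\<^esub> x = 0"
  "b \<in> B_set \<Longrightarrow> b' \<in> B_set \<Longrightarrow> hat (b \<oplus>\<^bsub>B_alg t\<^esub> b') x = hat b x + hat b' x"
  "b \<in> B_set \<Longrightarrow> hat (c \<odot>\<^bsub>B_alg t\<^esub> b) x = c * hat b x"
proof -
  have "blocks (\<lambda>a\<in>A_set. 0) = {}" by (auto simp: blocks_def)
  then show "hat \<zero>\<^bsub>B_alg t\<^esub> x = 0" by (simp add: hat_def pairingM_def B_simps)
  show "hat (b \<oplus>\<^bsub>B_alg t\<^esub> b') x = hat b x + hat b' x" if b: "b \<in> B_set" "b' \<in> B_set"
  proof -
    let ?K = "blocks b \<union> blocks b' \<union> blocks (b \<oplus>\<^bsub>B_alg t\<^esub> b')"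
    have K: "finite ?K" using b B_linear_closed(2)[OF b] by (simp add: B_set_blocks)
    obtain a where a: "a \<in> A_set" "\<forall>k\<in>?K. a k = repE k x" using exists_A_set[OF K] by blast
    have "hat (b \<oplus>\<^bsub>B_alg t\<^esub> b') x = (b \<oplus>\<^bsub>B_alg t\<^esub> b') a" "hat b x = b a" "hat b' x = b' a"
      using a by (auto intro!: hat_eq B_linear_closed b)
    then show ?thesis using a by (simp add: B_simps)
  qed
  show "hat (c \<odot>\<^bsub>B_alg t\<^esub> b) x = c * hat b x" if b: "b \<in> B_set"
  proof -
    let ?K = "blocks b \<union> blocks (c \<odot>\<^bsub>B_alg t\<^esub> b)"
    have K: "finite ?K" using b B_linear_closed(3)[OF b] by (simp add: B_set_blocks)
    obtain a where a: "a \<in> A_set" "\<forall>k\<in>?K. a k = repE k x" using exists_A_set[OF K] by blast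
    have "hat (c \<odot>\<^bsub>B_alg t\<^esub> b) x = (c \<odot>\<^bsub>B_alg t\<^esub> b) a" "hat b x = b a"
      using a by (auto intro!: hat_eq B_linear_closed b)
    then show ?thesis using a by (simp add: B_simps)
  qed
qed

text \<open>The one-dimensional representation \<pi>_0 is the counit of U: it sends e and f to 0 and
  q to 1.\<close>

lemma csum_counit:
  assumes "ulin \<phi>"
  shows "csum x (\<lambda>p r. \<phi> p * repE 0 r $$ (0, 0)) = \<phi> x"
    and "csum x (\<lambda>p r. repE 0 p $$ (0, 0) * \<phi> r) = \<phi> x"
proof -
  have mult: "(repE 0 x * repE 0 y) $$ (0, 0) = repE 0 x $$ (0, 0) * repE 0 y $$ (0, 0)" for x y
    using mult_mat_index[OF repE_carrier repE_carrier, of 0 0 0] by simp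
  have gens: "rep_e t 0 $$ (0, 0) = 0" "rep_f t 0 $$ (0, 0) = 0" "rep_q t 0 $$ (0, 0) = 1"
    "rep_qi 0 $$ (0, 0) = 1"
    by (simp_all add: rep_index qv_def weight_def)
  show "csum x (\<lambda>p r. \<phi> p * repE 0 r $$ (0, 0)) = \<phi> x"
    using assms
  proof (induction x arbitrary: \<phi>)
    case (Gen a)
    then show ?case by (cases a) (simp_all add: gens)
  next
    case (EMul x y)
    have "csum (x \<boxtimes> y) (\<lambda>p r. \<phi> p * repE 0 r $$ (0, 0)) =
      csum x (\<lambda>p r. csum y (\<lambda>p' r'. (\<phi> (p \<boxtimes> p') * repE 0 r' $$ (0, 0)) * repE 0 r $$ (0, 0)))"
      by (simp add: mult ac_simps del: index_mult_mat(1))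
    also have "\<dots> = csum x (\<lambda>p r. csum y (\<lambda>p' r'. \<phi> (p \<boxtimes> p') * repE 0 r' $$ (0, 0)) * repE 0 r $$ (0, 0))"
      by (simp only: comult_sum_mult_right)
    also have "\<dots> = csum x (\<lambda>p r. \<phi> (p \<boxtimes> y) * repE 0 r $$ (0, 0))"
      by (simp add: EMul.IH(2)[OF ulin_mult_left[OF EMul.prems]])
    also have "\<dots> = \<phi> (x \<boxtimes> y)" by (rule EMul.IH(1)[OF ulin_mult_right[OF EMul.prems]])
    finally show ?case .
  next
    case (EScale c x)
    then show ?case by (simp add: ulin_smult comult_sum_mult_left mult.assoc)
  next
    case (EStar x)
    have "csum (EStar x) (\<lambda>p r. \<phi> p * repE 0 r $$ (0, 0)) =
        cnj (csum x (\<lambda>p r. cnj (\<phi> (EStar p)) * repE 0 r $$ (0, 0)))"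
      by (simp flip: comult_sum_cnj)
    then show ?case using EStar.IH[OF ulin_star[OF EStar.prems]] by simp
  qed (simp_all add: ulin_zero ulin_add)
  show "csum x (\<lambda>p r. repE 0 p $$ (0, 0) * \<phi> r) = \<phi> x"
    using assms
  proof (induction x arbitrary: \<phi>)
    case (Gen a)
    then show ?case by (cases a) (simp_all add: gens)
  next
    case (EMul x y)
    have "csum (x \<boxtimes> y) (\<lambda>p r. repE 0 p $$ (0, 0) * \<phi> r) =
      csum x (\<lambda>p r. csum y (\<lambda>p' r'. repE 0 p $$ (0, 0) * (repE 0 p' $$ (0, 0) * \<phi> (r \<boxtimes> r'))))"
      by (simp add: mult ac_simps del: index_mult_mat(1))
    also have "\<dots> = csum x (\<lambda>p r. repE 0 p $$ (0, 0) * csum y (\<lambda>p' r'. repE 0 p' $$ (0, 0) * \<phi> (r \<boxtimes> r')))"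
      by (simp only: comult_sum_mult_left)
    also have "\<dots> = csum x (\<lambda>p r. repE 0 p $$ (0, 0) * \<phi> (r \<boxtimes> y))"
      by (simp add: EMul.IH(2)[OF ulin_mult_left[OF EMul.prems]])
    also have "\<dots> = \<phi> (x \<boxtimes> y)" by (rule EMul.IH(1)[OF ulin_mult_right[OF EMul.prems]])
    finally show ?case .
  next
    case (EScale c x)
    then show ?case by (simp add: ulin_smult comult_sum_mult_left mult.assoc)
  next
    case (EStar x)
    have "csum (EStar x) (\<lambda>p r. repE 0 p $$ (0, 0) * \<phi> r) =
        cnj (csum x (\<lambda>p r. repE 0 p $$ (0, 0) * cnj (\<phi> (EStar r))))"
      by (simp flip: comult_sum_cnj)
    then show ?case using EStar.IH[OF ulin_star[OF EStar.prems]] by simp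
  qed (simp_all add: ulin_zero ulin_add)
qed

lemma hat_one: "hat \<one>\<^bsub>B_alg t\<^esub> x = repE 0 x $$ (0, 0)"
  unfolding B_one by (rule hat_coordinate) auto

lemma B_one_closed: "\<one>\<^bsub>B_alg t\<^esub> \<in> B_set"
  unfolding B_one by (rule coordinate_in_B_set) auto

text \<open>All axioms are compared after \<open>hat\<close>. Associativity becomes
  \<open>csum_coassoc\<close>, the unit laws \<open>csum_counit\<close>, reversal of products under
  star \<open>csum_tau\<close>, and star is involutive because \<open>tauM\<close> is.\<close>

lemma staralg_B: "staralg (B_alg t)"
proof -
  note closed = B_linear_closed B_mult_closed B_star_closed B_one_closed
  note hats = hat_linear hat_mult hat_star hat_one
  have assoc: "hat ((b \<otimes>\<^bsub>B_alg t\<^esub> b') \<otimes>\<^bsub>B_alg t\<^esub> b'') x = hat (b \<otimes>\<^bsub>B_alg t\<^esub> (b' \<otimes>\<^bsub>B_alg t\<^esub> b'')) x"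
    if "b \<in> B_set" "b' \<in> B_set" "b'' \<in> B_set" for b b' b'' x
  proof -
    have "hat ((b \<otimes>\<^bsub>B_alg t\<^esub> b') \<otimes>\<^bsub>B_alg t\<^esub> b'') x =
        csum x (\<lambda>p r. csum r (\<lambda>p' r'. hat b'' p * hat b' p' * hat b r'))"
      using that by (simp add: hats closed comult_sum_mult_left mult.assoc)
    also have "\<dots> = csum x (\<lambda>p r. csum p (\<lambda>p' r'. hat b'' p' * hat b' r' * hat b r))"
      by (rule csum_coassoc[symmetric])
    also have "\<dots> = hat (b \<otimes>\<^bsub>B_alg t\<^esub> (b' \<otimes>\<^bsub>B_alg t\<^esub> b'')) x"
      using that by (simp add: hats closed comult_sum_mult_right)
    finally show ?thesis .
  qed
  have star_mult: "hat (star (B_alg t) (b \<otimes>\<^bsub>B_alg t\<^esub> b')) x =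
      hat (star (B_alg t) b' \<otimes>\<^bsub>B_alg t\<^esub> star (B_alg t) b) x" if "b \<in> B_set" "b' \<in> B_set" for b b' x
    using that by (simp add: hats closed csum_tau ulin_hat mult.commute flip: comult_sum_cnj)
  have star_star: "hat (star (B_alg t) (star (B_alg t) b)) x = hat b x" if "b \<in> B_set" for b x
    using that by (simp add: hats closed) (rule hat_cong, simp add: repE_tau tauM_tauM)
  have unit: "hat (\<one>\<^bsub>B_alg t\<^esub> \<otimes>\<^bsub>B_alg t\<^esub> b) x = hat b x" "hat (b \<otimes>\<^bsub>B_alg t\<^esub> \<one>\<^bsub>B_alg t\<^esub>) x = hat b x"
    if "b \<in> B_set" for b x
    using that by (simp_all add: hat_mult closed hat_one csum_counit ulin_hat)
  show ?thesis
    by (unfold_locales; unfold B_simps(1))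
      (auto intro!: closed B_set_eqI assoc star_mult star_star unit
        simp: hats closed comult_sum_add comult_sum_mult_left algebra_simps)
qed

end


section \<open>Woronowicz's quantum SU(2)\<close>

text \<open>Interpreted in SU_\<nu>(2) itself, in its tensor square for \<Delta>, in the complex
  numbers for the counit and in B for \<theta>.\<close>

locale su_alg = staralg V for V :: "'a star_alg" (structure) +
  fixes \<nu> :: real and \<alpha> \<gamma> :: 'a
  assumes su_gens_closed [simp, intro]: "\<alpha> \<in> carrier V" "\<gamma> \<in> carrier V"
    and su_rel1: "star V \<alpha> \<otimes> \<alpha> \<oplus> star V \<gamma> \<otimes> \<gamma> = \<one>"
    and su_rel2: "\<alpha> \<otimes> star V \<alpha> \<oplus> (complex_of_real \<nu>)\<^sup>2 \<odot> (\<gamma> \<otimes> star V \<gamma>) = \<one>"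
    and su_rel3: "\<gamma> \<otimes> star V \<gamma> = star V \<gamma> \<otimes> \<gamma>"
    and su_rel4: "\<alpha> \<otimes> \<gamma> = complex_of_real \<nu> \<odot> (\<gamma> \<otimes> \<alpha>)"
    and su_rel5: "\<alpha> \<otimes> star V \<gamma> = complex_of_real \<nu> \<odot> (star V \<gamma> \<otimes> \<alpha>)"
begin

lemma interp_su_relations:
  assumes "(x, y) \<in> su_relations \<nu>"
  shows "interp V (case_su_gen \<alpha> \<gamma>) x = interp V (case_su_gen \<alpha> \<gamma>) y"
  using assms su_rel1 su_rel2 su_rel3 su_rel4 su_rel5 by (auto simp: su_relations_def Let_def)

lemma case_su_gens_closed [simp]: "case_su_gen \<alpha> \<gamma> a \<in> carrier V"
  by (cases a) auto

lemma lift_su: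
  "lift (su_relations \<nu>) V (case_su_gen \<alpha> \<gamma>) (cls (su_relations \<nu>) x) = interp V (case_su_gen \<alpha> \<gamma>) x"
  by (rule lift_cls[OF case_su_gens_closed interp_su_relations])

lemma lift_su_star_homs: "lift (su_relations \<nu>) V (case_su_gen \<alpha> \<gamma>) \<in> star_homs (su \<nu>) V"
  unfolding su_def by (rule lift_star_homs[OF case_su_gens_closed interp_su_relations])

lemma the_su_star_hom:
  "(THE h. h \<in> star_homs (su \<nu>) V \<inter> extensional (carrier (su \<nu>)) \<and>
      h (su_alpha \<nu>) = \<alpha> \<and> h (su_gamma \<nu>) = \<gamma>) = lift (su_relations \<nu>) V (case_su_gen \<alpha> \<gamma>)"
proof (rule the_equality)
  show "lift (su_relations \<nu>) V (case_su_gen \<alpha> \<gamma>) \<in> star_homs (su \<nu>) V \<inter> extensional (carrier (su \<nu>)) \<and>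
      lift (su_relations \<nu>) V (case_su_gen \<alpha> \<gamma>) (su_alpha \<nu>) = \<alpha> \<and>
      lift (su_relations \<nu>) V (case_su_gen \<alpha> \<gamma>) (su_gamma \<nu>) = \<gamma>"
    using lift_su_star_homs lift_extensional
    by (auto simp: su_def su_alpha_def su_gamma_def gen_eq_cls lift_su)
  fix h assume h: "h \<in> star_homs (su \<nu>) V \<inter> extensional (carrier (su \<nu>)) \<and>
      h (su_alpha \<nu>) = \<alpha> \<and> h (su_gamma \<nu>) = \<gamma>"
  show "h = lift (su_relations \<nu>) V (case_su_gen \<alpha> \<gamma>)"
  proof (rule star_hom_eqI)
    show "h (cls (su_relations \<nu>) (Gen a)) =
        lift (su_relations \<nu>) V (case_su_gen \<alpha> \<gamma>) (cls (su_relations \<nu>) (Gen a))" for a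
      using h by (cases a) (simp_all add: lift_su su_alpha_def su_gamma_def gen_eq_cls)
  qed (use h lift_su_star_homs lift_extensional in \<open>auto simp: su_def\<close>)
qed

lemma star_gamma_star_alpha: "star V \<gamma> \<otimes> star V \<alpha> = complex_of_real \<nu> \<odot> (star V \<alpha> \<otimes> star V \<gamma>)"
proof -
  have "star V (\<alpha> \<otimes> \<gamma>) = star V (complex_of_real \<nu> \<odot> (\<gamma> \<otimes> \<alpha>))" by (simp only: su_rel4)
  then show ?thesis by (simp add: star_mult star_smult)
qed

lemma gamma_star_alpha: "\<gamma> \<otimes> star V \<alpha> = complex_of_real \<nu> \<odot> (star V \<alpha> \<otimes> \<gamma>)"
proof -
  have "star V (\<alpha> \<otimes> star V \<gamma>) = star V (complex_of_real \<nu> \<odot> (star V \<gamma> \<otimes> \<alpha>))" by (simp only: su_rel5)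
  then show ?thesis by (simp add: star_mult star_smult)
qed

end

lemma su_alg_su: "su_alg (su \<nu>) \<nu> (su_alpha \<nu>) (su_gamma \<nu>)"
proof -
  have "su_alg_axioms (presented (su_relations \<nu>)) \<nu> (su_alpha \<nu>) (su_gamma \<nu>)"
    unfolding gen_eq_cls su_alpha_def su_gamma_def
    by unfold_locales (auto simp: cls_eq_iff su_relations_def Let_def intro: expr_eq.rel)
  then show ?thesis using staralg_presented by (simp add: su_alg_def su_def)
qed

lemma (in staralg) smult_cancel_neg:
  assumes "x \<in> carrier V" shows "(- c) \<odot> x \<oplus> c \<odot> x = \<zero>" "c \<odot> x \<oplus> (- c) \<odot> x = \<zero>"
  using add_smult[of x "- c" c] add_smult[of x c "- c"] assms by simp_all

lemma (in staralg) add_eq_diff: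
  assumes "x \<in> carrier V" "y \<in> carrier V" "x \<oplus> c \<odot> y = z"
  shows "x = z \<oplus> (- c) \<odot> y"
  using assms by (simp add: a_assoc smult_cancel_neg flip: assms(3))

section \<open>Coproduct and counit of SU_\<nu>(2)\<close>

context su_alg
begin

text \<open>With \<Delta>(\<alpha>) = A + B and \<Delta>(\<gamma>) = C + D each relation expands
  into products of these summands and their adjoints. The products are grouped so that a relation of
  V applies in one leg of each group.\<close>

lemma su_alg_tensor:
  "su_alg (tensor_alg V V) \<nu>
    (tensor V V \<alpha> \<alpha> \<oplus>\<^sub>2 (- complex_of_real \<nu>) \<odot>\<^sub>2 tensor V V (star V \<gamma>) \<gamma>)
    (tensor V V \<gamma> \<alpha> \<oplus>\<^sub>2 tensor V V (star V \<alpha>) \<gamma>)"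
proof -
  interpret P: tensor_pair V V by unfold_locales
  let ?T = "tensor_alg V V"
  interpret T: staralg ?T by (rule P.staralg_tensor)
  note [simp] = P.tensor_closed P.tensor_mult1 P.tensor_one1 P.tensor_star1
  define v where "v = complex_of_real \<nu>"
  define \<alpha>' where "\<alpha>' = star V \<alpha>"
  define \<gamma>' where "\<gamma>' = star V \<gamma>"
  have [simp]: "cnj v = v" "\<alpha>' \<in> carrier V" "\<gamma>' \<in> carrier V" "star V \<alpha> = \<alpha>'" "star V \<gamma> = \<gamma>'"
      "star V \<alpha>' = \<alpha>" "star V \<gamma>' = \<gamma>"
    by (simp_all add: v_def \<alpha>'_def \<gamma>'_def)
  note rels = su_rel1 su_rel2 su_rel3 su_rel4 su_rel5 star_gamma_star_alpha gamma_star_alpha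
  note r = rels[folded v_def \<alpha>'_def \<gamma>'_def]
  have x: "\<alpha>' \<otimes> \<alpha> = \<one> \<oplus> (- 1) \<odot> (\<gamma>' \<otimes> \<gamma>)"
    using add_eq_diff[of "\<alpha>' \<otimes> \<alpha>" "\<gamma>' \<otimes> \<gamma>" 1] r(1) by simp
  have y: "\<alpha> \<otimes> \<alpha>' = \<one> \<oplus> (- v\<^sup>2) \<odot> (\<gamma>' \<otimes> \<gamma>)"
    using add_eq_diff[of "\<alpha> \<otimes> \<alpha>'" "\<gamma>' \<otimes> \<gamma>" "v\<^sup>2"] r(2,3) by simp
  \<comment> \<open>Both sides equal 1 - (1 + v^2) \<gamma>'\<gamma>. This settles the mixed terms
    in the last two relations.\<close>
  have xy: "\<alpha> \<otimes> \<alpha>' \<oplus> (- 1) \<odot> (\<gamma>' \<otimes> \<gamma>) = \<alpha>' \<otimes> \<alpha> \<oplus> (- v\<^sup>2) \<odot> (\<gamma>' \<otimes> \<gamma>)"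
    unfolding x y by (simp add: a_ac)
  define A where "A = tensor V V \<alpha> \<alpha>"
  define B where "B = (- v) \<odot>\<^sub>2 tensor V V \<gamma>' \<gamma>"
  define C where "C = tensor V V \<gamma> \<alpha>"
  define D where "D = tensor V V \<alpha>' \<gamma>"
  define A' where "A' = tensor V V \<alpha>' \<alpha>'"
  define B' where "B' = (- v) \<odot>\<^sub>2 tensor V V \<gamma> \<gamma>'"
  define C' where "C' = tensor V V \<gamma>' \<alpha>'"
  define D' where "D' = tensor V V \<alpha> \<gamma>'"
  note defs = A_def B_def C_def D_def A'_def B'_def C'_def D'_def
  have cl [simp]: "A \<in> carrier ?T" "B \<in> carrier ?T" "C \<in> carrier ?T" "D \<in> carrier ?T"
    "A' \<in> carrier ?T" "B' \<in> carrier ?T" "C' \<in> carrier ?T" "D' \<in> carrier ?T"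
    by (simp_all add: defs)
  have star1: "star ?T (A \<oplus>\<^sub>2 B) = A' \<oplus>\<^sub>2 B'" and star2: "star ?T (C \<oplus>\<^sub>2 D) = C' \<oplus>\<^sub>2 D'"
    by (simp_all add: defs T.star_add T.star_smult)
  have rel1: "(A' \<oplus>\<^sub>2 B') \<otimes>\<^sub>2 (A \<oplus>\<^sub>2 B) \<oplus>\<^sub>2 (C' \<oplus>\<^sub>2 D') \<otimes>\<^sub>2 (C \<oplus>\<^sub>2 D) = \<one>\<^bsub>?T\<^esub>"
  proof -
    have "A' \<otimes>\<^sub>2 A \<oplus>\<^sub>2 C' \<otimes>\<^sub>2 C = tensor V V (\<alpha>' \<otimes> \<alpha> \<oplus> \<gamma>' \<otimes> \<gamma>) (\<alpha>' \<otimes> \<alpha>)"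
      by (simp add: defs P.tensor_add_left)
    then have 1: "A' \<otimes>\<^sub>2 A \<oplus>\<^sub>2 C' \<otimes>\<^sub>2 C = tensor V V \<one> (\<alpha>' \<otimes> \<alpha>)" by (simp add: r)
    have "B' \<otimes>\<^sub>2 B \<oplus>\<^sub>2 D' \<otimes>\<^sub>2 D = tensor V V (\<alpha> \<otimes> \<alpha>' \<oplus> v\<^sup>2 \<odot> (\<gamma> \<otimes> \<gamma>')) (\<gamma>' \<otimes> \<gamma>)"
      by (simp add: defs P.tensor_bilinear T.smult_l T.smult_r T.a_comm power2_eq_square)
    then have 2: "B' \<otimes>\<^sub>2 B \<oplus>\<^sub>2 D' \<otimes>\<^sub>2 D = tensor V V \<one> (\<gamma>' \<otimes> \<gamma>)" by (simp only: r(2))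
    have 3: "A' \<otimes>\<^sub>2 B \<oplus>\<^sub>2 C' \<otimes>\<^sub>2 D = \<zero>\<^bsub>?T\<^esub>"
      by (simp add: defs r P.tensor_bilinear T.smult_l T.smult_r T.smult_cancel_neg)
    have 4: "B' \<otimes>\<^sub>2 A \<oplus>\<^sub>2 D' \<otimes>\<^sub>2 C = \<zero>\<^bsub>?T\<^esub>"
      by (simp add: defs r P.tensor_bilinear T.smult_l T.smult_r T.smult_cancel_neg)
    have "(A' \<oplus>\<^sub>2 B') \<otimes>\<^sub>2 (A \<oplus>\<^sub>2 B) \<oplus>\<^sub>2 (C' \<oplus>\<^sub>2 D') \<otimes>\<^sub>2 (C \<oplus>\<^sub>2 D) =
      (A' \<otimes>\<^sub>2 A \<oplus>\<^sub>2 C' \<otimes>\<^sub>2 C) \<oplus>\<^sub>2 (B' \<otimes>\<^sub>2 B \<oplus>\<^sub>2 D' \<otimes>\<^sub>2 D) \<oplus>\<^sub>2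
      ((A' \<otimes>\<^sub>2 B \<oplus>\<^sub>2 C' \<otimes>\<^sub>2 D) \<oplus>\<^sub>2 (B' \<otimes>\<^sub>2 A \<oplus>\<^sub>2 D' \<otimes>\<^sub>2 C))"
      by (simp add: T.l_distr T.r_distr T.a_ac)
    also have "\<dots> = tensor V V \<one> (\<alpha>' \<otimes> \<alpha> \<oplus> \<gamma>' \<otimes> \<gamma>)"
      unfolding 1 2 3 4 by (simp add: P.tensor_add_right)
    finally show ?thesis by (simp add: r(1,2))
  qed
  have rel2: "(A \<oplus>\<^sub>2 B) \<otimes>\<^sub>2 (A' \<oplus>\<^sub>2 B') \<oplus>\<^sub>2
      v\<^sup>2 \<odot>\<^sub>2 ((C \<oplus>\<^sub>2 D) \<otimes>\<^sub>2 (C' \<oplus>\<^sub>2 D')) = \<one>\<^bsub>?T\<^esub>"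
  proof -
    have "A \<otimes>\<^sub>2 A' \<oplus>\<^sub>2 v\<^sup>2 \<odot>\<^sub>2 (C \<otimes>\<^sub>2 C') = tensor V V (\<alpha> \<otimes> \<alpha>' \<oplus> v\<^sup>2 \<odot> (\<gamma> \<otimes> \<gamma>')) (\<alpha> \<otimes> \<alpha>')"
      by (simp add: defs P.tensor_bilinear)
    then have 1: "A \<otimes>\<^sub>2 A' \<oplus>\<^sub>2 v\<^sup>2 \<odot>\<^sub>2 (C \<otimes>\<^sub>2 C') = tensor V V \<one> (\<alpha> \<otimes> \<alpha>')" by (simp only: r(2))
    have "B \<otimes>\<^sub>2 B' \<oplus>\<^sub>2 v\<^sup>2 \<odot>\<^sub>2 (D \<otimes>\<^sub>2 D') = v\<^sup>2 \<odot>\<^sub>2 tensor V V (\<alpha>' \<otimes> \<alpha> \<oplus> \<gamma>' \<otimes> \<gamma>) (\<gamma> \<otimes> \<gamma>')"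
      by (simp add: defs P.tensor_bilinear T.smult_l T.smult_r T.smult_add T.a_comm power2_eq_square)
    then have 2: "B \<otimes>\<^sub>2 B' \<oplus>\<^sub>2 v\<^sup>2 \<odot>\<^sub>2 (D \<otimes>\<^sub>2 D') = v\<^sup>2 \<odot>\<^sub>2 tensor V V \<one> (\<gamma> \<otimes> \<gamma>')"
      by (simp only: r(1))
    have 3: "A \<otimes>\<^sub>2 B' \<oplus>\<^sub>2 v\<^sup>2 \<odot>\<^sub>2 (C \<otimes>\<^sub>2 D') = \<zero>\<^bsub>?T\<^esub>"
      by (simp add: defs r P.tensor_bilinear T.smult_l T.smult_r T.smult_cancel_neg power2_eq_square mult.assoc)
    have 4: "B \<otimes>\<^sub>2 A' \<oplus>\<^sub>2 v\<^sup>2 \<odot>\<^sub>2 (D \<otimes>\<^sub>2 C') = \<zero>\<^bsub>?T\<^esub>"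
      by (simp add: defs r P.tensor_bilinear T.smult_l T.smult_r T.smult_cancel_neg power2_eq_square mult.assoc)
    have "(A \<oplus>\<^sub>2 B) \<otimes>\<^sub>2 (A' \<oplus>\<^sub>2 B') \<oplus>\<^sub>2 v\<^sup>2 \<odot>\<^sub>2 ((C \<oplus>\<^sub>2 D) \<otimes>\<^sub>2 (C' \<oplus>\<^sub>2 D')) =
      (A \<otimes>\<^sub>2 A' \<oplus>\<^sub>2 v\<^sup>2 \<odot>\<^sub>2 (C \<otimes>\<^sub>2 C')) \<oplus>\<^sub>2 (B \<otimes>\<^sub>2 B' \<oplus>\<^sub>2 v\<^sup>2 \<odot>\<^sub>2 (D \<otimes>\<^sub>2 D')) \<oplus>\<^sub>2
      ((A \<otimes>\<^sub>2 B' \<oplus>\<^sub>2 v\<^sup>2 \<odot>\<^sub>2 (C \<otimes>\<^sub>2 D')) \<oplus>\<^sub>2 (B \<otimes>\<^sub>2 A' \<oplus>\<^sub>2 v\<^sup>2 \<odot>\<^sub>2 (D \<otimes>\<^sub>2 C')))"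
      by (simp add: T.l_distr T.r_distr T.smult_add T.a_ac)
    also have "\<dots> = tensor V V \<one> (\<alpha> \<otimes> \<alpha>' \<oplus> v\<^sup>2 \<odot> (\<gamma> \<otimes> \<gamma>'))"
      unfolding 1 2 3 4 by (simp add: P.tensor_bilinear)
    finally show ?thesis by (simp add: r(1,2))
  qed
  have rel3: "(C \<oplus>\<^sub>2 D) \<otimes>\<^sub>2 (C' \<oplus>\<^sub>2 D') = (C' \<oplus>\<^sub>2 D') \<otimes>\<^sub>2 (C \<oplus>\<^sub>2 D)"
  proof -
    have 1: "C \<otimes>\<^sub>2 D' = D' \<otimes>\<^sub>2 C" "D \<otimes>\<^sub>2 C' = C' \<otimes>\<^sub>2 D"
      by (simp_all add: defs r P.tensor_bilinear)
    have 2: "C \<otimes>\<^sub>2 C' \<oplus>\<^sub>2 D \<otimes>\<^sub>2 D' = C' \<otimes>\<^sub>2 C \<oplus>\<^sub>2 D' \<otimes>\<^sub>2 D"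
      by (simp add: defs r(3) x y P.tensor_bilinear T.a_ac)
    have "(C \<oplus>\<^sub>2 D) \<otimes>\<^sub>2 (C' \<oplus>\<^sub>2 D') =
        (C \<otimes>\<^sub>2 C' \<oplus>\<^sub>2 D \<otimes>\<^sub>2 D') \<oplus>\<^sub>2 (C \<otimes>\<^sub>2 D' \<oplus>\<^sub>2 D \<otimes>\<^sub>2 C')"
      by (simp add: T.l_distr T.r_distr T.a_ac)
    also have "\<dots> = (C' \<oplus>\<^sub>2 D') \<otimes>\<^sub>2 (C \<oplus>\<^sub>2 D)"
      unfolding 1 2 by (simp add: T.l_distr T.r_distr T.a_ac)
    finally show ?thesis .
  qed
  have rel4: "(A \<oplus>\<^sub>2 B) \<otimes>\<^sub>2 (C \<oplus>\<^sub>2 D) = v \<odot>\<^sub>2 ((C \<oplus>\<^sub>2 D) \<otimes>\<^sub>2 (A \<oplus>\<^sub>2 B))"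
  proof -
    have 1: "A \<otimes>\<^sub>2 C = v \<odot>\<^sub>2 (C \<otimes>\<^sub>2 A)" "B \<otimes>\<^sub>2 D = v \<odot>\<^sub>2 (D \<otimes>\<^sub>2 B)"
      by (simp_all add: defs r P.tensor_bilinear T.smult_l T.smult_r)
    have "A \<otimes>\<^sub>2 D \<oplus>\<^sub>2 B \<otimes>\<^sub>2 C = v \<odot>\<^sub>2 tensor V V (\<alpha> \<otimes> \<alpha>' \<oplus> (- 1) \<odot> (\<gamma>' \<otimes> \<gamma>)) (\<gamma> \<otimes> \<alpha>)"
      by (simp add: defs r(4) P.tensor_bilinear T.smult_l T.smult_r T.smult_add)
    also have "\<dots> = v \<odot>\<^sub>2 (C \<otimes>\<^sub>2 B \<oplus>\<^sub>2 D \<otimes>\<^sub>2 A)"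
      unfolding xy by (simp add: defs r(3,4) P.tensor_bilinear T.smult_l T.smult_r T.smult_add T.a_comm power2_eq_square)
    finally have 2: "A \<otimes>\<^sub>2 D \<oplus>\<^sub>2 B \<otimes>\<^sub>2 C = v \<odot>\<^sub>2 (C \<otimes>\<^sub>2 B \<oplus>\<^sub>2 D \<otimes>\<^sub>2 A)" .
    have "(A \<oplus>\<^sub>2 B) \<otimes>\<^sub>2 (C \<oplus>\<^sub>2 D) = A \<otimes>\<^sub>2 C \<oplus>\<^sub>2 B \<otimes>\<^sub>2 D \<oplus>\<^sub>2 (A \<otimes>\<^sub>2 D \<oplus>\<^sub>2 B \<otimes>\<^sub>2 C)"
      by (simp add: T.l_distr T.r_distr T.a_ac)
    also have "\<dots> = v \<odot>\<^sub>2 ((C \<oplus>\<^sub>2 D) \<otimes>\<^sub>2 (A \<oplus>\<^sub>2 B))"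
      unfolding 1 2 by (simp add: T.l_distr T.r_distr T.smult_add T.a_ac)
    finally show ?thesis .
  qed
  have rel5: "(A \<oplus>\<^sub>2 B) \<otimes>\<^sub>2 (C' \<oplus>\<^sub>2 D') = v \<odot>\<^sub>2 ((C' \<oplus>\<^sub>2 D') \<otimes>\<^sub>2 (A \<oplus>\<^sub>2 B))"
  proof -
    have 1: "A \<otimes>\<^sub>2 D' = v \<odot>\<^sub>2 (D' \<otimes>\<^sub>2 A)" "B \<otimes>\<^sub>2 C' = v \<odot>\<^sub>2 (C' \<otimes>\<^sub>2 B)"
      by (simp_all add: defs r P.tensor_bilinear T.smult_l T.smult_r)
    have "A \<otimes>\<^sub>2 C' \<oplus>\<^sub>2 B \<otimes>\<^sub>2 D' = v \<odot>\<^sub>2 tensor V V (\<gamma>' \<otimes> \<alpha>) (\<alpha> \<otimes> \<alpha>' \<oplus> (- 1) \<odot> (\<gamma>' \<otimes> \<gamma>))"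
      by (simp add: defs r(3,5) P.tensor_bilinear T.smult_l T.smult_r T.smult_add)
    also have "\<dots> = v \<odot>\<^sub>2 (C' \<otimes>\<^sub>2 A \<oplus>\<^sub>2 D' \<otimes>\<^sub>2 B)"
      unfolding xy by (simp add: defs r(5) P.tensor_bilinear T.smult_l T.smult_r T.smult_add power2_eq_square)
    finally have 2: "A \<otimes>\<^sub>2 C' \<oplus>\<^sub>2 B \<otimes>\<^sub>2 D' = v \<odot>\<^sub>2 (C' \<otimes>\<^sub>2 A \<oplus>\<^sub>2 D' \<otimes>\<^sub>2 B)" .
    have "(A \<oplus>\<^sub>2 B) \<otimes>\<^sub>2 (C' \<oplus>\<^sub>2 D') = A \<otimes>\<^sub>2 D' \<oplus>\<^sub>2 B \<otimes>\<^sub>2 C' \<oplus>\<^sub>2 (A \<otimes>\<^sub>2 C' \<oplus>\<^sub>2 B \<otimes>\<^sub>2 D')"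
      by (simp add: T.l_distr T.r_distr T.a_ac)
    also have "\<dots> = v \<odot>\<^sub>2 ((C' \<oplus>\<^sub>2 D') \<otimes>\<^sub>2 (A \<oplus>\<^sub>2 B))"
      unfolding 1 2 by (simp add: T.l_distr T.r_distr T.smult_add T.a_ac)
    finally show ?thesis .
  qed
  have "su_alg ?T \<nu> (A \<oplus>\<^sub>2 B) (C \<oplus>\<^sub>2 D)"
    by (unfold_locales; (unfold star1 star2 v_def[symmetric])?;
      (rule rel1 rel2 rel3 rel4 rel5 | intro cl T.add_closed))
  then show ?thesis by (simp add: A_def B_def C_def D_def v_def)
qed

end

definition su_delta :: "real \<Rightarrow> su_gen \<Rightarrow> (su_gen expr \<times> su_gen expr) list" where
  "su_delta \<nu> a = (case a of
      Galpha \<Rightarrow> [(Gen Galpha, Gen Galpha), ((- complex_of_real \<nu>) \<boxdot> EStar (Gen Ggamma), Gen Ggamma)]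
    | Ggamma \<Rightarrow> [(Gen Ggamma, Gen Galpha), (EStar (Gen Galpha), Gen Ggamma)])"

lemma su_comult_cls:
  "su_comult \<nu> (cls (su_relations \<nu>) x) = tcls (su \<nu>) (su \<nu>)
    (map (map_prod (cls (su_relations \<nu>)) (cls (su_relations \<nu>))) (expr_comult (su_delta \<nu>) x))"
proof -
  let ?P = "su \<nu>" and ?c = "map_prod (cls (su_relations \<nu>)) (cls (su_relations \<nu>))"
  interpret P: su_alg ?P \<nu> "su_alpha \<nu>" "su_gamma \<nu>" by (rule su_alg_su)
  interpret PP: tensor_pair ?P ?P by unfold_locales
  note T = P.su_alg_tensor
  let ?g = "case_su_gen
    (tensor ?P ?P (su_alpha \<nu>) (su_alpha \<nu>) \<oplus>\<^bsub>tensor_alg ?P ?P\<^esub>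
      (- complex_of_real \<nu>) \<odot>\<^bsub>tensor_alg ?P ?P\<^esub> tensor ?P ?P (star ?P (su_gamma \<nu>)) (su_gamma \<nu>))
    (tensor ?P ?P (su_gamma \<nu>) (su_alpha \<nu>) \<oplus>\<^bsub>tensor_alg ?P ?P\<^esub> tensor ?P ?P (star ?P (su_alpha \<nu>)) (su_gamma \<nu>))"
  have "su_comult \<nu> (cls (su_relations \<nu>) x) = interp (tensor_alg ?P ?P) ?g x"
    unfolding su_comult_def Let_def su_alg.the_su_star_hom[OF T] by (rule su_alg.lift_su[OF T])
  also have "?g = (\<lambda>a. tcls ?P ?P (map ?c (su_delta \<nu> a)))"
  proof
    fix a
    have "star ?P (su_gamma \<nu>) = cls (su_relations \<nu>) (EStar (Gen Ggamma))"
      "star ?P (su_alpha \<nu>) = cls (su_relations \<nu>) (EStar (Gen Galpha))"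
      "(- complex_of_real \<nu>) \<odot>\<^bsub>?P\<^esub> cls (su_relations \<nu>) (EStar (Gen Ggamma)) =
        cls (su_relations \<nu>) ((- complex_of_real \<nu>) \<boxdot> EStar (Gen Ggamma))"
      by (simp_all add: su_def su_gamma_def su_alpha_def gen_eq_cls)
    moreover have "cls (su_relations \<nu>) x \<in> carrier ?P" for x by (simp add: su_def)
    ultimately show "?g a = tcls ?P ?P (map ?c (su_delta \<nu> a))"
      by (cases a)
        (simp_all add: su_delta_def tensor_eq_tcls PP.tensor_add PP.tensor_smult su_alpha_def su_gamma_def gen_eq_cls)
  qed
  also have "interp (tensor_alg ?P ?P) \<dots> x = tcls ?P ?P (map ?c (expr_comult (su_delta \<nu>) x))"
    using interp_tensor_presented[of "su_relations \<nu>" "su_delta \<nu>" x] by (simp add: su_def)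
  finally show ?thesis .
qed

lemma su_counit_cls:
  "su_counit \<nu> (cls (su_relations \<nu>) x) = interp complex_alg (case_su_gen 1 0) x"
proof -
  interpret staralg complex_alg by (rule staralg_complex_alg)
  have C: "su_alg complex_alg \<nu> 1 0"
    by unfold_locales (simp_all add: complex_alg_def)
  show ?thesis
    unfolding su_counit_def su_alg.the_su_star_hom[OF C] by (rule su_alg.lift_su[OF C])
qed

section \<open>The invariant vector and the relations in B\<close>

section \<open>The homomorphism into B\<close>

context quantum
begin

text \<open>Indices count down from the highest weight, so (0, Suc 0) stands for \<xi>_1 \<otimes>
  \<xi>_2. The coefficient c at (Suc 0, 0) is dictated by e: \<lambda>^(1/2) + c \<lambda>^(-1/2) =
  0.\<close>

definition sing :: "nat \<times> nat \<Rightarrow> complex" where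
  "sing a = (if a = (0, Suc 0) then 1 else if a = (Suc 0, 0) then - lam else 0)"

lemma qv_one: "qv (Suc 0) 0 * qv (Suc 0) 0 = lam"
  by (simp add: qv_def weight_def field_simps flip: exp_add of_real_mult)

text \<open>e and f annihilate the vector and q fixes it, as in the spin 0 representation;
  \<open>uq_induct\<close> extends this from the generators to U.\<close>

lemma act_sing: "act (Suc 0) (Suc 0) x sing = (\<lambda>a. repE 0 x $$ (0, 0) * sing a)"
proof (induction x rule: uq_induct)
  case (1 x y)
  then show ?case using act_cong[OF 1(1)] repE_cong[OF 1(1)] by simp
next
  case (2 a)
  have gens: "rep_e t 0 $$ (0, 0) = 0" "rep_f t 0 $$ (0, 0) = 0" "rep_q t 0 $$ (0, 0) = 1"
    "rep_qi 0 $$ (0, 0) = 1"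
    by (simp_all add: rep_index qv_def weight_def)
  have c: "rep_coeff t (Suc 0) (Suc 0) = 1"
    using rep_coeff_square[of "Suc 0" "Suc 0"] rep_coeff_pos[of "Suc 0" "Suc 0"] t_pos
    by (simp add: power2_eq_square) (smt (verit) mult_less_cancel_left2 mult_le_cancel_left1)
  show ?case
  proof
    fix p :: "nat \<times> nat"
    consider "p = (0, 0)" | "p = (0, Suc 0)" | "p = (Suc 0, 0)" | "p = (Suc 0, Suc 0)" | "p \<notin> box (Suc 0) (Suc 0)"
      by (cases p) (force simp: le_Suc_eq)
    then show "act (Suc 0) (Suc 0) (Gen a) sing p = repE 0 (Gen a) $$ (0, 0) * sing p"
      by cases (cases a; auto simp: act_e act_f act_q gens sing_def qv_Suc c act_outside
        field_simps qv_one)+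
  qed
next
  case 4
  show ?case by (subst act_one) (auto simp: sing_def)
next
  case (6 x y)
  have "act (Suc 0) (Suc 0) (x \<boxtimes> y) sing a = repE 0 y $$ (0, 0) * (repE 0 x $$ (0, 0) * sing a)" for a
    unfolding act_mult 6(2) act_vec_smult 6(1) ..
  then show ?case
    using mult_mat_index[OF repE_carrier repE_carrier, of 0 0 0 x y]
    by (simp add: fun_eq_iff del: index_mult_mat(1))
qed (auto simp: act_zero act_add act_smult fun_eq_iff algebra_simps)

lemma tcoeff_star:
  assumes "a \<in> box n m" "b \<in> box n m"
  shows "tcoeff n m (EStar x) a b = cnj (tcoeff n m x b a)"
  using assms by (auto simp: tcoeff_def box_def simp flip: comult_sum_cnj)

lemma box_one: "box (Suc 0) (Suc 0) = {(0, 0), (0, Suc 0), (Suc 0, 0), (Suc 0, Suc 0)}"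
  by (auto simp: box_def le_Suc_eq)

lemma sum_box_one: "sum F (box (Suc 0) (Suc 0)) = F (0, 0) + F (0, Suc 0) + F (Suc 0, 0) + F (Suc 0, Suc 0)"
  for F :: "_ \<Rightarrow> complex"
  by (simp add: box_one)

lemma tcoeff_sing_right:
  assumes "a \<in> box (Suc 0) (Suc 0)"
  shows "tcoeff (Suc 0) (Suc 0) x a (0, Suc 0) - lam * tcoeff (Suc 0) (Suc 0) x a (Suc 0, 0) = repE 0 x $$ (0, 0) * sing a"
proof -
  have "act (Suc 0) (Suc 0) x sing a = tcoeff (Suc 0) (Suc 0) x a (0, Suc 0) - lam * tcoeff (Suc 0) (Suc 0) x a (Suc 0, 0)"
    using assms by (simp add: act_def sum_box_one sing_def)
  then show ?thesis by (simp add: act_sing)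
qed

text \<open>The coefficients respect adjoints, so invariance under the adjoint of x, conjugated, is
  invariance of \<open>sing\<close> as a row vector.\<close>

lemma tcoeff_sing_left:
  assumes "a \<in> box (Suc 0) (Suc 0)"
  shows "tcoeff (Suc 0) (Suc 0) x (0, Suc 0) a - lam * tcoeff (Suc 0) (Suc 0) x (Suc 0, 0) a = repE 0 x $$ (0, 0) * sing a"
proof -
  have "cnj (tcoeff (Suc 0) (Suc 0) x (0, Suc 0) a - lam * tcoeff (Suc 0) (Suc 0) x (Suc 0, 0) a) = cnj (repE 0 x $$ (0, 0) * sing a)"
    using tcoeff_sing_right[OF assms, of "EStar x"] assms by (simp add: tcoeff_star sing_def)
  then show ?thesis by (simp only: complex_cnj_cancel_iff)
qed

lemma u_eq: "u (Suc 0) (Suc 0) = (\<lambda>a\<in>A_set. a (Suc 0) $$ (0, 0))" "u 2 (Suc 0) = (\<lambda>a\<in>A_set. a (Suc 0) $$ (Suc 0, 0))"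
  by (simp_all add: u_def)

lemma u_closed: "u (Suc 0) (Suc 0) \<in> B_set" "u 2 (Suc 0) \<in> B_set"
  unfolding u_eq by (auto intro: coordinate_in_B_set)

text \<open>The last two lines say that star sends u_11 to u_22 and u_21 to -\<lambda> u_12: the
  matrix of the u_ij has the shape demanded by SU_\<nu>(2) with \<nu> = \<lambda>^-1.\<close>

lemma hat_u:
  "hat (u (Suc 0) (Suc 0)) x = repE (Suc 0) x $$ (0, 0)" "hat (u 2 (Suc 0)) x = repE (Suc 0) x $$ (Suc 0, 0)"
  "hat (star (B_alg t) (u (Suc 0) (Suc 0))) x = repE (Suc 0) x $$ (Suc 0, Suc 0)"
  "hat (star (B_alg t) (u 2 (Suc 0))) x = - lam * repE (Suc 0) x $$ (0, Suc 0)"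
proof -
  show 1: "hat (u (Suc 0) (Suc 0)) x = repE (Suc 0) x $$ (0, 0)" "hat (u 2 (Suc 0)) x = repE (Suc 0) x $$ (Suc 0, 0)" for x
    unfolding u_eq by (simp_all add: hat_coordinate)
  show "hat (star (B_alg t) (u (Suc 0) (Suc 0))) x = repE (Suc 0) x $$ (Suc 0, Suc 0)"
    "hat (star (B_alg t) (u 2 (Suc 0))) x = - lam * repE (Suc 0) x $$ (0, Suc 0)"
    unfolding hat_star[OF u_closed(1)] hat_star[OF u_closed(2)] 1 repE_tau by simp_all
qed

text \<open>A product of two of these functionals is, up to a scalar, an entry of the tensor square
  of spin 1/2 with the legs exchanged by the flip. The five relations then come from single entries
  of the row and column equations of \<open>sing\<close>.\<close>

lemma su_alg_B:
  assumes "\<nu> = inverse (exp t)"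
  shows "su_alg (B_alg t) \<nu> (u (Suc 0) (Suc 0)) (u 2 (Suc 0))"
proof -
  interpret staralg "B_alg t" by (rule staralg_B)
  note cl = B_linear_closed B_mult_closed B_star_closed B_one_closed u_closed
  have v: "complex_of_real \<nu> = inverse lam" using assms by simp
  let ?T = "\<lambda>x a b. tcoeff (Suc 0) (Suc 0) x a b" and ?e = "\<lambda>x. repE 0 x $$ (0, 0)"
  have T: "csum x (\<lambda>p r. repE (Suc 0) p $$ (i, j) * repE (Suc 0) r $$ (k, l)) = ?T x (i, k) (j, l)" for x i j k l
    by (simp add: tcoeff_def)
  have hats: "hat (star (B_alg t) (u (Suc 0) (Suc 0)) \<otimes>\<^bsub>B_alg t\<^esub> u (Suc 0) (Suc 0)) x = ?T x (0, Suc 0) (0, Suc 0)"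
    "hat (star (B_alg t) (u 2 (Suc 0)) \<otimes>\<^bsub>B_alg t\<^esub> u 2 (Suc 0)) x = - lam * ?T x (Suc 0, 0) (0, Suc 0)"
    "hat (u (Suc 0) (Suc 0) \<otimes>\<^bsub>B_alg t\<^esub> star (B_alg t) (u (Suc 0) (Suc 0))) x = ?T x (Suc 0, 0) (Suc 0, 0)"
    "hat (u 2 (Suc 0) \<otimes>\<^bsub>B_alg t\<^esub> star (B_alg t) (u 2 (Suc 0))) x = - lam * ?T x (0, Suc 0) (Suc 0, 0)"
    "hat (u (Suc 0) (Suc 0) \<otimes>\<^bsub>B_alg t\<^esub> u 2 (Suc 0)) x = ?T x (Suc 0, 0) (0, 0)"
    "hat (u 2 (Suc 0) \<otimes>\<^bsub>B_alg t\<^esub> u (Suc 0) (Suc 0)) x = ?T x (0, Suc 0) (0, 0)"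
    "hat (u (Suc 0) (Suc 0) \<otimes>\<^bsub>B_alg t\<^esub> star (B_alg t) (u 2 (Suc 0))) x = - lam * ?T x (0, 0) (Suc 0, 0)"
    "hat (star (B_alg t) (u 2 (Suc 0)) \<otimes>\<^bsub>B_alg t\<^esub> u (Suc 0) (Suc 0)) x = - lam * ?T x (0, 0) (0, Suc 0)" for x
    by (simp_all only: hat_mult cl hat_u mult.assoc mult.left_commute[of _ "- lam"] comult_sum_mult_left T)
  have inv: "?T x (0, Suc 0) (0, Suc 0) = ?e x + lam * ?T x (Suc 0, 0) (0, Suc 0)"
    "?T x (0, Suc 0) (Suc 0, 0) = lam * (?T x (Suc 0, 0) (Suc 0, 0) - ?e x)"
    "?T x (0, Suc 0) (0, 0) = lam * ?T x (Suc 0, 0) (0, 0)"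
    "?T x (0, Suc 0) (0, Suc 0) = ?e x + lam * ?T x (0, Suc 0) (Suc 0, 0)"
    "?T x (0, 0) (0, Suc 0) = lam * ?T x (0, 0) (Suc 0, 0)" for x
    using tcoeff_sing_left[of "(0, Suc 0)" x] tcoeff_sing_left[of "(Suc 0, 0)" x] tcoeff_sing_left[of "(0, 0)" x]
      tcoeff_sing_right[of "(0, Suc 0)" x] tcoeff_sing_right[of "(0, 0)" x]
    by (simp_all add: sing_def algebra_simps)
  \<comment> \<open>The same entry is computed once by row invariance and once by column invariance,
    and \<lambda> cancels.\<close>
  have sym: "?T x (Suc 0, 0) (0, Suc 0) = ?T x (0, Suc 0) (Suc 0, 0)" for x
    using inv(1)[of x] inv(4)[of x] by simp
  show ?thesis
  proof
    show "u (Suc 0) (Suc 0) \<in> carrier (B_alg t)" "u 2 (Suc 0) \<in> carrier (B_alg t)" by (simp_all only: B_simps cl)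
    show "star (B_alg t) (u (Suc 0) (Suc 0)) \<otimes>\<^bsub>B_alg t\<^esub> u (Suc 0) (Suc 0) \<oplus>\<^bsub>B_alg t\<^esub> star (B_alg t) (u 2 (Suc 0)) \<otimes>\<^bsub>B_alg t\<^esub> u 2 (Suc 0) = \<one>\<^bsub>B_alg t\<^esub>"
      by (rule B_set_eqI) (simp_all only: cl hat_linear hats hat_one, simp add: inv(1))
    show "u (Suc 0) (Suc 0) \<otimes>\<^bsub>B_alg t\<^esub> star (B_alg t) (u (Suc 0) (Suc 0)) \<oplus>\<^bsub>B_alg t\<^esub>
        (complex_of_real \<nu>)\<^sup>2 \<odot>\<^bsub>B_alg t\<^esub> (u 2 (Suc 0) \<otimes>\<^bsub>B_alg t\<^esub> star (B_alg t) (u 2 (Suc 0))) = \<one>\<^bsub>B_alg t\<^esub>"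
      by (rule B_set_eqI) (simp_all only: cl hat_linear hats hat_one, simp add: inv(2) v power2_eq_square field_simps)
    show "u 2 (Suc 0) \<otimes>\<^bsub>B_alg t\<^esub> star (B_alg t) (u 2 (Suc 0)) = star (B_alg t) (u 2 (Suc 0)) \<otimes>\<^bsub>B_alg t\<^esub> u 2 (Suc 0)"
      by (rule B_set_eqI) (simp_all only: cl hats sym)
    show "u (Suc 0) (Suc 0) \<otimes>\<^bsub>B_alg t\<^esub> u 2 (Suc 0) = complex_of_real \<nu> \<odot>\<^bsub>B_alg t\<^esub> (u 2 (Suc 0) \<otimes>\<^bsub>B_alg t\<^esub> u (Suc 0) (Suc 0))"
      by (rule B_set_eqI) (simp_all only: cl hat_linear hats, simp add: inv(3) v)
    show "u (Suc 0) (Suc 0) \<otimes>\<^bsub>B_alg t\<^esub> star (B_alg t) (u 2 (Suc 0)) = complex_of_real \<nu> \<odot>\<^bsub>B_alg t\<^esub> (star (B_alg t) (u 2 (Suc 0)) \<otimes>\<^bsub>B_alg t\<^esub> u (Suc 0) (Suc 0))"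
      by (rule B_set_eqI) (simp_all only: cl hat_linear hats, simp add: inv(5) v)
  qed
qed

section \<open>The coproduct of B\<close>

lemma B_expansion:
  "\<exists>ps. (\<forall>(n, p)\<in>set ps. p \<in> box n n) \<and> (\<forall>b\<in>B_set. blocks b \<subseteq> {..N} \<longrightarrow>
    b = lcomb (B_alg t) (map (\<lambda>(n, p). (b (component n (unit_mat n p)), \<lambda>a\<in>A_set. a n $$ p)) ps))"
proof -
  obtain qs where qs: "\<And>n. set (qs n) = box n n"
    "\<And>n A. A \<in> carrier_mat (Suc n) (Suc n) \<Longrightarrow> A = lcomb (op_alg n) (map (\<lambda>p. (A $$ p, unit_mat n p)) (qs n))"
    using op_alg_expansion by metis
  \<comment> \<open>The list depends on N alone, so one spanning family serves every b with blocks
    up to N.\<close>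
  define ps where "ps = concat (map (\<lambda>n. map (Pair n) (qs n)) [0..<Suc N])"
  have box: "\<forall>(n, p)\<in>set ps. p \<in> box n n" using qs(1) by (auto simp: ps_def)
  have "b = lcomb (B_alg t) (map (\<lambda>(n, p). (b (component n (unit_mat n p)), \<lambda>a\<in>A_set. a n $$ p)) ps)"
    if b: "b \<in> B_set" "blocks b \<subseteq> {..N}" for b
  proof (rule B_set_eqI)
    let ?L = "map (\<lambda>(n, p). (b (component n (unit_mat n p)), \<lambda>a\<in>A_set. a n $$ p)) ps"
    have L: "snd ` set ?L \<subseteq> carrier (B_alg t)"
      using box by (auto simp: B_simps box_def intro!: coordinate_in_B_set)
    show "lcomb (B_alg t) ?L \<in> B_set"
      using staralg.lcomb_closed[OF staralg_B L] by (simp add: B_simps)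
    show "b \<in> B_set" by (rule b)
    fix x
    have "hat (lcomb (B_alg t) ?L) x = (\<Sum>(c, v)\<leftarrow>?L. c * hat v x)"
      by (rule linear_functional_lcomb[OF staralg_B _ L])
        (auto simp: linear_functional_def B_simps(1) hat_linear)
    also have "\<dots> = (\<Sum>(n, p)\<leftarrow>ps. b (component n (unit_mat n p)) * repE n x $$ p)"
      unfolding map_map
      using box by (intro arg_cong[where f = sum_list] map_cong) (auto simp: hat_coordinate)
    also have "\<dots> = (\<Sum>n\<leftarrow>[0..<Suc N]. \<Sum>p\<leftarrow>qs n. b (component n (unit_mat n p)) * repE n x $$ p)"
      unfolding ps_def map_concat sum_list_concat map_map by (simp add: comp_def)
    also have "\<dots> = (\<Sum>n\<leftarrow>[0..<Suc N]. b (component n (repE n x)))"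
    proof (intro arg_cong[where f = sum_list] map_cong HOL.refl)
      fix n
      have "b (component n (repE n x)) = b (component n (lcomb (op_alg n) (map (\<lambda>p. (repE n x $$ p, unit_mat n p)) (qs n))))"
        using qs(2)[OF repE_carrier[of n x]] by simp
      also have "\<dots> = (\<Sum>p\<leftarrow>qs n. b (component n (unit_mat n p)) * repE n x $$ p)"
        by (subst linear_functional_lcomb[OF staralg_op_alg linear_functional_component[OF b(1)]])
          (auto simp: comp_def mult.commute)
      finally show "(\<Sum>p\<leftarrow>qs n. b (component n (unit_mat n p)) * repE n x $$ p) = b (component n (repE n x))" by simp
    qed
    also have "\<dots> = (\<Sum>n\<in>{..N}. b (component n (repE n x)))"
      by (simp only: interv_sum_list_conv_sum_set_nat set_upt atLeast0LessThan lessThan_Suc_atMost)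
    also have "\<dots> = hat b x"
      using b(2) unfolding hat_def pairingM_def
      by (intro sum.mono_neutral_right) (auto simp: blocks_def)
    finally show "hat b x = hat (lcomb (B_alg t) ?L) x" by simp
  qed
  then show ?thesis using box by blast
qed

lemma linear_functional_eval: "a \<in> A_set \<Longrightarrow> linear_functional (B_alg t) (\<lambda>c. c a)"
  by (simp add: linear_functional_def B_simps)

text \<open>Any tensor with the prescribed pairing is the coproduct: evaluations at elements of A
  separate B, so \<open>tensor_eqI\<close> identifies two such tensors.\<close>

lemma B_comult_eq:
  assumes xs: "set xs \<subseteq> B_set \<times> B_set"
    and eq: "\<And>a a'. a \<in> A_set \<Longrightarrow> a' \<in> A_set \<Longrightarrow> (\<Sum>(v, w)\<leftarrow>xs. v a * w a') = b (\<lambda>n. a n * a' n)"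
  shows "B_comult t b = tcls (B_alg t) (B_alg t) xs"
proof -
  interpret staralg "B_alg t" by (rule staralg_B)
  interpret T: tensor_pair "B_alg t" "B_alg t" by unfold_locales
  have tf: "tensor_functional (\<lambda>c. c a) (\<lambda>c. c a') (tcls (B_alg t) (B_alg t) zs) = (\<Sum>(v, w)\<leftarrow>zs. v a * w a')"
    if "T.valid zs" "a \<in> A_set" "a' \<in> A_set" for zs a a'
    using T.tensor_functional_tcls[OF linear_functional_eval[OF that(2)] linear_functional_eval[OF that(3)] that(1)] .
  have valid: "T.valid xs" using xs by (simp add: B_simps)
  show ?thesis
    unfolding B_comult_def
  proof (rule the_equality)
    show "tcls (B_alg t) (B_alg t) xs \<in> carrier (tensor_alg (B_alg t) (B_alg t)) \<and>
      (\<forall>a\<in>A_set. \<forall>a'\<in>A_set. tensor_functional (\<lambda>c. c a) (\<lambda>c. c a') (tcls (B_alg t) (B_alg t) xs) = b (a \<otimes>\<^bsub>MA\<^esub> a'))"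
      using valid eq by (simp add: T.tcls_closed tf)
    fix T assume T: "T \<in> carrier (tensor_alg (B_alg t) (B_alg t)) \<and>
      (\<forall>a\<in>A_set. \<forall>a'\<in>A_set. tensor_functional (\<lambda>c. c a) (\<lambda>c. c a') T = b (a \<otimes>\<^bsub>MA\<^esub> a'))"
    then obtain ys where ys: "T = tcls (B_alg t) (B_alg t) ys" "T.valid ys" by (auto elim: T.tensor_cases)
    \<comment> \<open>Only finitely many first components occur, so their blocks are bounded and a
      common coordinate list exists.\<close>
    let ?K = "\<Union>v\<in>fst ` set (ys @ xs). blocks v"
    have "finite ?K" using ys(2) xs by (auto intro!: B_set_blocks simp: B_simps)
    then obtain N where N: "?K \<subseteq> {..N}" by (meson finite_nat_set_iff_bounded_le atMost_iff subsetI)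
    obtain ps where ps: "\<forall>(n, p)\<in>set ps. p \<in> box n n"
      "\<forall>b\<in>B_set. blocks b \<subseteq> {..N} \<longrightarrow>
        b = lcomb (B_alg t) (map (\<lambda>(n, p). (b (component n (unit_mat n p)), \<lambda>a\<in>A_set. a n $$ p)) ps)"
      using B_expansion by blast
    let ?\<phi> = "\<lambda>q b. b (component (fst q) (unit_mat (fst q) (snd q)))"
    have "tensor_eq (B_alg t) (B_alg t) ys xs"
    proof (rule T.tensor_eqI[where b = "\<lambda>q. \<lambda>a\<in>A_set. a (fst q) $$ snd q" and \<phi> = ?\<phi> and ps = ps
          and F = "(\<lambda>a c. c a) ` A_set", OF _ ys(2) valid])
      show "(\<lambda>a\<in>A_set. a (fst q) $$ snd q) \<in> carrier (B_alg t)" if "q \<in> set ps" for q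
        using that ps(1) by (auto simp: B_simps box_def intro!: coordinate_in_B_set)
      show "v = lcomb (B_alg t) (map (\<lambda>q. (?\<phi> q v, \<lambda>a\<in>A_set. a (fst q) $$ snd q)) ps)"
        if vw: "(v, w) \<in> set (ys @ xs)" for v w
      proof -
        have "v \<in> B_set" using vw ys(2) xs by (auto simp: B_simps)
        moreover have "blocks v \<subseteq> {..N}" using N vw by force
        ultimately show ?thesis using ps(2) by (simp add: split_def)
      qed
      show "w = w'" if w: "w \<in> carrier (B_alg t)" "w' \<in> carrier (B_alg t)"
        and "\<And>\<psi>. \<psi> \<in> (\<lambda>a c. c a) ` A_set \<Longrightarrow> \<psi> w = \<psi> w'" for w w'
        using w that(3)[OF imageI]
        by (intro extensionalityI[of w A_set w']) (auto simp: B_simps B_set_extensional)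
      show "linear_functional (B_alg t) \<psi>" if "\<psi> \<in> (\<lambda>a c. c a) ` A_set" for \<psi>
        using that by (auto simp: linear_functional_eval)
      fix q and \<psi> :: "((nat \<Rightarrow> complex mat) \<Rightarrow> complex) \<Rightarrow> complex"
      assume "q \<in> set ps" "\<psi> \<in> (\<lambda>a c. c a) ` A_set"
      then obtain a' where a': "a' \<in> A_set" "\<psi> = (\<lambda>c. c a')" by auto
      let ?a = "component (fst q) (unit_mat (fst q) (snd q))"
      have "(\<Sum>(v, w)\<leftarrow>ys. v ?a * w a') = b (\<lambda>n. ?a n * a' n)"
        using T tf[OF ys(2), of ?a a'] a'(1) ys(1) by simp
      also have "\<dots> = (\<Sum>(v, w)\<leftarrow>xs. v ?a * w a')" using eq[of ?a a'] a'(1) by simp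
      finally show "(\<Sum>(v, w)\<leftarrow>ys. ?\<phi> q v * \<psi> w) = (\<Sum>(v, w)\<leftarrow>xs. ?\<phi> q v * \<psi> w)"
        by (simp add: a'(2))
    qed
    then show "T = tcls (B_alg t) (B_alg t) xs" unfolding ys(1) by (rule T.tcls_eqI)
  qed
qed

section \<open>The homomorphism \<theta> and its compatibility with coproduct and counit\<close>

definition thetaE :: "su_gen expr \<Rightarrow> (nat \<Rightarrow> complex mat) \<Rightarrow> complex" where
  "thetaE = interp (B_alg t) (case_su_gen (u (Suc 0) (Suc 0)) (u 2 (Suc 0)))"

lemma thetaE_closed: "thetaE x \<in> B_set"
proof -
  have "case_su_gen (u (Suc 0) (Suc 0)) (u 2 (Suc 0)) a \<in> carrier (B_alg t)" for a
    using u_closed by (cases a) (simp_all add: B_simps)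
  from staralg.interp_closed[OF staralg_B this] show ?thesis by (simp only: thetaE_def B_simps)
qed

lemma thetaE_simps:
  "thetaE (Gen Galpha) = u (Suc 0) (Suc 0)" "thetaE (Gen Ggamma) = u 2 (Suc 0)"
  "thetaE EZero = \<zero>\<^bsub>B_alg t\<^esub>" "thetaE EOne = \<one>\<^bsub>B_alg t\<^esub>"
  "thetaE (x \<boxplus> y) = thetaE x \<oplus>\<^bsub>B_alg t\<^esub> thetaE y" "thetaE (x \<boxtimes> y) = thetaE x \<otimes>\<^bsub>B_alg t\<^esub> thetaE y"
  "thetaE (c \<boxdot> x) = c \<odot>\<^bsub>B_alg t\<^esub> thetaE x" "thetaE (EStar x) = star (B_alg t) (thetaE x)"
  by (simp_all add: thetaE_def)

text \<open>The coproduct of SU_\<nu>(2) is dual to the product of U. On generators this is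
  multiplication of 2 by 2 matrices; the star step uses that \<open>tau\<close> is multiplicative,
  and the product step that the coproduct of U is.\<close>

lemma hat_thetaE_mult:
  assumes "\<nu> = inverse (exp t)"
  shows "comult_sum (su_delta \<nu>) x (\<lambda>y z. hat (thetaE y) X * hat (thetaE z) X') = hat (thetaE x) (X \<boxtimes> X')"
proof (induction x arbitrary: X X')
  case (Gen a)
  have v: "complex_of_real \<nu> = inverse lam" using assms by simp
  have mult: "(repE (Suc 0) X * repE (Suc 0) X') $$ (i, 0) = repE (Suc 0) X $$ (i, 0) * repE (Suc 0) X' $$ (0, 0) + repE (Suc 0) X $$ (i, Suc 0) * repE (Suc 0) X' $$ (Suc 0, 0)"
    if "i \<le> Suc 0" for i
    unfolding mult_mat_index[OF repE_carrier repE_carrier that le0] by simp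
  show ?case
    by (cases a) (simp_all add: su_delta_def thetaE_simps hat_u hat_linear B_star_closed
      u_closed mult v del: index_mult_mat(1))
next
  case EZero
  then show ?case by (simp add: thetaE_simps hat_linear)
next
  case EOne
  then show ?case
    using mult_mat_index[OF repE_carrier repE_carrier, of 0 0 0 X X']
    by (simp add: thetaE_simps hat_one del: index_mult_mat(1))
next
  case (EAdd x y)
  then show ?case by (simp add: thetaE_simps hat_linear thetaE_closed)
next
  case (EScale c x)
  then show ?case by (simp add: thetaE_simps hat_linear thetaE_closed comult_sum_mult_left mult.assoc)
next
  case (EStar x)
  have "comult_sum (su_delta \<nu>) (EStar x) (\<lambda>y z. hat (thetaE y) X * hat (thetaE z) X') =
      cnj (comult_sum (su_delta \<nu>) x (\<lambda>y z. hat (thetaE y) (tau X) * hat (thetaE z) (tau X')))"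
    by (simp add: thetaE_simps hat_star thetaE_closed flip: comult_sum_cnj)
  also have "\<dots> = hat (thetaE (EStar x)) (X \<boxtimes> X')"
    by (simp add: EStar thetaE_simps hat_star thetaE_closed)
  finally show ?case .
next
  case (EMul x y)
  let ?cs = "comult_sum (su_delta \<nu>)"
  have "?cs (x \<boxtimes> y) (\<lambda>y z. hat (thetaE y) X * hat (thetaE z) X') =
    ?cs x (\<lambda>y1 z1. ?cs y (\<lambda>y2 z2.
      csum X (\<lambda>p r. csum X' (\<lambda>p' r'. (hat (thetaE y2) p * hat (thetaE y1) r) * (hat (thetaE z2) p' * hat (thetaE z1) r')))))"
    by (simp add: thetaE_simps hat_mult thetaE_closed comult_sum_mult_left comult_sum_mult_right)
  \<comment> \<open>The coproducts of SU_\<nu>(2) and of U run over different variables, so they can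
    be exchanged; the four factors then regroup into the two induction hypotheses.\<close>
  also have "\<dots> = csum X (\<lambda>p r. csum X' (\<lambda>p' r'. ?cs x (\<lambda>y1 z1. ?cs y (\<lambda>y2 z2.
      (hat (thetaE y2) p * hat (thetaE y1) r) * (hat (thetaE z2) p' * hat (thetaE z1) r')))))"
    by (simp only: comult_sum_swap[of "su_delta \<nu>" _ uq_delta])
  also have "\<dots> = csum X (\<lambda>p r. csum X' (\<lambda>p' r'. ?cs x (\<lambda>y1 z1. ?cs y (\<lambda>y2 z2.
      (hat (thetaE y2) p * hat (thetaE z2) p') * (hat (thetaE y1) r * hat (thetaE z1) r')))))"
    by (simp only: ac_simps)
  also have "\<dots> = csum X (\<lambda>p r. csum X' (\<lambda>p' r'. hat (thetaE y) (p \<boxtimes> p') * hat (thetaE x) (r \<boxtimes> r')))"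
    by (simp only: comult_sum_mult_left comult_sum_mult_right EMul.IH)
  also have "\<dots> = hat (thetaE (x \<boxtimes> y)) (X \<boxtimes> X')"
    by (simp add: thetaE_simps hat_mult thetaE_closed)
  finally show ?case .
qed

text \<open>Lifts of \<open>a\<close> and \<open>a'\<close> on the blocks of all functionals
  involved transfer the identity from U to A, since the product of the lifts lifts the
  product.\<close>

lemma thetaE_mult:
  assumes "\<nu> = inverse (exp t)" "a \<in> A_set" "a' \<in> A_set"
  shows "comult_sum (su_delta \<nu>) x (\<lambda>y z. thetaE y a * thetaE z a') = thetaE x (\<lambda>n. a n * a' n)"
proof -
  let ?D = "expr_comult (su_delta \<nu>) x"
  let ?K = "blocks (thetaE x) \<union> (\<Union>p\<in>set ?D. blocks (thetaE (fst p)) \<union> blocks (thetaE (snd p)))"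
  have K: "finite ?K" using B_set_blocks[OF thetaE_closed] by auto
  obtain X where X: "\<forall>k\<in>?K. repE k X = a k" using exists_expr[OF K] A_set_carrier[OF assms(2)] by blast
  obtain X' where X': "\<forall>k\<in>?K. repE k X' = a' k" using exists_expr[OF K] A_set_carrier[OF assms(3)] by blast
  have "comult_sum (su_delta \<nu>) x (\<lambda>y z. thetaE y a * thetaE z a') =
      comult_sum (su_delta \<nu>) x (\<lambda>y z. hat (thetaE y) X * hat (thetaE z) X')"
    unfolding comult_sum_def
  proof (intro arg_cong[where f = sum_list] map_cong HOL.refl)
    fix p assume p: "p \<in> set ?D"
    have "hat (thetaE (fst p)) X = thetaE (fst p) a"
      using p X by (intro hat_eq thetaE_closed assms) auto
    moreover have "hat (thetaE (snd p)) X' = thetaE (snd p) a'"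
      using p X' by (intro hat_eq thetaE_closed assms) auto
    ultimately show "(case p of (y, z) \<Rightarrow> thetaE y a * thetaE z a') =
        (case p of (y, z) \<Rightarrow> hat (thetaE y) X * hat (thetaE z) X')"
      by (simp add: split_def)
  qed
  also have "\<dots> = hat (thetaE x) (X \<boxtimes> X')" by (rule hat_thetaE_mult[OF assms(1)])
  also have "\<dots> = thetaE x (\<lambda>n. a n * a' n)"
    using X X' by (intro hat_eq thetaE_closed A_set_mult assms) auto
  finally show ?thesis .
qed

lemma counit_thetaE: "B_counit (thetaE x) = interp complex_alg (case_su_gen 1 0) x"
proof -
  \<comment> \<open>The identity of M(A) is the family \<pi>_n(1), so the counit of B is evaluation
    at 1.\<close>
  have "B_counit b = hat b EOne" for b by (simp add: B_counit_def hat_def pairingM_def)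
  moreover have "hat (thetaE x) EOne = interp complex_alg (case_su_gen 1 0) x"
  proof (induction x)
    case (Gen a)
    then show ?case by (cases a) (simp_all add: thetaE_simps hat_u)
  qed (simp_all add: thetaE_simps hat_linear hat_one hat_mult hat_star thetaE_closed complex_alg_def)
  ultimately show ?thesis by simp
qed

end

theorem proposition5p5:
  fixes t lam \<nu> :: real
  assumes "t > 0" and "lam = exp t" and "\<nu> = inverse lam"
  shows "\<exists>\<theta>. \<theta> \<in> star_homs (su \<nu>) (B_alg t) \<and>
             \<theta> (su_alpha \<nu>) = u 1 1 \<and>
             \<theta> (su_gamma \<nu>) = u 2 1 \<and>
             \<theta> \<in> coalgebra_homs (su \<nu>) (su_comult \<nu>) (su_counit \<nu>)
                                 (B_alg t) (B_comult t) B_counit"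
  unfolding One_nat_def
proof -
  interpret quantum t by unfold_locales (rule assms(1))
  have \<nu>: "\<nu> = inverse (exp t)" using assms(2,3) by simp
  interpret B: su_alg "B_alg t" \<nu> "u (Suc 0) (Suc 0)" "u 2 (Suc 0)" by (rule su_alg_B[OF \<nu>])
  interpret P: su_alg "su \<nu>" \<nu> "su_alpha \<nu>" "su_gamma \<nu>" by (rule su_alg_su)
  interpret PP: tensor_pair "su \<nu>" "su \<nu>" by unfold_locales
  let ?S = "su_relations \<nu>"
  define \<theta> where "\<theta> = lift ?S (B_alg t) (case_su_gen (u (Suc 0) (Suc 0)) (u 2 (Suc 0)))"
  have \<theta>_cls: "\<theta> (cls ?S x) = thetaE x" for x
    unfolding \<theta>_def thetaE_def by (rule B.lift_su)
  have hom: "\<theta> \<in> star_homs (su \<nu>) (B_alg t)"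
    unfolding \<theta>_def by (rule B.lift_su_star_homs)
  then have lin: "\<theta> \<in> linear_maps (su \<nu>) (B_alg t)" by (simp add: star_homs_def)
  have "B_comult t (\<theta> (cls ?S x)) = tensor_map (B_alg t) (B_alg t) \<theta> \<theta> (su_comult \<nu> (cls ?S x)) \<and>
      B_counit (\<theta> (cls ?S x)) = su_counit \<nu> (cls ?S x)" for x
  proof
    have "PP.valid (map (map_prod (cls ?S) (cls ?S)) (expr_comult (su_delta \<nu>) x))"
      by (auto simp: su_def)
    then have "tensor_map (B_alg t) (B_alg t) \<theta> \<theta> (su_comult \<nu> (cls ?S x)) =
        tcls (B_alg t) (B_alg t) (map (map_prod thetaE thetaE) (expr_comult (su_delta \<nu>) x))"
      unfolding su_comult_cls
      by (simp add: PP.tensor_map_tcls[OF staralg_B staralg_B lin lin] \<theta>_cls comp_def split_def map_prod_def)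
    also have "\<dots> = B_comult t (thetaE x)"
    \<comment> \<open>The coproduct of B is characterized by its pairing with pairs from A, which
      \<open>thetaE_mult\<close> computes for the image of the coproduct of x.\<close>
    proof (rule B_comult_eq[symmetric])
      show "set (map (map_prod thetaE thetaE) (expr_comult (su_delta \<nu>) x)) \<subseteq> B_set \<times> B_set"
        by (auto simp: thetaE_closed)
      show "(\<Sum>(v, w)\<leftarrow>map (map_prod thetaE thetaE) (expr_comult (su_delta \<nu>) x). v a * w a') =
          thetaE x (\<lambda>n. a n * a' n)" if "a \<in> A_set" "a' \<in> A_set" for a a'
        using thetaE_mult[OF \<nu> that, of x] by (simp add: comult_sum_def comp_def split_def)
    qed
    finally show "B_comult t (\<theta> (cls ?S x)) = tensor_map (B_alg t) (B_alg t) \<theta> \<theta> (su_comult \<nu> (cls ?S x))"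
      by (simp add: \<theta>_cls)
    show "B_counit (\<theta> (cls ?S x)) = su_counit \<nu> (cls ?S x)"
      by (simp only: \<theta>_cls counit_thetaE su_counit_cls)
  qed
  then have "\<theta> \<in> coalgebra_homs (su \<nu>) (su_comult \<nu>) (su_counit \<nu>) (B_alg t) (B_comult t) B_counit"
  proof -
    assume *: "\<And>x. B_comult t (\<theta> (cls ?S x)) = tensor_map (B_alg t) (B_alg t) \<theta> \<theta> (su_comult \<nu> (cls ?S x)) \<and>
      B_counit (\<theta> (cls ?S x)) = su_counit \<nu> (cls ?S x)"
    have "B_comult t (\<theta> X) = tensor_map (B_alg t) (B_alg t) \<theta> \<theta> (su_comult \<nu> X) \<and>
      B_counit (\<theta> X) = su_counit \<nu> X" if X: "X \<in> carrier (su \<nu>)" for X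
    proof -
      obtain x where "X = cls ?S x" using X unfolding su_def by (rule presented_cases)
      then show ?thesis using *[of x] by (simp only:)
    qed
    then show ?thesis using lin unfolding coalgebra_homs_def by blast
  qed
  moreover have "\<theta> (su_alpha \<nu>) = u (Suc 0) (Suc 0)" "\<theta> (su_gamma \<nu>) = u 2 (Suc 0)"
    by (simp_all add: su_alpha_def su_gamma_def gen_eq_cls \<theta>_cls thetaE_simps)
  ultimately show "\<exists>\<theta>. \<theta> \<in> star_homs (su \<nu>) (B_alg t) \<and> \<theta> (su_alpha \<nu>) = u (Suc 0) (Suc 0) \<and>
      \<theta> (su_gamma \<nu>) = u 2 (Suc 0) \<and>
      \<theta> \<in> coalgebra_homs (su \<nu>) (su_comult \<nu>) (su_counit \<nu>) (B_alg t) (B_comult t) B_counit"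
    using hom by (intro exI[of _ \<theta>] conjI)
qed

end
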